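(* Suppose that there is a polynomial-time algorithm $\mathcal A$ that, for any instance of FTFP in which every demand satisfies $r_j\le|\mathbb{F}|$, computes a feasible integral solution whose cost is at most $\rho$ times the optimal value of the LP relaxation of that instance, where $\rho\ge 1$. Then there is a polynomial-time $\rho$-approximation algorithm $\mathcal A'$ for FTFP (with arbitrary demands), i.e. one that outputs a feasible integral solution of cost at most $\rho$ times the optimum.
   Context: FTFP (Fault-Tolerant Facility Placement): given a finite set $\mathbb{F}$ of sites and a finite set $\mathbb{C}$ of clients, an opening cost $f_i\ge 0$ for each site $i$, connection costs $d_{ij}\ge 0$ forming a metric, and a positive integer demand $r_j$ for each client $j$. Any number of facilities may be opened at a site; a feasible integral solution consists of nonnegative integers $y_i$ and $x_{ij}$ with $x_{ij}\le y_i$ and $\sum_{i}x_{ij}\ge r_j$; its cost is $\sum_i f_iy_i+\sum_{i,j}d_{ij}x_{ij}$. The LP relaxation is the same program with real $x_{ij},y_i\ge 0$; its optimal value is at most the optimal integral cost. *)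

theory Defs
  imports Complex_Main "HOL-Computational_Algebra.Polynomial" "HOL-Library.Log_Nat"
begin

section \<open>Polynomial time\<close>

text \<open>
  The machine model is a one-variable WHILE language over binary trees (in the style of
  N. D. Jones, \<^emph>\<open>Computability and Complexity\<close>), with binary integers at the leaves and
  logarithmic-cost arithmetic.  A program transforms one tree into another.  Every elementary
  operation is charged the full size (in bits) of its argument and of its result, so that sharing
  of subtrees and growth of integers by repeated multiplication are both paid for.  The model is
  polynomially equivalent to Turing machines.
\<close>

datatype tree = Atom int | Node tree tree

fun tsize :: "tree \<Rightarrow> nat" where
  "tsize (Atom k) = 1 + floorlog 2 (nat \<bar>k\<bar>)"
| "tsize (Node u v) = 1 + tsize u + tsize v"

datatype oper = Copy | Const tree | Left | Right | IsAtom | Less | Add | Sub | Mul | Div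

text \<open>The atom 0 serves as false, as the empty list, and as the result of ill-typed operations.\<close>

fun apply_op :: "oper \<Rightarrow> tree \<Rightarrow> tree" where
  "apply_op Copy u = u"
| "apply_op (Const c) u = c"
| "apply_op Left (Node u v) = u"
| "apply_op Right (Node u v) = v"
| "apply_op IsAtom (Atom a) = Atom 1"
| "apply_op Less (Node (Atom a) (Atom b)) = Atom (if a < b then 1 else 0)"
| "apply_op Add (Node (Atom a) (Atom b)) = Atom (a + b)"
| "apply_op Sub (Node (Atom a) (Atom b)) = Atom (a - b)"
| "apply_op Mul (Node (Atom a) (Atom b)) = Atom (a * b)"
| "apply_op Div (Node (Atom a) (Atom b)) = Atom (a div b)"
| "apply_op _ _ = Atom 0"

datatype prog =
    Op oper
  | Seq prog prog
  | Fork prog prog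
  | Cond prog prog prog
  | While prog prog

text \<open>\<open>run P u v t\<close>: program \<open>P\<close> started on \<open>u\<close> halts with result \<open>v\<close> after time \<open>t\<close>.\<close>

inductive run :: "prog \<Rightarrow> tree \<Rightarrow> tree \<Rightarrow> nat \<Rightarrow> bool" where
  Op: "run (Op a) u (apply_op a u) (1 + tsize u + tsize (apply_op a u))"
| Seq: "run P u v s \<Longrightarrow> run Q v w t \<Longrightarrow> run (Seq P Q) u w (s + t)"
| Fork: "run P u v s \<Longrightarrow> run Q u w t \<Longrightarrow> run (Fork P Q) u (Node v w) (1 + s + t)"
| CondTrue: "run B u b r \<Longrightarrow> b \<noteq> Atom 0 \<Longrightarrow> run P u v s \<Longrightarrow> run (Cond B P Q) u v (1 + r + s)"
| CondFalse: "run B u (Atom 0) r \<Longrightarrow> run Q u v s \<Longrightarrow> run (Cond B P Q) u v (1 + r + s)"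
| WhileTrue: "run B u b r \<Longrightarrow> b \<noteq> Atom 0 \<Longrightarrow> run P u v s \<Longrightarrow> run (While B P) v w t
    \<Longrightarrow> run (While B P) u w (1 + r + s + t)"
| WhileFalse: "run B u (Atom 0) r \<Longrightarrow> run (While B P) u u (1 + r)"

inductive_cases run_OpE: "run (Op a) u v t"
inductive_cases run_SeqE: "run (Seq P Q) u v t"
inductive_cases run_ForkE: "run (Fork P Q) u v t"
inductive_cases run_CondE: "run (Cond B P Q) u v t"
inductive_cases run_WhileE: "run (While B P) u v t"

lemma run_deterministic:
  assumes "run P u v s" and "run P u w t"
  shows "v = w \<and> s = t"
  using assms
proof (induction arbitrary: w t rule: run.induct)
  case Op
  then show ?case by (auto elim: run_OpE)
next
  case (Seq P u v s Q w' t')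
  from Seq.prems show ?case
    by (rule run_SeqE) (auto dest!: Seq.IH)
next
  case (Fork P u v s Q w' t')
  from Fork.prems show ?case
    by (rule run_ForkE) (auto dest!: Fork.IH)
next
  case (CondTrue B u b r P v s Q)
  from CondTrue.prems show ?case
    by (rule run_CondE) (use CondTrue.hyps(2) in \<open>auto dest!: CondTrue.IH\<close>)+
next
  case (CondFalse B u r Q v s P)
  from CondFalse.prems show ?case
    by (rule run_CondE) (auto dest!: CondFalse.IH)+
next
  case (WhileTrue B u b r P v s w' t')
  from WhileTrue.prems show ?case
    by (rule run_WhileE) (use WhileTrue.hyps(2) in \<open>auto dest!: WhileTrue.IH\<close>)+
next
  case (WhileFalse B u r P)
  from WhileFalse.prems show ?case
    by (rule run_WhileE) (auto dest!: WhileFalse.IH)+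
qed

lemma tsize_le_time: "run P u v t \<Longrightarrow> tsize u \<le> t \<and> tsize v \<le> t"
  by (induction rule: run.induct) auto

definition returns :: "prog \<Rightarrow> tree \<Rightarrow> tree \<Rightarrow> bool" where
  "returns P u v \<longleftrightarrow> (\<exists>t. run P u v t)"

definition polytime_on :: "tree set \<Rightarrow> prog \<Rightarrow> bool" where
  "polytime_on U P \<longleftrightarrow>
     (\<exists>p :: nat poly. \<forall>u\<in>U. \<exists>v t. run P u v t \<and> t \<le> poly p (tsize u))"


section \<open>Fault-tolerant facility placement\<close>

text \<open>
  The sites are \<open>{..<num_sites I}\<close> and the clients \<open>{..<num_clients I}\<close>.  Costs are rational,
  so that instances are finite objects that can be given to a program.
\<close>

record ftfp =
  num_sites :: nat
  num_clients :: nat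
  open_cost :: "nat \<Rightarrow> rat"
  conn_cost :: "nat \<Rightarrow> nat \<Rightarrow> rat"
  demand :: "nat \<Rightarrow> nat"

abbreviation sites :: "ftfp \<Rightarrow> nat set" where
  "sites I \<equiv> {..<num_sites I}"

abbreviation clients :: "ftfp \<Rightarrow> nat set" where
  "clients I \<equiv> {..<num_clients I}"

text \<open>
  The site-client costs are the distances of a metric on the disjoint union of sites and clients;
  different points may be at distance 0 (several sites and clients at the same location).
\<close>

definition metric_costs :: "ftfp \<Rightarrow> bool" where
  "metric_costs I \<longleftrightarrow>
     (\<exists>D :: nat + nat \<Rightarrow> nat + nat \<Rightarrow> real.
        (\<forall>a \<in> sites I <+> clients I. D a a = 0) \<and>
        (\<forall>a \<in> sites I <+> clients I. \<forall>b \<in> sites I <+> clients I. 0 \<le> D a b \<and> D a b = D b a) \<and>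
        (\<forall>a \<in> sites I <+> clients I. \<forall>b \<in> sites I <+> clients I. \<forall>c \<in> sites I <+> clients I.
           D a c \<le> D a b + D b c) \<and>
        (\<forall>i \<in> sites I. \<forall>j \<in> clients I. D (Inl i) (Inr j) = of_rat (conn_cost I i j)))"

definition ftfp_instance :: "ftfp \<Rightarrow> bool" where
  "ftfp_instance I \<longleftrightarrow>
     (\<forall>i \<in> sites I. 0 \<le> open_cost I i) \<and>
     (\<forall>i \<in> sites I. \<forall>j \<in> clients I. 0 \<le> conn_cost I i j) \<and>
     metric_costs I \<and>
     (\<forall>j \<in> clients I. 0 < demand I j)"

definition lp_feasible :: "ftfp \<Rightarrow> (nat \<Rightarrow> real) \<Rightarrow> (nat \<Rightarrow> nat \<Rightarrow> real) \<Rightarrow> bool" where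
  "lp_feasible I y x \<longleftrightarrow>
     (\<forall>i \<in> sites I. 0 \<le> y i) \<and>
     (\<forall>i \<in> sites I. \<forall>j \<in> clients I. 0 \<le> x i j \<and> x i j \<le> y i) \<and>
     (\<forall>j \<in> clients I. (\<Sum>i \<in> sites I. x i j) \<ge> real (demand I j))"

definition lp_cost :: "ftfp \<Rightarrow> (nat \<Rightarrow> real) \<Rightarrow> (nat \<Rightarrow> nat \<Rightarrow> real) \<Rightarrow> real" where
  "lp_cost I y x =
     (\<Sum>i \<in> sites I. of_rat (open_cost I i) * y i) +
     (\<Sum>i \<in> sites I. \<Sum>j \<in> clients I. of_rat (conn_cost I i j) * x i j)"

definition lp_opt :: "ftfp \<Rightarrow> real" where
  "lp_opt I = Inf {lp_cost I y x | y x. lp_feasible I y x}"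

definition int_feasible :: "ftfp \<Rightarrow> (nat \<Rightarrow> nat) \<Rightarrow> (nat \<Rightarrow> nat \<Rightarrow> nat) \<Rightarrow> bool" where
  "int_feasible I y x \<longleftrightarrow>
     (\<forall>i \<in> sites I. \<forall>j \<in> clients I. x i j \<le> y i) \<and>
     (\<forall>j \<in> clients I. (\<Sum>i \<in> sites I. x i j) \<ge> demand I j)"

definition int_cost :: "ftfp \<Rightarrow> (nat \<Rightarrow> nat) \<Rightarrow> (nat \<Rightarrow> nat \<Rightarrow> nat) \<Rightarrow> real" where
  "int_cost I y x = lp_cost I (\<lambda>i. real (y i)) (\<lambda>i j. real (x i j))"

definition int_opt :: "ftfp \<Rightarrow> real" where
  "int_opt I = Inf {int_cost I y x | y x. int_feasible I y x}"


section \<open>Algorithms for FTFP\<close>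

definition enc_nat :: "nat \<Rightarrow> tree" where
  "enc_nat n = Atom (int n)"

definition enc_rat :: "rat \<Rightarrow> tree" where
  "enc_rat q = Node (Atom (fst (quotient_of q))) (Atom (snd (quotient_of q)))"

fun enc_list :: "tree list \<Rightarrow> tree" where
  "enc_list [] = Atom 0"
| "enc_list (u # us) = Node u (enc_list us)"

definition enc_vec :: "('a \<Rightarrow> tree) \<Rightarrow> nat \<Rightarrow> (nat \<Rightarrow> 'a) \<Rightarrow> tree" where
  "enc_vec e m v = enc_list (map (\<lambda>i. e (v i)) [0..<m])"

definition enc_mat :: "('a \<Rightarrow> tree) \<Rightarrow> nat \<Rightarrow> nat \<Rightarrow> (nat \<Rightarrow> nat \<Rightarrow> 'a) \<Rightarrow> tree" where
  "enc_mat e m n M = enc_vec (enc_vec e n) m M"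

definition enc_instance :: "ftfp \<Rightarrow> tree" where
  "enc_instance I =
     Node (enc_vec enc_rat (num_sites I) (open_cost I))
       (Node (enc_mat enc_rat (num_sites I) (num_clients I) (conn_cost I))
         (enc_vec enc_nat (num_clients I) (demand I)))"

definition enc_solution :: "ftfp \<Rightarrow> (nat \<Rightarrow> nat) \<Rightarrow> (nat \<Rightarrow> nat \<Rightarrow> nat) \<Rightarrow> tree" where
  "enc_solution I y x =
     Node (enc_vec enc_nat (num_sites I) y)
       (enc_mat enc_nat (num_sites I) (num_clients I) x)"

definition small_demand_instance :: "ftfp \<Rightarrow> bool" where
  "small_demand_instance I \<longleftrightarrow>
     ftfp_instance I \<and> (\<forall>j \<in> clients I. demand I j \<le> card (sites I))"

definition small_demand_lp_algorithm :: "real \<Rightarrow> prog \<Rightarrow> bool" where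
  "small_demand_lp_algorithm \<rho> A \<longleftrightarrow>
     polytime_on (enc_instance ` {I. small_demand_instance I}) A \<and>
     (\<forall>I. small_demand_instance I \<longrightarrow>
        (\<exists>y x. returns A (enc_instance I) (enc_solution I y x) \<and>
           int_feasible I y x \<and> int_cost I y x \<le> \<rho> * lp_opt I))"

text \<open>
  An instance has no feasible solution exactly if it has clients but no sites; on such an instance
  the algorithm only has to halt in polynomial time.
\<close>

definition approx_algorithm :: "real \<Rightarrow> prog \<Rightarrow> bool" where
  "approx_algorithm \<rho> A \<longleftrightarrow>
     polytime_on (enc_instance ` {I. ftfp_instance I}) A \<and>
     (\<forall>I. ftfp_instance I \<and> (\<exists>y x. int_feasible I y x) \<longrightarrow>
        (\<exists>y x. returns A (enc_instance I) (enc_solution I y x) \<and>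
           int_feasible I y x \<and> int_cost I y x \<le> \<rho> * int_opt I))"

end

theory Submission
  imports Defs
begin

text \<open>
  Let \<open>(y, x)\<close> be a nearly optimal solution of the LP relaxation. Its integral part is kept, and the
  algorithm for small demands is run on the residual instance: if the integral part costs \<open>c\<close>, the
  optimal LP value drops by at least \<open>c\<close>, up to the error of the LP solution. An instance with three
  sites and three clients shows \<open>\<rho> \<ge> 10 / 9\<close>, and as \<open>c\<close> is paid only once, the saving \<open>(\<rho> - 1) * c\<close> pays
  for this error, which is far below the smallest possible positive value of \<open>c\<close>.

  The LP is solved by bisection over its value; each step asks for a strictly positive solution of a
  homogeneous system \<open>b k \<bullet> w > 0\<close>. The perceptron algorithm, run in the norm given by a matrix \<open>Q\<close> close
  to the inverse of \<open>\<Sum>k. b k (b k)\<^sup>T\<close>, either finds a solution or a row with \<open>b k \<bullet> w \<le> 1 / 2\<close> for all \<open>w\<close>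
  with \<open>0 \<le> b i \<bullet> w \<le> 1\<close> for all \<open>i\<close>. In the second case this row is doubled, which a solution that is not
  too close to the boundary allows only a polynomial number of times.
\<close>

section \<open>Polynomial-time functions on encoded data\<close>

text \<open>This shapes the LP solver. Its matrix is stored with integer entries over one fixed
  denominator; as it stays positive semidefinite, the diagonal bounds all entries, and rounding is
  the only thing that can raise the diagonal. These bounds must also hold on systems without a
  solution, because bisection runs the solver on such systems. The integral part is not simply the
  floor. Of each \<open>y i\<close> one unit less than the floor is kept, so that what remains of
  \<open>x i j\<close> still fits below what remains of \<open>y i\<close>; and the kept connections
  are cut off early enough to leave every client a demand of at least 1, which an instance requires.
  A residual demand can then exceed the number of sites, but not twice that number. The bound on
  \<open>\<rho>\<close> is available because the hypothesis compares with the LP optimum and is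
  therefore subject to integrality gaps; at \<open>\<rho> = 1\<close> nothing would be
  saved.\<close>

class tree_code =
  fixes encode :: "'a \<Rightarrow> tree"

instantiation int :: tree_code
begin
definition "encode (k :: int) = Atom k"
instance ..
end

instantiation nat :: tree_code
begin
definition "encode (k :: nat) = Atom (int k)"
instance ..
end

instantiation bool :: tree_code
begin
definition "encode (b :: bool) = Atom (if b then 1 else 0)"
instance ..
end

instantiation prod :: (tree_code, tree_code) tree_code
begin
definition "encode (p :: 'a \<times> 'b) = Node (encode (fst p)) (encode (snd p))"
instance ..
end

instantiation list :: (tree_code) tree_code
begin
definition "encode (xs :: 'a list) = enc_list (map encode xs)"
instance ..
end

abbreviation csize :: "'a::tree_code \<Rightarrow> nat" where
  "csize x \<equiv> tsize (encode x)"

lemma csize_pair: "csize (a, b) = 1 + csize a + csize b"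
  by (simp add: encode_prod_def)

lemma csize_Nil: "csize ([] :: 'a::tree_code list) = 1"
  by (simp add: encode_list_def floorlog_def)

lemma csize_Cons: "csize (a # l) = 1 + csize a + csize l"
  by (simp add: encode_list_def)

lemma csize_list: "csize l = 1 + (\<Sum>a\<leftarrow>l. 1 + csize a)"
  by (induction l) (simp_all add: csize_Nil csize_Cons)

lemma length_le_csize: "length l \<le> csize l"
  by (induction l) (simp_all add: csize_Nil csize_Cons)

lemma csize_le_csize_list: "a \<in> set l \<Longrightarrow> csize a \<le> csize l"
  by (induction l) (auto simp: csize_Cons)

lemma csize_int: "csize (k :: int) = 1 + floorlog 2 (nat \<bar>k\<bar>)"
  by (simp add: encode_int_def)

lemma csize_nat: "csize (k :: nat) = 1 + floorlog 2 k"
  by (simp add: encode_nat_def)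

lemma csize_bool: "csize (b :: bool) \<le> 2"
  by (simp add: encode_bool_def floorlog_def)

lemma floorlog_le_self: "floorlog 2 n \<le> n"
proof (cases "n = 0")
  case False
  have "n < 2 ^ n" by (rule less_exp)
  then show ?thesis using floorlog_leI[of n 2 n] by simp
qed (simp add: floorlog_def)

lemma less_two_power_floorlog: "n < 2 ^ floorlog 2 n"
proof (cases "n = 0")
  case False
  then show ?thesis using floorlog_bounds[of n 2] by simp
qed (simp add: floorlog_def)

lemma floorlog_two_mult: "floorlog 2 (a * b) \<le> floorlog 2 a + floorlog 2 b"
proof -
  have "a * b < 2 ^ floorlog 2 a * 2 ^ floorlog 2 b \<or> a * b = 0"
    using mult_strict_mono'[of a "2 ^ floorlog 2 a" b "2 ^ floorlog 2 b"] less_two_power_floorlog[of a] less_two_power_floorlog[of b] by auto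
  then have "a * b < 2 ^ (floorlog 2 a + floorlog 2 b)"
    by (auto simp: power_add)
  then show ?thesis
    by (intro floorlog_leI) auto
qed

lemma floorlog_two_add: "floorlog 2 (a + b) \<le> 1 + floorlog 2 a + floorlog 2 b"
proof -
  have "a < 2 ^ (floorlog 2 a + floorlog 2 b)"
    by (rule less_le_trans[OF less_two_power_floorlog]) (simp add: power_increasing)
  moreover have "b < 2 ^ (floorlog 2 a + floorlog 2 b)"
    by (rule less_le_trans[OF less_two_power_floorlog]) (simp add: power_increasing)
  ultimately have "a + b < 2 ^ (1 + floorlog 2 a + floorlog 2 b)" by simp
  then show ?thesis
    by (intro floorlog_leI) auto
qed

lemma csize_nat_le: "csize (k :: nat) \<le> 1 + k"
  using floorlog_le_self[of k] by (simp add: csize_nat)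

lemma csize_int_mono: "\<bar>a\<bar> \<le> \<bar>b\<bar> \<Longrightarrow> csize (a :: int) \<le> csize b"
  by (simp add: csize_int floorlog_mono)

lemma csize_add: "csize (a + b :: int) \<le> 1 + csize a + csize b"
proof -
  have "floorlog 2 (nat \<bar>a + b\<bar>) \<le> floorlog 2 (nat \<bar>a\<bar> + nat \<bar>b\<bar>)"
    by (rule floorlog_mono) simp
  also have "\<dots> \<le> 1 + floorlog 2 (nat \<bar>a\<bar>) + floorlog 2 (nat \<bar>b\<bar>)"
    by (rule floorlog_two_add)
  finally show ?thesis by (simp add: csize_int)
qed

lemma csize_uminus: "csize (- a :: int) = csize a"
  by (simp add: csize_int)

lemma csize_mult: "csize (a * b :: int) \<le> csize a + csize b"
  using floorlog_two_mult[of "nat \<bar>a\<bar>" "nat \<bar>b\<bar>"] by (simp add: csize_int abs_mult nat_mult_distrib)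

text \<open>Rounding towards minus infinity can enlarge the magnitude of a negative quotient, but
  never beyond that of the quotient by 1. A negative divisor is handled by negating both
  arguments.\<close>

lemma abs_div_le: "\<bar>a div b\<bar> \<le> \<bar>a :: int\<bar>"
proof -
  have pos: "\<bar>c div d\<bar> \<le> \<bar>c\<bar>" if "d > 0" for c d :: int
  proof (cases "c \<ge> 0")
    case True
    then have "c div d \<le> c div 1" using that by (intro zdiv_mono2) auto
    then show ?thesis using True that by (simp add: pos_imp_zdiv_nonneg_iff)
  next
    case False
    then have "c div 1 \<le> c div d" using that by (intro zdiv_mono2_neg) auto
    moreover have "c div d < 0" using False that by (simp add: pos_imp_zdiv_neg_iff)
    ultimately show ?thesis using False by simp
  qed
  consider "b > 0" | "b = 0" | "- b > 0" by linarith
  then show ?thesis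
  proof cases
    case 3
    then show ?thesis using pos[of "- b" "- a"] by simp
  qed (use pos in auto)
qed

lemma csize_div: "csize (a div b :: int) \<le> csize a"
  by (rule csize_int_mono) (rule abs_div_le)

lemma poly_nat_mono: "a \<le> b \<Longrightarrow> poly (q :: nat poly) a \<le> poly q b"
  by (induction q) (auto intro: add_mono mult_mono)

section \<open>Polynomial bounds and polynomial-time functions\<close>

definition poly_bounded :: "'a::tree_code set \<Rightarrow> ('a \<Rightarrow> nat) \<Rightarrow> bool" where
  "poly_bounded A n \<longleftrightarrow> (\<exists>q :: nat poly. \<forall>x\<in>A. n x \<le> poly q (csize x))"

text \<open>The set \<open>A\<close> of admissible inputs is explicit because some functions, such
  as \<open>hd\<close> or the given algorithm for small demands, are controlled only on part of
  their type.\<close>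

definition ptime :: "'a::tree_code set \<Rightarrow> ('a \<Rightarrow> 'b::tree_code) \<Rightarrow> bool" where
  "ptime A f \<longleftrightarrow>
     (\<exists>P q. \<forall>x\<in>A. \<exists>t. run P (encode x) (encode (f x)) t \<and> t \<le> poly q (csize x))"

named_theorems pt

lemma poly_bounded_const [pt]: "poly_bounded A (\<lambda>x. c)"
  unfolding poly_bounded_def by (rule exI[of _ "[:c:]"]) simp

lemma poly_bounded_add [pt]:
  assumes "poly_bounded A m" "poly_bounded A n"
  shows "poly_bounded A (\<lambda>x. m x + n x)"
proof -
  obtain p q where "\<forall>x\<in>A. m x \<le> poly p (csize x)" "\<forall>x\<in>A. n x \<le> poly q (csize x)"
    using assms unfolding poly_bounded_def by auto
  then have "\<forall>x\<in>A. m x + n x \<le> poly (p + q) (csize x)" by (simp add: add_mono)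
  then show ?thesis unfolding poly_bounded_def by blast
qed

lemma poly_bounded_mult [pt]:
  assumes "poly_bounded A m" "poly_bounded A n"
  shows "poly_bounded A (\<lambda>x. m x * n x)"
proof -
  obtain p q where "\<forall>x\<in>A. m x \<le> poly p (csize x)" "\<forall>x\<in>A. n x \<le> poly q (csize x)"
    using assms unfolding poly_bounded_def by auto
  then have "\<forall>x\<in>A. m x * n x \<le> poly (p * q) (csize x)" by (simp add: mult_mono)
  then show ?thesis unfolding poly_bounded_def by blast
qed

lemma poly_bounded_power [pt]: "poly_bounded A m \<Longrightarrow> poly_bounded A (\<lambda>x. m x ^ k)"
  by (induction k) (auto intro: poly_bounded_const poly_bounded_mult)

lemma poly_bounded_le:
  assumes "poly_bounded A m" "\<And>x. x \<in> A \<Longrightarrow> n x \<le> m x"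
  shows "poly_bounded A n"
  using assms unfolding poly_bounded_def by (meson order_trans)

lemma poly_bounded_csize: "poly_bounded A csize"
  unfolding poly_bounded_def by (rule exI[of _ "[:0, 1:]"]) simp

lemma poly_bounded_compose:
  assumes n: "poly_bounded B n" and f: "poly_bounded A S"
    and "\<And>x. x \<in> A \<Longrightarrow> f x \<in> B" "\<And>x. x \<in> A \<Longrightarrow> csize (f x) \<le> S x"
  shows "poly_bounded A (\<lambda>x. n (f x))"
proof -
  obtain p where p: "\<forall>y\<in>B. n y \<le> poly p (csize y)" using n unfolding poly_bounded_def by auto
  obtain q where q: "\<forall>x\<in>A. S x \<le> poly q (csize x)" using f unfolding poly_bounded_def by auto
  have "n (f x) \<le> poly (pcompose p q) (csize x)" if "x \<in> A" for x
  proof -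
    have "n (f x) \<le> poly p (csize (f x))" using p assms(3) that by blast
    also have "\<dots> \<le> poly p (poly q (csize x))"
      by (rule poly_nat_mono) (use q that assms(4) in \<open>meson order_trans\<close>)
    finally show ?thesis by (simp add: poly_pcompose)
  qed
  then show ?thesis unfolding poly_bounded_def by blast
qed

lemma ptimeI:
  assumes "poly_bounded A T" "\<And>x. x \<in> A \<Longrightarrow> \<exists>t\<le>T x. run P (encode x) (encode (f x)) t"
  shows "ptime A f"
  using assms unfolding ptime_def poly_bounded_def by (meson order_trans)

lemma ptimeD:
  assumes "ptime A f"
  shows "\<exists>P T. poly_bounded A T \<and> (\<forall>x\<in>A. run P (encode x) (encode (f x)) (T x))"
proof -
  obtain P q where "\<forall>x\<in>A. \<exists>t. run P (encode x) (encode (f x)) t \<and> t \<le> poly q (csize x)"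
    using assms unfolding ptime_def by auto
  then obtain T where "\<forall>x\<in>A. run P (encode x) (encode (f x)) (T x) \<and> T x \<le> poly q (csize x)"
    by metis
  then show ?thesis unfolding poly_bounded_def by blast
qed

text \<open>A run is charged for the size of its output, so a time bound is also a size bound. This
  is what makes composition possible.\<close>

lemma poly_bounded_csize_ptime: "ptime A f \<Longrightarrow> poly_bounded A (\<lambda>x. csize (f x))"
proof -
  assume "ptime A f"
  then obtain P T where "poly_bounded A T" "\<forall>x\<in>A. run P (encode x) (encode (f x)) (T x)"
    using ptimeD by blast
  then show ?thesis by (blast intro: poly_bounded_le dest: tsize_le_time)
qed

lemma ptime_mono: "ptime B f \<Longrightarrow> A \<subseteq> B \<Longrightarrow> ptime A f"
  unfolding ptime_def by blast

lemma ptime_cong: "ptime A f \<Longrightarrow> (\<And>x. x \<in> A \<Longrightarrow> f x = g x) \<Longrightarrow> ptime A g"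
  unfolding ptime_def by simp

lemma ptime_compose:
  assumes "ptime B g" "ptime A f" "\<And>x. x \<in> A \<Longrightarrow> f x \<in> B"
  shows "ptime A (\<lambda>x. g (f x))"
proof -
  obtain P S where P: "poly_bounded A S" "\<And>x. x \<in> A \<Longrightarrow> run P (encode x) (encode (f x)) (S x)"
    using ptimeD[OF assms(2)] by blast
  obtain Q T where Q: "poly_bounded B T" "\<And>y. y \<in> B \<Longrightarrow> run Q (encode y) (encode (g y)) (T y)"
    using ptimeD[OF assms(1)] by blast
  have "poly_bounded A (\<lambda>x. T (f x))"
    using poly_bounded_compose[OF Q(1) P(1), of f] assms(3) tsize_le_time[OF P(2)] by blast
  then have "poly_bounded A (\<lambda>x. S x + T (f x))" by (rule poly_bounded_add[OF P(1)])
  then show ?thesis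
    by (rule ptimeI) (use P(2) Q(2) assms(3) in \<open>blast intro: run.Seq\<close>)
qed

lemma ptime_ident [pt]: "ptime A (\<lambda>x. x)"
proof (rule ptimeI)
  show "poly_bounded A (\<lambda>x. 1 + csize x + csize x)"
    by (intro pt poly_bounded_csize)
  show "\<exists>t\<le>1 + csize x + csize x. run (Op Copy) (encode x) (encode x) t" for x :: 'a
    using run.Op[of Copy "encode x"] by auto
qed

lemma ptime_const [pt]: "ptime A (\<lambda>x. c)"
proof (rule ptimeI)
  show "poly_bounded A (\<lambda>x. 1 + csize x + csize c)"
    by (intro pt poly_bounded_csize)
  show "\<exists>t\<le>1 + csize x + csize c. run (Op (Const (encode c))) (encode x) (encode c) t" for x :: 'a
    using run.Op[of "Const (encode c)" "encode x"] by auto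
qed

lemma ptime_pair [pt]:
  assumes "ptime A f" "ptime A g"
  shows "ptime A (\<lambda>x. (f x, g x))"
proof -
  obtain P S where P: "poly_bounded A S" "\<And>x. x \<in> A \<Longrightarrow> run P (encode x) (encode (f x)) (S x)"
    using ptimeD[OF assms(1)] by blast
  obtain Q T where Q: "poly_bounded A T" "\<And>x. x \<in> A \<Longrightarrow> run Q (encode x) (encode (g x)) (T x)"
    using ptimeD[OF assms(2)] by blast
  have "poly_bounded A (\<lambda>x. 1 + S x + T x)" by (intro pt P Q)
  then show ?thesis
  proof (rule ptimeI)
    show "\<exists>t\<le>1 + S x + T x. run (Fork P Q) (encode x) (encode (f x, g x)) t" if "x \<in> A" for x
      using run.Fork[OF P(2) Q(2), OF that that] by (auto simp: encode_prod_def)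
  qed
qed

lemma ptime_op:
  assumes "\<And>x. x \<in> A \<Longrightarrow> apply_op a (encode x) = encode (f x)"
    and "poly_bounded A (\<lambda>x. csize (f x))"
  shows "ptime A f"
proof (rule ptimeI)
  show "poly_bounded A (\<lambda>x. 1 + csize x + csize (f x))"
    by (intro pt poly_bounded_csize assms)
  show "\<exists>t\<le>1 + csize x + csize (f x). run (Op a) (encode x) (encode (f x)) t" if "x \<in> A" for x
    using run.Op[of a "encode x"] assms(1)[OF that] by auto
qed

lemma ptime_compose_UNIV:
  "ptime UNIV g \<Longrightarrow> ptime A f \<Longrightarrow> ptime A (\<lambda>x. g (f x))"
  by (rule ptime_compose) auto

lemma ptime_compose2:
  assumes "ptime UNIV (\<lambda>p. h (fst p) (snd p))" "ptime A f" "ptime A g"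
  shows "ptime A (\<lambda>x. h (f x) (g x))"
  using ptime_compose_UNIV[OF assms(1) ptime_pair[OF assms(2,3)]] by simp

lemma ptime_compose3:
  assumes "ptime UNIV (\<lambda>p. h (fst p) (fst (snd p)) (snd (snd p)))" "ptime A f" "ptime A g" "ptime A k"
  shows "ptime A (\<lambda>x. h (f x) (g x) (k x))"
  using ptime_compose_UNIV[OF assms(1) ptime_pair[OF assms(2) ptime_pair[OF assms(3,4)]]] by simp

lemma ptime_fst [pt]: "ptime A f \<Longrightarrow> ptime A (\<lambda>x. fst (f x))"
proof (erule ptime_compose_UNIV[rotated])
  show "ptime UNIV (fst :: 'b \<times> 'c \<Rightarrow> 'b)"
    by (rule ptime_op[of _ Left])
      (auto simp: encode_prod_def intro: poly_bounded_le[OF poly_bounded_csize])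
qed

lemma ptime_snd [pt]: "ptime A f \<Longrightarrow> ptime A (\<lambda>x. snd (f x))"
proof (erule ptime_compose_UNIV[rotated])
  show "ptime UNIV (snd :: 'b \<times> 'c \<Rightarrow> 'c)"
    by (rule ptime_op[of _ Right])
      (auto simp: encode_prod_def intro: poly_bounded_le[OF poly_bounded_csize])
qed

lemma ptime_int_op2:
  fixes h :: "int \<Rightarrow> int \<Rightarrow> 'c::tree_code"
  assumes "ptime A f" "ptime A g"
    and "\<And>a b. apply_op c (Node (Atom a) (Atom b)) = encode (h a b)"
    and "\<And>a b. csize (h a b) \<le> 2 + csize a + csize b"
  shows "ptime A (\<lambda>x. h (f x) (g x))"
proof (rule ptime_compose2[OF _ assms(1,2)])
  show "ptime UNIV (\<lambda>p. h (fst p) (snd p))"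
  proof (rule ptime_op)
    show "apply_op c (encode p) = encode (h (fst p) (snd p))" for p :: "int \<times> int"
      by (simp add: assms(3) encode_prod_def encode_int_def)
    show "poly_bounded UNIV (\<lambda>p :: int \<times> int. csize (h (fst p) (snd p)))"
    proof (rule poly_bounded_le)
      show "poly_bounded UNIV (\<lambda>p :: int \<times> int. 1 + csize p)" by (intro pt poly_bounded_csize)
      show "csize (h (fst p) (snd p)) \<le> 1 + csize p" for p :: "int \<times> int"
        using assms(4)[of "fst p" "snd p"] by (simp add: encode_prod_def)
    qed
  qed
qed

section \<open>Arithmetic and Boolean operations\<close>

context
  fixes A :: "'a::tree_code set" and f g :: "'a \<Rightarrow> int"
  assumes f: "ptime A f" and g: "ptime A g"
begin

lemma ptime_add [pt]: "ptime A (\<lambda>x. f x + g x)"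
  by (rule ptime_int_op2[OF f g, of Add])
    (use csize_add in \<open>auto simp: encode_int_def[symmetric] intro: le_SucI order_trans\<close>, simp add: encode_int_def)

lemma ptime_diff [pt]: "ptime A (\<lambda>x. f x - g x)"
  by (rule ptime_int_op2[OF f g, of Sub])
    (simp add: encode_int_def, use csize_add[of _ "- _"] in \<open>fastforce simp: csize_uminus intro: le_SucI\<close>)

lemma ptime_mult [pt]: "ptime A (\<lambda>x. f x * g x)"
  by (rule ptime_int_op2[OF f g, of Mul])
    (simp add: encode_int_def, use csize_mult in \<open>fastforce intro: le_SucI\<close>)

lemma ptime_div [pt]: "ptime A (\<lambda>x. f x div g x)"
  by (rule ptime_int_op2[OF f g, of Div])
    (simp add: encode_int_def, use csize_div in \<open>fastforce intro: le_SucI trans_le_add1\<close>)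

lemma ptime_less [pt]: "ptime A (\<lambda>x. f x < g x)"
proof (rule ptime_int_op2[OF f g, of Less])
  show "csize (a < b) \<le> 2 + csize a + csize b" for a b :: int
    by (rule order_trans[OF csize_bool]) simp
qed (simp add: encode_bool_def)

end

text \<open>Each branch has to be controlled only on the inputs that reach it, so a test can guard a
  partial operation.\<close>

lemma ptime_if_set:
  assumes "ptime A b" "ptime {x \<in> A. b x} f" "ptime {x \<in> A. \<not> b x} g"
  shows "ptime A (\<lambda>x. if b x then f x else g x)"
proof -
  obtain B R where B: "poly_bounded A R" "\<And>x. x \<in> A \<Longrightarrow> run B (encode x) (encode (b x)) (R x)"
    using ptimeD[OF assms(1)] by blast
  obtain P S where P: "poly_bounded {x \<in> A. b x} S"
      "\<And>x. x \<in> A \<Longrightarrow> b x \<Longrightarrow> run P (encode x) (encode (f x)) (S x)"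
    using ptimeD[OF assms(2)] by auto
  obtain Q T where Q: "poly_bounded {x \<in> A. \<not> b x} T"
      "\<And>x. x \<in> A \<Longrightarrow> \<not> b x \<Longrightarrow> run Q (encode x) (encode (g x)) (T x)"
    using ptimeD[OF assms(3)] by auto
  \<comment> \<open>\<open>S\<close> and \<open>T\<close> are bounded only on their own branches, so
    the total time is estimated by polynomials in the input size, which are defined on all of
    \<open>A\<close>.\<close>
  obtain p where p: "\<forall>x\<in>{x \<in> A. b x}. S x \<le> poly p (csize x)"
    using P(1) unfolding poly_bounded_def by blast
  obtain q where q: "\<forall>x\<in>{x \<in> A. \<not> b x}. T x \<le> poly q (csize x)"
    using Q(1) unfolding poly_bounded_def by blast
  have "poly_bounded A (\<lambda>x. 1 + R x + (poly p (csize x) + poly q (csize x)))"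
    using B(1) by (intro pt) (auto simp: poly_bounded_def)
  then show ?thesis
  proof (rule ptimeI)
    fix x assume x: "x \<in> A"
    show "\<exists>t\<le>1 + R x + (poly p (csize x) + poly q (csize x)).
        run (Cond B P Q) (encode x) (encode (if b x then f x else g x)) t"
    proof (cases "b x")
      case True
      have "run (Cond B P Q) (encode x) (encode (f x)) (1 + R x + S x)"
        by (rule run.CondTrue[OF B(2)[OF x] _ P(2)[OF x True]]) (simp add: True encode_bool_def)
      then show ?thesis using True p x by (intro exI[of _ "1 + R x + S x"]) (simp add: trans_le_add1)
    next
      case False
      have "run (Cond B P Q) (encode x) (encode (g x)) (1 + R x + T x)"
        by (rule run.CondFalse[OF _ Q(2)[OF x False]]) (use B(2)[OF x] False in \<open>simp add: encode_bool_def\<close>)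
      then show ?thesis using False q x by (intro exI[of _ "1 + R x + T x"]) (simp add: trans_le_add2)
    qed
  qed
qed

lemma ptime_if [pt]:
  "ptime A b \<Longrightarrow> ptime A f \<Longrightarrow> ptime A g \<Longrightarrow> ptime A (\<lambda>x. if b x then f x else g x)"
  by (rule ptime_if_set) (auto elim: ptime_mono)

lemma ptime_not [pt]: "ptime A b \<Longrightarrow> ptime A (\<lambda>x. \<not> b x)"
  by (rule ptime_cong[OF ptime_if[OF _ ptime_const[of _ False] ptime_const[of _ True]]]) auto

lemma ptime_conj [pt]: "ptime A b \<Longrightarrow> ptime A c \<Longrightarrow> ptime A (\<lambda>x. b x \<and> c x)"
  by (rule ptime_cong[OF ptime_if[of _ b c "\<lambda>_. False"]]) (auto intro: pt)

lemma ptime_le_int [pt]: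
  fixes f :: "_ \<Rightarrow> int"
  shows "ptime A f \<Longrightarrow> ptime A g \<Longrightarrow> ptime A (\<lambda>x. f x \<le> g x)"
  by (rule ptime_cong[OF ptime_not[OF ptime_less[of _ g f]]]) auto

lemma ptime_eq_int [pt]:
  fixes f :: "_ \<Rightarrow> int"
  shows "ptime A f \<Longrightarrow> ptime A g \<Longrightarrow> ptime A (\<lambda>x. f x = g x)"
  by (rule ptime_cong[OF ptime_conj[OF ptime_le_int[of A f g] ptime_le_int[of A g f]]]) auto

lemma ptime_max_int [pt]:
  fixes f :: "_ \<Rightarrow> int"
  shows "ptime A f \<Longrightarrow> ptime A g \<Longrightarrow> ptime A (\<lambda>x. max (f x) (g x))"
  unfolding max_def by (intro pt)

lemma ptime_min_int [pt]:
  fixes f :: "_ \<Rightarrow> int"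
  shows "ptime A f \<Longrightarrow> ptime A g \<Longrightarrow> ptime A (\<lambda>x. min (f x) (g x))"
  unfolding min_def by (intro pt)

lemma ptime_abs_int [pt]:
  fixes f :: "_ \<Rightarrow> int"
  shows "ptime A f \<Longrightarrow> ptime A (\<lambda>x. \<bar>f x\<bar>)"
  unfolding abs_if by (subst diff_0[symmetric]) (intro pt)

lemma ptime_uminus_int [pt]:
  fixes f :: "_ \<Rightarrow> int"
  shows "ptime A f \<Longrightarrow> ptime A (\<lambda>x. - f x)"
  by (subst diff_0[symmetric]) (intro pt)

lemma ptime_int [pt]: "ptime A f \<Longrightarrow> ptime A (\<lambda>x. int (f x))"
proof (erule ptime_compose_UNIV[rotated])
  show "ptime UNIV int"
    by (rule ptime_op[of _ Copy])
      (auto simp: encode_int_def encode_nat_def intro: poly_bounded_le[OF poly_bounded_csize])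
qed

text \<open>A natural number and the same integer have equal encodings, so nothing needs to be
  computed once negative inputs have been replaced by 0.\<close>

lemma ptime_nat [pt]: "ptime A f \<Longrightarrow> ptime A (\<lambda>x. nat (f x))"
proof (erule ptime_compose_UNIV[rotated])
  have "ptime UNIV (\<lambda>k. nat (max 0 k))"
  proof (rule ptime_compose[of "{0..}" nat])
    show "ptime {0..} nat"
      by (rule ptime_op[of _ Copy])
        (auto simp: encode_int_def encode_nat_def intro: poly_bounded_le[OF poly_bounded_csize])
  qed (auto intro!: pt)
  then show "ptime UNIV nat"
    by (rule ptime_cong) auto
qed

lemma ptime_nat_of_int:
  assumes "ptime A (\<lambda>x. g x)" "\<And>x. x \<in> A \<Longrightarrow> g x = int (f x)"
  shows "ptime A f"
  by (rule ptime_cong[OF ptime_nat[OF assms(1)]]) (simp add: assms(2))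

context
  fixes A :: "'a::tree_code set" and f g :: "'a \<Rightarrow> nat"
  assumes f: "ptime A f" and g: "ptime A g"
begin

lemma ptime_add_nat [pt]: "ptime A (\<lambda>x. f x + g x)"
  by (rule ptime_nat_of_int[where g = "\<lambda>x. int (f x) + int (g x)"]) (intro pt f g, simp)

lemma ptime_diff_nat [pt]: "ptime A (\<lambda>x. f x - g x)"
  by (rule ptime_nat_of_int[where g = "\<lambda>x. max 0 (int (f x) - int (g x))"]) (intro pt f g, simp)

lemma ptime_mult_nat [pt]: "ptime A (\<lambda>x. f x * g x)"
  by (rule ptime_nat_of_int[where g = "\<lambda>x. int (f x) * int (g x)"]) (intro pt f g, simp)

lemma ptime_div_nat [pt]: "ptime A (\<lambda>x. f x div g x)"
  by (rule ptime_nat_of_int[where g = "\<lambda>x. int (f x) div int (g x)"]) (intro pt f g, simp add: zdiv_int)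

lemma ptime_mod_nat [pt]: "ptime A (\<lambda>x. f x mod g x)"
  by (rule ptime_nat_of_int[where g = "\<lambda>x. int (f x) - int (f x) div int (g x) * int (g x)"])
    (intro pt f g, simp add: minus_div_mult_eq_mod zmod_int)

lemma ptime_less_nat [pt]: "ptime A (\<lambda>x. f x < g x)"
  using ptime_less[OF ptime_int[OF f] ptime_int[OF g]] by simp

lemma ptime_eq_nat [pt]: "ptime A (\<lambda>x. f x = g x)"
  using ptime_eq_int[OF ptime_int[OF f] ptime_int[OF g]] by simp

end

lemma ptime_Suc [pt]: "ptime A f \<Longrightarrow> ptime A (\<lambda>x. Suc (f x))"
  unfolding Suc_eq_plus1 by (intro pt)

section \<open>Loops and folds\<close>

lemma run_while_iterate:
  fixes g :: "'a::tree_code \<Rightarrow> 'a"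
  assumes "\<And>k. k < n \<Longrightarrow> run B (encode ((g ^^ k) s)) (encode True) (R k) \<and>
      run P (encode ((g ^^ k) s)) (encode ((g ^^ Suc k) s)) (T k) \<and> R k + T k \<le> M"
    and "run B (encode ((g ^^ n) s)) (encode False) (R n)" "R n \<le> M"
  shows "\<exists>t\<le>(n + 1) * (1 + M). run (While B P) (encode s) (encode ((g ^^ n) s)) t"
  using assms
proof (induction n arbitrary: s R T)
  case 0
  from 0(2) have "run (While B P) (encode s) (encode s) (1 + R 0)"
    by (intro run.WhileFalse) (simp add: encode_bool_def)
  then show ?case using 0 by auto
next
  case (Suc n)
  have *: "(g ^^ k) (g s) = (g ^^ Suc k) s" for k by (simp add: funpow_swap1)
  have "\<exists>t\<le>(n + 1) * (1 + M). run (While B P) (encode (g s)) (encode ((g ^^ n) (g s))) t"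
  proof (rule Suc.IH[where R = "\<lambda>k. R (Suc k)" and T = "\<lambda>k. T (Suc k)"])
    show "run B (encode ((g ^^ k) (g s))) (encode True) (R (Suc k)) \<and>
      run P (encode ((g ^^ k) (g s))) (encode ((g ^^ Suc k) (g s))) (T (Suc k)) \<and>
      R (Suc k) + T (Suc k) \<le> M" if "k < n" for k
      using Suc.prems(1)[of "Suc k"] that unfolding * by simp
    show "run B (encode ((g ^^ n) (g s))) (encode False) (R (Suc n))" "R (Suc n) \<le> M"
      using Suc.prems(2,3) unfolding * by simp_all
  qed
  then obtain t where t: "t \<le> (n + 1) * (1 + M)"
      "run (While B P) (encode (g s)) (encode ((g ^^ Suc n) s)) t"
    unfolding * by blast
  have "run (While B P) (encode s) (encode ((g ^^ Suc n) s)) (1 + R 0 + T 0 + t)"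
    using Suc.prems(1)[of 0] by (intro run.WhileTrue[OF _ _ _ t(2)]) (auto simp: encode_bool_def)
  moreover have "1 + R 0 + T 0 + t \<le> (Suc n + 1) * (1 + M)"
    using Suc.prems(1)[of 0] t(1) by simp
  ultimately show ?case by blast
qed

text \<open>Iterating the size bound of a single step would not give a polynomial. Hence the
  separate bound \<open>S\<close> on all states that are reached: with it every round costs at most
  a fixed polynomial in \<open>S x\<close>.\<close>

lemma ptime_while:
  assumes step: "ptime B step" and continue: "ptime B continue" and init: "ptime A init"
    and N: "poly_bounded A N" and S: "poly_bounded A S"
    and "\<And>x k. x \<in> A \<Longrightarrow> k \<le> N x \<Longrightarrow> (step ^^ k) (init x) \<in> B"
    and cont: "\<And>x k. x \<in> A \<Longrightarrow> k < N x \<Longrightarrow> continue ((step ^^ k) (init x))"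
    and stop: "\<And>x k. x \<in> A \<Longrightarrow> \<not> continue ((step ^^ N x) (init x))"
    and size: "\<And>x k. x \<in> A \<Longrightarrow> k \<le> N x \<Longrightarrow> csize ((step ^^ k) (init x)) \<le> S x"
  shows "ptime A (\<lambda>x. (step ^^ N x) (init x))"
proof -
  obtain C R where C: "poly_bounded B R" "\<And>x. x \<in> B \<Longrightarrow> run C (encode x) (encode (continue x)) (R x)"
    using ptimeD[OF continue] by blast
  obtain P T where P: "poly_bounded B T" "\<And>x. x \<in> B \<Longrightarrow> run P (encode x) (encode (step x)) (T x)"
    using ptimeD[OF step] by blast
  obtain I U where I: "poly_bounded A U" "\<And>x. x \<in> A \<Longrightarrow> run I (encode x) (encode (init x)) (U x)"
    using ptimeD[OF init] by blast
  obtain p where p: "\<forall>x\<in>B. R x + T x \<le> poly p (csize x)"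
    using poly_bounded_add[OF C(1) P(1)] unfolding poly_bounded_def by auto
  have pS: "poly_bounded A (\<lambda>x. poly p (S x))"
  proof -
    obtain q where "\<forall>x\<in>A. S x \<le> poly q (csize x)" using S unfolding poly_bounded_def by auto
    then have "\<forall>x\<in>A. poly p (S x) \<le> poly (pcompose p q) (csize x)"
      by (simp add: poly_pcompose poly_nat_mono)
    then show ?thesis unfolding poly_bounded_def by blast
  qed
  have "poly_bounded A (\<lambda>x. U x + (N x + 1) * (1 + poly p (S x)))"
    by (intro pt I N pS)
  then show ?thesis
  proof (rule ptimeI)
    fix x assume x: "x \<in> A"
    have M: "R ((step ^^ k) (init x)) + T ((step ^^ k) (init x)) \<le> poly p (S x)" if "k \<le> N x" for k
      using p assms(6)[OF x that] poly_nat_mono[OF size[OF x that], of p] by (meson order_trans)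
    have "\<exists>t\<le>(N x + 1) * (1 + poly p (S x)).
        run (While C P) (encode (init x)) (encode ((step ^^ N x) (init x))) t"
    proof (rule run_while_iterate[where R = "\<lambda>k. R ((step ^^ k) (init x))" and T = "\<lambda>k. T ((step ^^ k) (init x))"])
      show "run C (encode ((step ^^ k) (init x))) (encode True) (R ((step ^^ k) (init x))) \<and>
         run P (encode ((step ^^ k) (init x))) (encode ((step ^^ Suc k) (init x))) (T ((step ^^ k) (init x))) \<and>
         R ((step ^^ k) (init x)) + T ((step ^^ k) (init x)) \<le> poly p (S x)" if "k < N x" for k
        using C(2)[OF assms(6)[OF x, of k]] P(2)[OF assms(6)[OF x, of k]] cont[OF x that] M[of k] that by simp
      show "run C (encode ((step ^^ N x) (init x))) (encode False) (R ((step ^^ N x) (init x)))"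
        using C(2)[OF assms(6)[OF x, of "N x"]] stop[OF x] by simp
      show "R ((step ^^ N x) (init x)) \<le> poly p (S x)" using M[of "N x"] by simp
    qed
    then obtain t where "t \<le> (N x + 1) * (1 + poly p (S x))"
        "run (While C P) (encode (init x)) (encode ((step ^^ N x) (init x))) t" by blast
    then show "\<exists>t\<le>U x + (N x + 1) * (1 + poly p (S x)).
        run (Seq I (While C P)) (encode x) (encode ((step ^^ N x) (init x))) t"
      using run.Seq[OF I(2)[OF x]] by (meson add_le_mono order_refl)
  qed
qed

section \<open>Lists\<close>

lemma ptime_Cons [pt]:
  assumes "ptime A f" "ptime A l"
  shows "ptime A (\<lambda>x. f x # l x)"
  \<comment> \<open>A nonempty list has the same encoding as the pair of its head and tail.\<close>
  using ptime_pair[OF assms] unfolding ptime_def by (simp add: encode_prod_def encode_list_def)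

lemma ptime_null [pt]: "ptime A l \<Longrightarrow> ptime A (\<lambda>x. l x = [])"
proof (erule ptime_compose_UNIV[rotated])
  show "ptime UNIV (\<lambda>l :: 'b list. l = [])"
  proof (rule ptime_op[of _ IsAtom])
    show "apply_op IsAtom (encode l) = encode (l = [])" for l :: "'b list"
      by (cases l) (auto simp: encode_list_def encode_bool_def)
  qed (rule poly_bounded_le[OF poly_bounded_const[of _ 2]], rule csize_bool)
qed

lemma csize_tl_le: "csize (tl l) \<le> csize l"
  by (cases l) (auto simp: csize_Cons)

lemma csize_hd_le: "l \<noteq> [] \<Longrightarrow> csize (hd l) \<le> csize l"
  by (cases l) (auto simp: csize_Cons)

text \<open>On an atom \<open>Right\<close> yields \<open>Atom 0\<close>, which is the encoding of
  the empty list and so agrees with \<open>tl [] = []\<close>. There is no such agreement for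
  \<open>hd\<close>.\<close>

lemma ptime_tl [pt]: "ptime A l \<Longrightarrow> ptime A (\<lambda>x. tl (l x))"
proof (erule ptime_compose_UNIV[rotated])
  show "ptime UNIV (tl :: 'b list \<Rightarrow> 'b list)"
  proof (rule ptime_op[of _ Right])
    show "apply_op Right (encode l) = encode (tl l)" for l :: "'b list"
      by (cases l) (auto simp: encode_list_def)
  qed (rule poly_bounded_le[OF poly_bounded_csize], rule csize_tl_le)
qed

lemma ptime_hd:
  assumes "ptime A l" "\<And>x. x \<in> A \<Longrightarrow> l x \<noteq> []"
  shows "ptime A (\<lambda>x. hd (l x))"
proof (rule ptime_compose[OF _ assms(1)])
  show "ptime {l :: 'b list. l \<noteq> []} hd"
  proof (rule ptime_op[of _ Left])
    show "apply_op Left (encode l) = encode (hd l)" if "l \<in> {l. l \<noteq> []}" for l :: "'b list"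
      using that by (cases l) (auto simp: encode_list_def)
  qed (rule poly_bounded_le[OF poly_bounded_csize], use csize_hd_le in blast)
qed (use assms(2) in simp)

lemma csize_drop_le: "csize (drop k l) \<le> csize l"
  by (induction l arbitrary: k) (auto simp: csize_Cons drop_Cons' intro!: le_SucI trans_le_add2)

text \<open>The loop state consists of the input, the unread part of the list and the accumulator.
  Only the triples in \<open>B\<close> need to be handled by \<open>f\<close>, and the sizes of
  accumulators must be bounded independently of the running time of \<open>f\<close>.\<close>

lemma ptime_foldl:
  assumes l: "ptime A l" and s0: "ptime A s0"
    and f: "ptime B (\<lambda>p. f (fst p) (fst (snd p)) (snd (snd p)))" and S: "poly_bounded A S"
    and inB: "\<And>x k. x \<in> A \<Longrightarrow> k < length (l x) \<Longrightarrow>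
      (x, foldl (f x) (s0 x) (take k (l x)), l x ! k) \<in> B"
    and size: "\<And>x k. x \<in> A \<Longrightarrow> k \<le> length (l x) \<Longrightarrow>
      csize (foldl (f x) (s0 x) (take k (l x))) \<le> S x"
  shows "ptime A (\<lambda>x. foldl (f x) (s0 x) (l x))"
proof -
  define step where "step p = (fst p, tl (fst (snd p)), f (fst p) (snd (snd p)) (hd (fst (snd p))))"
    for p
  define init where "init x = (x, l x, s0 x)" for x
  define C where "C = {p. fst (snd p) = [] \<or> (fst p, snd (snd p), hd (fst (snd p))) \<in> B}"
  \<comment> \<open>The head of an empty list is unspecified, so the step is idle once the list is
    exhausted.\<close>
  define step' where "step' p = (if fst (snd p) = [] then p else step p)" for p
  have iter: "(step' ^^ k) (init x) = (x, drop k (l x), foldl (f x) (s0 x) (take k (l x)))"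
    if "k \<le> length (l x)" for x k
    using that
    by (induction k)
      (auto simp: init_def step'_def step_def tl_drop drop_Suc hd_drop_conv_nth take_Suc_conv_app_nth)
  have "ptime A (\<lambda>x. (step' ^^ length (l x)) (init x))"
  proof (rule ptime_while[of C _ "\<lambda>p. fst (snd p) \<noteq> []"])
    have "ptime {p \<in> C. fst (snd p) \<noteq> []} step"
      unfolding step_def
    proof (intro ptime_pair ptime_tl ptime_fst ptime_snd ptime_ident)
      have "ptime {p \<in> C. fst (snd p) \<noteq> []} (\<lambda>p. (fst p, snd (snd p), hd (fst (snd p))))"
        by (intro pt ptime_hd) auto
      from ptime_compose[OF f this]
      show "ptime {p \<in> C. fst (snd p) \<noteq> []} (\<lambda>p. f (fst p) (snd (snd p)) (hd (fst (snd p))))"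
        by (auto simp: C_def)
    qed
    then show "ptime C step'"
      unfolding step'_def by (intro ptime_if_set pt)
    show "ptime C (\<lambda>p. fst (snd p) \<noteq> [])" by (intro pt)
    show "ptime A init" unfolding init_def by (intro pt l s0)
    show "poly_bounded A (\<lambda>x. length (l x))"
      by (rule poly_bounded_le[OF poly_bounded_csize_ptime[OF l]]) (rule length_le_csize)
    show "poly_bounded A (\<lambda>x. 2 + csize x + csize (l x) + S x)"
      by (intro pt poly_bounded_csize_ptime l S)
    show "(step' ^^ k) (init x) \<in> C" if "x \<in> A" "k \<le> length (l x)" for x k
      using inB[OF that(1), of k] that by (cases "k = length (l x)") (auto simp: C_def iter hd_drop_conv_nth)
    show "fst (snd ((step' ^^ k) (init x))) \<noteq> []" if "x \<in> A" "k < length (l x)" for x k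
      using that by (simp add: iter)
    show "\<not> fst (snd ((step' ^^ length (l x)) (init x))) \<noteq> []" for x
      by (simp add: iter)
    show "csize ((step' ^^ k) (init x)) \<le> 2 + csize x + csize (l x) + S x"
      if "x \<in> A" "k \<le> length (l x)" for x k
      using size[OF that] csize_drop_le[of k "l x"] by (simp add: iter that csize_pair)
  qed
  then have "ptime A (\<lambda>x. snd (snd ((step' ^^ length (l x)) (init x))))" by (intro pt)
  then show ?thesis by (simp add: iter)
qed

lemma ptime_foldl_UNIV:
  assumes "ptime A l" "ptime A s0" "ptime UNIV (\<lambda>p. f (fst p) (fst (snd p)) (snd (snd p)))"
    and "poly_bounded A S" "\<And>x k. x \<in> A \<Longrightarrow> k \<le> length (l x) \<Longrightarrow>
      csize (foldl (f x) (s0 x) (take k (l x))) \<le> S x"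
  shows "ptime A (\<lambda>x. foldl (f x) (s0 x) (l x))"
  by (rule ptime_foldl[OF assms(1-4) _ assms(5)]) auto

lemma foldl_Cons_conv: "foldl (\<lambda>s a. h a # s) ys l = rev (map h l) @ ys"
  by (induction l arbitrary: ys) auto

lemma csize_rev: "csize (rev l) = csize l"
  by (simp add: csize_list rev_map[symmetric])

lemma csize_append: "csize (xs @ ys) \<le> csize xs + csize ys"
  by (simp add: csize_list)

lemma csize_take_le: "csize (take k l) \<le> csize l"
  by (induction l arbitrary: k) (auto simp: csize_Cons csize_Nil take_Cons' trans_le_add2)

lemma ptime_rev_append: "ptime A l \<Longrightarrow> ptime A m \<Longrightarrow> ptime A (\<lambda>x. rev (l x) @ m x)"
proof -
  assume l: "ptime A l" and m: "ptime A m"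
  have "ptime A (\<lambda>x. foldl (\<lambda>s a. a # s) (m x) (l x))"
  proof (rule ptime_foldl_UNIV[OF l m])
    show "poly_bounded A (\<lambda>x. csize (l x) + csize (m x))"
      by (intro pt poly_bounded_csize_ptime l m)
    show "csize (foldl (\<lambda>s a. a # s) (m x) (take k (l x))) \<le> csize (l x) + csize (m x)" for x k
      using csize_append[of "rev (take k (l x))" "m x"] csize_take_le[of k "l x"]
      by (simp add: foldl_Cons_conv[of "\<lambda>a. a", simplified] csize_rev)
  qed (intro pt)
  then show ?thesis by (simp add: foldl_Cons_conv[of "\<lambda>a. a", simplified])
qed

lemma ptime_rev [pt]: "ptime A l \<Longrightarrow> ptime A (\<lambda>x. rev (l x))"
  using ptime_rev_append[of A l "\<lambda>_. []"] by (simp add: pt)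

lemma ptime_append [pt]: "ptime A l \<Longrightarrow> ptime A m \<Longrightarrow> ptime A (\<lambda>x. l x @ m x)"
  using ptime_rev_append[OF ptime_rev] by simp

lemma ptime_map [pt]:
  assumes h: "ptime UNIV (\<lambda>p. h (fst p) (snd p))" and l: "ptime A l"
  shows "ptime A (\<lambda>x. map (\<lambda>a. h x a) (l x))"
proof -
  obtain q where q: "\<forall>p\<in>UNIV. csize (h (fst p) (snd p)) \<le> poly q (csize p)"
    using poly_bounded_csize_ptime[OF h] unfolding poly_bounded_def by blast
  \<comment> \<open>An element of the list paired with \<open>x\<close> has size at most
    \<open>1 + csize x + csize (l x)\<close>, so \<open>M x\<close> bounds the size of every
    image.\<close>
  define M where "M x = poly q (1 + csize x + csize (l x))" for x
  have M: "poly_bounded A M"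
  proof -
    obtain r where r: "\<forall>x\<in>A. 1 + csize x + csize (l x) \<le> poly r (csize x)"
      using poly_bounded_add[OF poly_bounded_add[OF poly_bounded_const[of A 1] poly_bounded_csize]
          poly_bounded_csize_ptime[OF l]]
      unfolding poly_bounded_def by auto
    then have "\<forall>x\<in>A. M x \<le> poly (pcompose q r) (csize x)"
      unfolding M_def by (simp add: poly_pcompose poly_nat_mono)
    then show ?thesis unfolding poly_bounded_def by blast
  qed
  have "ptime A (\<lambda>x. foldl (\<lambda>s a. h x a # s) [] (l x))"
  proof (rule ptime_foldl_UNIV[OF l])
    have "ptime UNIV (\<lambda>p :: 'a \<times> 'c list \<times> 'b. (fst p, snd (snd p)))"
      by (intro pt)
    from ptime_compose_UNIV[OF h this]
    show "ptime UNIV (\<lambda>p. h (fst p) (snd (snd p)) # fst (snd p))"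
      by (intro pt) simp
    show "poly_bounded A (\<lambda>x. 1 + csize (l x) * (1 + M x))"
      by (intro pt poly_bounded_csize_ptime l M)
    show "csize (foldl (\<lambda>s a. h x a # s) [] (take k (l x))) \<le> 1 + csize (l x) * (1 + M x)" for x k
    proof -
      have "csize (h x a) \<le> M x" if "a \<in> set (take k (l x))" for a
      proof -
        have "csize (x, a) \<le> 1 + csize x + csize (l x)"
          using csize_le_csize_list[OF in_set_takeD[OF that]] by (simp add: csize_pair)
        then show ?thesis
          using q poly_nat_mono[of _ _ q] unfolding M_def by (metis UNIV_I fst_conv snd_conv order_trans)
      qed
      then have "(\<Sum>a\<leftarrow>take k (l x). 1 + csize (h x a)) \<le> (\<Sum>a\<leftarrow>take k (l x). 1 + M x)"
        by (intro sum_list_mono) auto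
      also have "\<dots> \<le> csize (l x) * (1 + M x)"
        unfolding sum_list_triv length_take of_nat_id
        by (intro mult_right_mono) (use length_le_csize[of "l x"] in auto)
      finally show ?thesis
        by (simp add: foldl_Cons_conv csize_rev csize_list[of "map _ _"] o_def)
    qed
  qed (intro pt)
  then have "ptime A (\<lambda>x. rev (foldl (\<lambda>s a. h x a # s) [] (l x)))" by (intro pt)
  then show ?thesis by (simp add: foldl_Cons_conv)
qed

lemma csize_filter_le: "csize (filter P l) \<le> csize l"
  by (induction l) (auto simp: csize_Cons)

lemma ptime_filter [pt]:
  assumes h: "ptime UNIV (\<lambda>p. h (fst p) (snd p))" and l: "ptime A l"
  shows "ptime A (\<lambda>x. filter (\<lambda>a. h x a) (l x))"
proof -
  have eq: "foldl (\<lambda>s a. if P a then a # s else s) ys l = rev (filter P l) @ ys" for P and ys l :: "'b list"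
    by (induction l arbitrary: ys) auto
  have "ptime A (\<lambda>x. foldl (\<lambda>s a. if h x a then a # s else s) [] (l x))"
  proof (rule ptime_foldl_UNIV[OF l])
    have "ptime UNIV (\<lambda>p :: 'a \<times> 'b list \<times> 'b. (fst p, snd (snd p)))"
      by (intro pt)
    from ptime_compose_UNIV[OF h this]
    show "ptime UNIV (\<lambda>p. if h (fst p) (snd (snd p)) then snd (snd p) # fst (snd p) else fst (snd p))"
      by (intro pt) simp
    show "poly_bounded A (\<lambda>x. csize (l x))"
      by (intro poly_bounded_csize_ptime l)
    show "csize (foldl (\<lambda>s a. if h x a then a # s else s) [] (take k (l x))) \<le> csize (l x)" for x k
      unfolding eq using order_trans[OF csize_filter_le csize_take_le] by (auto simp: csize_rev)
  qed (intro pt)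
  then have "ptime A (\<lambda>x. rev (foldl (\<lambda>s a. if h x a then a # s else s) [] (l x)))" by (intro pt)
  then show ?thesis by (simp add: eq)
qed

lemma foldl_plus_int: "foldl (+) (c :: int) l = c + sum_list l"
  by (induction l arbitrary: c) auto

lemma foldl_times_int: "foldl (*) (c :: int) l = c * prod_list l"
  by (induction l arbitrary: c) auto

lemma csize_sum_list: "csize (sum_list l :: int) \<le> csize l"
proof (induction l)
  case (Cons a l)
  then show ?case using csize_add[of a "sum_list l"] by (simp add: csize_Cons)
qed (simp add: csize_Nil csize_int floorlog_def)

lemma csize_prod_list: "csize (prod_list l :: int) \<le> 1 + csize l"
proof (induction l)
  case (Cons a l)
  then show ?case using csize_mult[of a "prod_list l"] by (simp add: csize_Cons)
qed (simp add: csize_Nil csize_int floorlog_def)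

lemma ptime_sum_list [pt]:
  fixes l :: "'a::tree_code \<Rightarrow> int list"
  assumes l: "ptime A l"
  shows "ptime A (\<lambda>x. sum_list (l x))"
proof -
  have "ptime A (\<lambda>x. foldl (+) 0 (l x))"
  proof (rule ptime_foldl_UNIV[OF l])
    show "poly_bounded A (\<lambda>x. csize (l x))" by (intro poly_bounded_csize_ptime l)
    show "csize (foldl (+) 0 (take k (l x))) \<le> csize (l x)" for x k
      using order_trans[OF csize_sum_list csize_take_le] by (simp add: foldl_plus_int)
  qed (intro pt)+
  then show ?thesis by (simp add: foldl_plus_int)
qed

lemma ptime_prod_list [pt]:
  fixes l :: "'a::tree_code \<Rightarrow> int list"
  assumes l: "ptime A l"
  shows "ptime A (\<lambda>x. prod_list (l x))"
proof -
  have "ptime A (\<lambda>x. foldl (*) 1 (l x))"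
  proof (rule ptime_foldl_UNIV[OF l])
    show "poly_bounded A (\<lambda>x. 1 + csize (l x))" by (intro pt poly_bounded_csize_ptime l)
    show "csize (foldl (*) 1 (take k (l x))) \<le> 1 + csize (l x)" for x k
      using order_trans[OF csize_prod_list add_left_mono[OF csize_take_le]] by (simp add: foldl_times_int)
  qed (intro pt)+
  then show ?thesis by (simp add: foldl_times_int)
qed

lemma poly_bounded_length [pt]: "ptime A l \<Longrightarrow> poly_bounded A (\<lambda>x. length (l x))"
  by (rule poly_bounded_le[OF poly_bounded_csize_ptime]) (auto intro: length_le_csize)

lemma ptime_length [pt]: "ptime A l \<Longrightarrow> ptime A (\<lambda>x. length (l x))"
proof -
  assume l: "ptime A l"
  have "ptime A (\<lambda>x. sum_list (map (\<lambda>a. 1 :: int) (l x)))" by (intro pt l)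
  then show ?thesis by (rule ptime_nat_of_int) (simp add: sum_list_triv)
qed

text \<open>The bound on the value of \<open>g\<close> is essential: a number may be exponentially
  larger than its binary encoding, and the list has as many entries as its value.\<close>

lemma ptime_upt [pt]:
  assumes g: "ptime A g" "poly_bounded A g"
  shows "ptime A (\<lambda>x. [0..<g x])"
proof -
  define step where "step p = (fst p - 1, (fst p - 1) # snd p)" for p :: "nat \<times> nat list"
  have iter: "(step ^^ k) (n, []) = (n - k, [n - k..<n])" if "k \<le> n" for n k
    using that
  proof (induction k)
    case (Suc k)
    then have "[n - Suc k..<n] = (n - Suc k) # [n - k..<n]"
      by (subst upt_conv_Cons) (auto simp: Suc_diff_Suc)
    with Suc show ?case by (simp add: step_def)
  qed simp
  have "ptime A (\<lambda>x. (step ^^ g x) (g x, []))"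
  proof (rule ptime_while[of UNIV _ "\<lambda>p. 0 < fst p"])
    show "ptime UNIV step" unfolding step_def by (intro pt)
    show "poly_bounded A (\<lambda>x. 3 + g x + g x * (2 + g x))" by (intro pt g)
    show "csize ((step ^^ k) (g x, [])) \<le> 3 + g x + g x * (2 + g x)" if "k \<le> g x" for x k
    proof -
      have "(\<Sum>a\<leftarrow>[g x - k..<g x]. 1 + csize a) \<le> (\<Sum>a\<leftarrow>[g x - k..<g x]. 2 + g x)"
        by (intro sum_list_mono) (use csize_nat_le in \<open>fastforce intro: order_trans\<close>)
      also have "\<dots> \<le> g x * (2 + g x)"
        unfolding sum_list_triv of_nat_id by (intro mult_right_mono) auto
      finally show ?thesis
        using csize_nat_le[of "g x - k"] by (simp add: iter that csize_pair csize_list)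
    qed
  qed (auto simp: iter intro!: pt g)
  then have "ptime A (\<lambda>x. snd ((step ^^ g x) (g x, [])))" by (intro pt)
  then show ?thesis by (simp add: iter)
qed

lemma poly_bounded_floorlog [pt]: "ptime A g \<Longrightarrow> poly_bounded A (\<lambda>x. floorlog 2 (g x))"
  by (rule poly_bounded_le[OF poly_bounded_csize_ptime]) (auto simp: csize_nat)

lemma floorlog_div2: "0 < n \<Longrightarrow> floorlog 2 n = Suc (floorlog 2 (n div 2))"
  by (subst compute_floorlog) auto

lemma ptime_floorlog [pt]:
  assumes g: "ptime A g"
  shows "ptime A (\<lambda>x. floorlog 2 (g x))"
proof -
  define step where "step p = (fst p div 2, Suc (snd p))" for p :: "nat \<times> nat"
  have iter: "(step ^^ k) (n, 0) = (n div 2 ^ k, k)" for n k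
    by (induction k) (auto simp: step_def div_mult2_eq[symmetric] mult.commute)
  have less: "0 < n div 2 ^ k \<longleftrightarrow> k < floorlog 2 n" for n k
  proof (induction k arbitrary: n)
    case 0 then show ?case by (cases "n = 0") (simp_all add: floorlog_def)
  next
    case (Suc k)
    show ?case
    proof (cases "n = 0")
      case False
      then show ?thesis using Suc[of "n div 2"] by (simp add: div_mult2_eq floorlog_div2[of n])
    qed (simp add: floorlog_def)
  qed
  have "ptime A (\<lambda>x. (step ^^ floorlog 2 (g x)) (g x, 0))"
  proof (rule ptime_while[of UNIV _ "\<lambda>p. 0 < fst p"])
    show "ptime UNIV step" unfolding step_def by (intro pt)
    show "poly_bounded A (\<lambda>x. 1 + csize (g x) + (1 + floorlog 2 (g x)))"
      by (intro pt g poly_bounded_csize_ptime)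
    show "csize ((step ^^ k) (g x, 0)) \<le> 1 + csize (g x) + (1 + floorlog 2 (g x))"
      if "k \<le> floorlog 2 (g x)" for x k
    proof -
      have "csize (g x div 2 ^ k) \<le> csize (g x)" by (simp add: csize_nat floorlog_mono)
      then show ?thesis using csize_nat_le[of k] that unfolding iter csize_pair by linarith
    qed
  qed (auto simp: iter less intro!: pt g)
  then have "ptime A (\<lambda>x. snd ((step ^^ floorlog 2 (g x)) (g x, 0)))" by (intro pt)
  then show ?thesis by (simp add: iter)
qed

lemma ptime_power2 [pt]:
  assumes g: "ptime A g" "poly_bounded A g"
  shows "ptime A (\<lambda>x. 2 ^ g x :: int)"
proof -
  have eq: "foldl (\<lambda>s (a :: nat). 2 * s) c l = 2 ^ length l * (c :: int)" for c l
    by (induction l arbitrary: c) auto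
  have "ptime A (\<lambda>x. foldl (\<lambda>s a. 2 * s) (1 :: int) [0..<g x])"
  proof (rule ptime_foldl_UNIV)
    show "poly_bounded A (\<lambda>x. 2 + g x)" by (intro pt g)
    show "csize (foldl (\<lambda>s a. 2 * s) (1 :: int) (take k [0..<g x])) \<le> 2 + g x"
      if "k \<le> length [0..<g x]" for x k
    proof -
      have "floorlog 2 (2 ^ k) \<le> Suc k" by (rule floorlog_leI) auto
      then show ?thesis using that unfolding eq by (simp add: csize_int nat_power_eq)
    qed
  qed (intro pt g)+
  then show ?thesis by (simp add: eq)
qed

text \<open>The loop runs through the list instead of counting the index down, because the index may
  be exponentially larger than its encoding.\<close>

lemma ptime_drop [pt]:
  assumes l: "ptime A l" and i: "ptime A i"
  shows "ptime A (\<lambda>x. drop (i x) (l x))"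
proof -
  define step where "step s = (if fst s = 0 then s else (fst s - 1, tl (snd s)))" for s :: "nat \<times> 'b list"
  have eq: "foldl (\<lambda>s (a :: 'b). step s) (k, m) l = (k - length l, drop (min k (length l)) m)"
    for k m and l :: "'b list"
    by (induction l arbitrary: k m) (auto simp: step_def drop_Suc[symmetric] min_def simp flip: drop_tl)
  have "ptime A (\<lambda>x. foldl (\<lambda>s a. step s) (i x, l x) (l x))"
  proof (rule ptime_foldl_UNIV)
    show "ptime UNIV (\<lambda>p :: 'a \<times> (nat \<times> 'b list) \<times> 'b. step (fst (snd p)))"
      unfolding step_def by (intro pt)
    show "poly_bounded A (\<lambda>x. 1 + csize (i x) + csize (l x))"
      by (intro pt poly_bounded_csize_ptime l i)
    show "csize (foldl (\<lambda>s a. step s) (i x, l x) (take k (l x))) \<le> 1 + csize (i x) + csize (l x)" for x k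
    proof -
      have "csize (i x - j) \<le> csize (i x)" for j by (simp add: csize_nat floorlog_mono)
      then show ?thesis unfolding eq csize_pair using csize_drop_le by (meson add_mono order_refl)
    qed
  qed (intro pt l i)+
  then have "ptime A (\<lambda>x. snd (foldl (\<lambda>s a. step s) (i x, l x) (l x)))" by (intro pt)
  then show ?thesis by (rule ptime_cong) (simp add: eq min_def)
qed

text \<open>A fixed default makes indexing total, so later definitions can be shown polynomial
  without any condition on lengths.\<close>

lemma ptime_nth_default [pt]:
  assumes "ptime A l" "ptime A i"
  shows "ptime A (\<lambda>x. nth_default d (l x) (i x))"
proof -
  have "ptime A (\<lambda>x. if drop (i x) (l x) = [] then d else hd (drop (i x) (l x)))"
    by (intro ptime_if_set ptime_hd pt) (auto intro!: pt ptime_mono[OF assms(1)] ptime_mono[OF assms(2)])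
  then show ?thesis by (rule ptime_cong) (auto simp: nth_default_def hd_drop_conv_nth)
qed

section \<open>A rescaled perceptron for strict linear inequalities\<close>

definition dot :: "nat \<Rightarrow> (nat \<Rightarrow> real) \<Rightarrow> (nat \<Rightarrow> real) \<Rightarrow> real" where
  "dot n g w = (\<Sum>i<n. g i * w i)"

definition bform :: "nat \<Rightarrow> (nat \<Rightarrow> nat \<Rightarrow> real) \<Rightarrow> (nat \<Rightarrow> real) \<Rightarrow> (nat \<Rightarrow> real) \<Rightarrow> real" where
  "bform n Q g h = (\<Sum>i<n. \<Sum>j<n. g i * Q i j * h j)"

definition sym_mat :: "nat \<Rightarrow> (nat \<Rightarrow> nat \<Rightarrow> 'a) \<Rightarrow> bool" where
  "sym_mat n Q \<longleftrightarrow> (\<forall>i<n. \<forall>j<n. Q i j = Q j i)"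

text \<open>
  For positive definite \<open>Q\<close> this says that the inverse of \<open>Q\<close> is dominated by the Gram form
  \<open>w \<mapsto> \<Sum>k<m. (b k \<bullet> w)\<^sup>2\<close>; the conjugate form below needs no inverse and implies \<open>Q \<ge> 0\<close>.
\<close>

definition gram_dual :: "nat \<Rightarrow> nat \<Rightarrow> (nat \<Rightarrow> nat \<Rightarrow> real) \<Rightarrow> (nat \<Rightarrow> nat \<Rightarrow> real) \<Rightarrow> bool" where
  "gram_dual n m Q b \<longleftrightarrow>
     (\<forall>g w. 2 * dot n g w - (\<Sum>k<m. (dot n (b k) w)\<^sup>2) \<le> bform n Q g g)"

lemma dot_lin: "dot n (\<lambda>i. f i - c * h i) w = dot n f w - c * dot n h w"
  "dot n (\<lambda>i. f i + h i) w = dot n f w + dot n h w"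
  "dot n (\<lambda>i. c * f i) w = c * dot n f w" "dot n f (\<lambda>i. c * w i) = c * dot n f w"
  by (simp_all add: dot_def algebra_simps sum.distrib sum_subtractf sum_distrib_left)

lemma bform_eq_dot: "bform n Q g h = dot n g (\<lambda>i. dot n (Q i) h)"
  by (simp add: bform_def dot_def sum_distrib_left algebra_simps)

lemma bform_sym: "sym_mat n Q \<Longrightarrow> bform n Q g h = bform n Q h g"
  unfolding bform_def by (subst sum.swap) (auto simp: sym_mat_def algebra_simps intro!: sum.cong)

lemma bform_lin1: "bform n Q (\<lambda>i. f i - c * h i) w = bform n Q f w - c * bform n Q h w"
  "bform n Q (\<lambda>i. f i + h i) w = bform n Q f w + bform n Q h w"
  "bform n Q (\<lambda>i. c * f i) w = c * bform n Q f w"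
  by (simp_all add: bform_def algebra_simps sum.distrib sum_subtractf sum_distrib_left)

lemma bform_lin2: "bform n Q w (\<lambda>i. f i - c * h i) = bform n Q w f - c * bform n Q w h"
  "bform n Q w (\<lambda>i. f i + h i) = bform n Q w f + bform n Q w h"
  "bform n Q w (\<lambda>i. c * f i) = c * bform n Q w f"
  by (simp_all add: bform_def algebra_simps sum.distrib sum_subtractf sum_distrib_left)

lemma gram_dual_nonneg: "gram_dual n m Q b \<Longrightarrow> 0 \<le> bform n Q g g"
  unfolding gram_dual_def by (drule spec[of _ g], drule spec[of _ "\<lambda>_. 0"]) (simp add: dot_def)

lemma bform_rank_one:
  "bform n (\<lambda>i j. Q i j - c * s i * s j) g g = bform n Q g g - c * (dot n s g)\<^sup>2"
proof -
  have "(\<Sum>i<n. \<Sum>j<n. g i * (c * s i * s j) * g j) = c * (dot n s g)\<^sup>2"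
    unfolding dot_def power2_eq_square sum_product by (simp add: sum_distrib_left algebra_simps)
  then show ?thesis
    unfolding bform_def right_diff_distrib left_diff_distrib sum_subtractf by simp
qed

text \<open>Sherman--Morrison for the Gram form of the rows in which one row has been doubled.\<close>

lemma gram_dual_double_row:
  assumes dual: "gram_dual n m Q b" and sym: "sym_mat n Q" and k: "k < m"
    and s: "\<And>i. i < n \<Longrightarrow> s i = dot n (Q i) (b k)"
  defines "a \<equiv> bform n Q (b k) (b k)"
  shows "gram_dual n m (\<lambda>i j. Q i j - 3 / (1 + 3 * a) * s i * s j) (b(k := (\<lambda>i. 2 * b k i)))"
  unfolding gram_dual_def
proof (intro allI)
  fix g w
  have a: "0 \<le> a" unfolding a_def by (rule gram_dual_nonneg[OF dual])
  define p where "p = dot n s g"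
  have p: "bform n Q g (b k) = p" "bform n Q (b k) g = p"
    using bform_sym[OF sym, of g "b k"] s
    by (simp_all add: p_def bform_eq_dot[of n Q g] dot_def mult.commute)
  \<comment> \<open>Applying \<open>dual\<close> to \<open>g - l * b k\<close> and eliminating
    \<open>c\<close> leaves the correction \<open>l^2 * (a + 1 / 3) - 2 * l * p\<close>; this
    \<open>l\<close> minimises it.\<close>
  define l where "l = 3 * p / (1 + 3 * a)"
  define c where "c = dot n (b k) w"
  let ?M = "\<Sum>i<m. (dot n (b i) w)\<^sup>2"
  have "2 * dot n (\<lambda>i. g i - l * b k i) w - ?M
      \<le> bform n Q (\<lambda>i. g i - l * b k i) (\<lambda>i. g i - l * b k i)"
    using dual unfolding gram_dual_def by blast
  then have 1: "2 * dot n g w - 2 * l * c - ?M \<le> bform n Q g g - 2 * l * p + l\<^sup>2 * a"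
    unfolding dot_lin bform_lin1 bform_lin2 p c_def a_def by (simp add: power2_eq_square algebra_simps)
  have 2: "(\<Sum>i<m. (dot n ((b(k := (\<lambda>i. 2 * b k i))) i) w)\<^sup>2) = ?M + 3 * c\<^sup>2"
  proof -
    have "(\<Sum>i<m. (dot n ((b(k := (\<lambda>i. 2 * b k i))) i) w)\<^sup>2)
        = (\<Sum>i<m. (dot n (b i) w)\<^sup>2 + (if i = k then 3 * c\<^sup>2 else 0))"
      by (rule sum.cong) (auto simp: dot_lin c_def power2_eq_square)
    then show ?thesis using k by (simp add: sum.distrib)
  qed
  have "0 \<le> (l - 3 * c)\<^sup>2" by simp
  then have 3: "2 * l * c - 3 * c\<^sup>2 \<le> l\<^sup>2 / 3"
    by (simp add: power2_eq_square algebra_simps)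
  have "l\<^sup>2 * a + l\<^sup>2 / 3 - 2 * l * p = l * (l * (1 + 3 * a)) / 3 - 2 * l * p"
    by (simp add: power2_eq_square algebra_simps)
  also have "\<dots> = - (l * p)"
  proof -
    have "l * (1 + 3 * a) = 3 * p" using a by (simp add: l_def)
    then show ?thesis by simp
  qed
  also have "\<dots> = - (3 / (1 + 3 * a) * p\<^sup>2)" by (simp add: l_def power2_eq_square)
  finally show "2 * dot n g w - (\<Sum>i<m. (dot n ((b(k := (\<lambda>i. 2 * b k i))) i) w)\<^sup>2)
      \<le> bform n (\<lambda>i j. Q i j - 3 / (1 + 3 * a) * s i * s j) g g"
    using 1 3 unfolding 2 bform_rank_one p_def[symmetric] by linarith
qed

lemma gram_dual_mono:
  "gram_dual n m Q b \<Longrightarrow> (\<And>g. bform n Q g g \<le> bform n Q' g g) \<Longrightarrow> gram_dual n m Q' b"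
  unfolding gram_dual_def by (meson order_trans)

text \<open>By the inequality \<open>2 * s * t \<le> s^2 + t^2\<close>, entries between 0 and 1 give
  a form of magnitude at most \<open>n\<close> times the squared norm. The same amount on the
  diagonal makes it nonnegative and at most doubles the bound.\<close>

lemma bform_rounding:
  assumes e: "\<And>i j. i < n \<Longrightarrow> j < n \<Longrightarrow> 0 \<le> e i j \<and> e i j \<le> 1"
  shows "0 \<le> bform n (\<lambda>i j. e i j + (if i = j then real n else 0)) g g"
    and "bform n (\<lambda>i j. e i j + (if i = j then real n else 0)) g g \<le> 2 * real n * (\<Sum>i<n. (g i)\<^sup>2)"
proof -
  let ?E = "\<Sum>i<n. \<Sum>j<n. g i * e i j * g j"
  have eq: "bform n (\<lambda>i j. e i j + (if i = j then real n else 0)) g g = ?E + n * (\<Sum>i<n. (g i)\<^sup>2)"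
  proof -
    have "(\<Sum>j<n. g i * (e i j + (if i = j then real n else 0)) * g j)
        = (\<Sum>j<n. g i * e i j * g j) + n * (g i)\<^sup>2" if "i < n" for i
    proof -
      have "(\<Sum>j<n. g i * (e i j + (if i = j then real n else 0)) * g j)
        = (\<Sum>j<n. g i * e i j * g j + (if i = j then n * (g i)\<^sup>2 else 0))"
        by (rule sum.cong) (auto simp: algebra_simps power2_eq_square)
      then show ?thesis using that by (simp add: sum.distrib)
    qed
    then show ?thesis unfolding bform_def by (simp add: sum.distrib sum_distrib_left)
  qed
  have "\<bar>?E\<bar> \<le> (\<Sum>i<n. \<Sum>j<n. \<bar>g i * e i j * g j\<bar>)"
    by (rule order_trans[OF sum_abs]) (intro sum_mono sum_abs)
  also have "\<dots> \<le> (\<Sum>i<n. \<Sum>j<n. \<bar>g i\<bar> * \<bar>g j\<bar>)"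
  proof (intro sum_mono)
    fix i j assume "i \<in> {..<n}" "j \<in> {..<n}"
    then have "\<bar>e i j\<bar> \<le> 1" using e[of i j] by simp
    then have "\<bar>g i\<bar> * \<bar>g j\<bar> * \<bar>e i j\<bar> \<le> \<bar>g i\<bar> * \<bar>g j\<bar> * 1" by (intro mult_left_mono) auto
    then show "\<bar>g i * e i j * g j\<bar> \<le> \<bar>g i\<bar> * \<bar>g j\<bar>" by (simp add: abs_mult algebra_simps)
  qed
  also have "\<dots> \<le> (\<Sum>i<n. \<Sum>j<n. ((g i)\<^sup>2 + (g j)\<^sup>2) / 2)"
    by (intro sum_mono) (use sum_squares_bound[of "\<bar>g _\<bar>" "\<bar>g _\<bar>"] in \<open>simp add: algebra_simps\<close>)
  also have "\<dots> = n * (\<Sum>i<n. (g i)\<^sup>2)"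
    by (simp add: sum_divide_distrib[symmetric] sum.distrib sum_distrib_left[symmetric])
  finally have "\<bar>?E\<bar> \<le> n * (\<Sum>i<n. (g i)\<^sup>2)" .
  then show "0 \<le> bform n (\<lambda>i j. e i j + (if i = j then real n else 0)) g g"
    and "bform n (\<lambda>i j. e i j + (if i = j then real n else 0)) g g \<le> 2 * real n * (\<Sum>i<n. (g i)\<^sup>2)"
    unfolding eq by linarith+
qed

lemma bform_perceptron_step:
  assumes "sym_mat n Q" "bform n Q b g \<le> 0"
  shows "bform n Q (\<lambda>i. g i + b i) (\<lambda>i. g i + b i) \<le> bform n Q g g + bform n Q b b"
  using assms(2) bform_sym[OF assms(1), of g b] unfolding bform_lin1 bform_lin2 by simp

text \<open>Write \<open>g\<close> for the combination of the rows. All terms of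
  \<open>g . w\<close> are nonnegative, so it is at least \<open>y k * (b k . w)\<close>. On the
  other side, the Gram form of \<open>w\<close> is at most \<open>m\<close>, and duality gives
  \<open>(g . w)^2 \<le> 16 * m^4\<close>. A heavy coefficient thus forces a small product.\<close>

lemma perceptron_cut:
  assumes dual: "gram_dual n m Q b" and k: "k < m"
    and w: "\<And>i. i < m \<Longrightarrow> 0 \<le> dot n (b i) w \<and> dot n (b i) w \<le> 1"
    and y: "\<And>i. i < m \<Longrightarrow> 0 \<le> y i"
    and small: "bform n Q (\<lambda>j. \<Sum>i<m. y i * b i j) (\<lambda>j. \<Sum>i<m. y i * b i j) \<le> 16 * real m ^ 3"
    and yk: "8 * real m ^ 2 \<le> y k"
  shows "dot n (b k) w \<le> 1 / 2"
proof -
  let ?g = "\<lambda>j. \<Sum>i<m. y i * b i j"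
  have m: "0 < real m" using k by simp
  have gw: "dot n ?g w = (\<Sum>i<m. y i * dot n (b i) w)"
    unfolding dot_def sum_distrib_right sum_distrib_left by (subst sum.swap) (simp add: algebra_simps)
  have "y k * dot n (b k) w \<le> (\<Sum>i<m. y i * dot n (b i) w)"
    by (rule member_le_sum) (use k y w in auto)
  then have le: "8 * real m ^ 2 * dot n (b k) w \<le> dot n ?g w"
    unfolding gw using mult_right_mono[OF yk, of "dot n (b k) w"] w[OF k] by linarith
  have M: "(\<Sum>i<m. (dot n (b i) w)\<^sup>2) \<le> m"
    using sum_bounded_above[of "{..<m}" "\<lambda>i. (dot n (b i) w)\<^sup>2" 1] w by (simp add: power_le_one)
  \<comment> \<open>Duality holds for every multiple of \<open>w\<close>; this factor maximises
    \<open>2 * s * dot n ?g w - s^2 * m\<close>.\<close>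
  define s where "s = dot n ?g w / m"
  have "2 * dot n ?g (\<lambda>i. s * w i) - (\<Sum>i<m. (dot n (b i) (\<lambda>i. s * w i))\<^sup>2) \<le> 16 * real m ^ 3"
    using dual small unfolding gram_dual_def by (meson order_trans)
  then have "2 * s * dot n ?g w - s\<^sup>2 * (\<Sum>i<m. (dot n (b i) w)\<^sup>2) \<le> 16 * real m ^ 3"
    by (simp add: dot_lin(4) power_mult_distrib sum_distrib_left[symmetric])
  moreover have "s\<^sup>2 * (\<Sum>i<m. (dot n (b i) w)\<^sup>2) \<le> s\<^sup>2 * m"
    using M by (intro mult_left_mono) auto
  moreover have "2 * s * dot n ?g w - s\<^sup>2 * m = (dot n ?g w)\<^sup>2 / m"
    using m by (simp add: s_def power2_eq_square)
  ultimately have "(dot n ?g w)\<^sup>2 / m \<le> 16 * real m ^ 3" by linarith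
  then have "(dot n ?g w)\<^sup>2 \<le> 16 * real m ^ 3 * m"
    using m by (simp add: pos_divide_le_eq)
  also have "\<dots> = (4 * real m ^ 2)\<^sup>2" by (simp add: power2_eq_square power3_eq_cube)
  finally have "dot n ?g w \<le> 4 * real m ^ 2"
    by (rule power2_le_imp_le) simp
  with le have "8 * real m ^ 2 * dot n (b k) w \<le> 8 * real m ^ 2 * (1 / 2)" by linarith
  then show ?thesis using m by (subst (asm) mult_le_cancel_left_pos) auto
qed

lemma ptime_Let [pt]:
  assumes "ptime UNIV (\<lambda>p. h (fst p) (snd p))" "ptime A f"
  shows "ptime A (\<lambda>x. let a = f x in h x a)"
  using ptime_compose2[OF assms(1) ptime_ident assms(2)] by simp

section \<open>The solver on lists of integers\<close>

abbreviation vnth :: "int list \<Rightarrow> nat \<Rightarrow> int" where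
  "vnth \<equiv> nth_default 0"

abbreviation rnth :: "'a list list \<Rightarrow> nat \<Rightarrow> 'a list" where
  "rnth \<equiv> nth_default []"

lemma nth_default_map_upt [simp]: "nth_default d (map f [0..<n]) i = (if i < n then f i else d)"
  by (simp add: nth_default_def)

lemma sum_list_map_upt [simp]: "(\<Sum>i\<leftarrow>[0..<n]. f i) = (\<Sum>i<n. f i)"
  by (simp add: interv_sum_list_conv_sum_set_nat atLeast0LessThan)

definition vdot :: "int list \<Rightarrow> int list \<Rightarrow> int" where
  "vdot u v = (\<Sum>i\<leftarrow>[0..<length u]. vnth u i * vnth v i)"

definition matvec :: "int list list \<Rightarrow> int list \<Rightarrow> int list" where
  "matvec Z v = map (\<lambda>u. vdot u v) Z"

definition row_comb :: "int list \<Rightarrow> int list list \<Rightarrow> int list" where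
  "row_comb y B = map (\<lambda>i. \<Sum>k\<leftarrow>[0..<length B]. vnth y k * vnth (rnth B k) i) [0..<length (rnth B 0)]"

text \<open>The candidate solution is the matrix applied to the combination of the rows with
  coefficients \<open>y\<close>. The positive denominator of the matrix is left out, as only signs
  matter.\<close>

definition violated :: "int list list \<Rightarrow> int list list \<Rightarrow> int list \<Rightarrow> nat list" where
  "violated Z B y =
     (let q = matvec Z (row_comb y B) in filter (\<lambda>k. vdot (rnth B k) q \<le> 0) [0..<length B])"

definition increment :: "int list \<Rightarrow> nat \<Rightarrow> int list" where
  "increment y k = map (\<lambda>i. if i = k then vnth y i + 1 else vnth y i) [0..<length y]"

definition percep_step :: "int list list \<Rightarrow> int list list \<Rightarrow> int list \<Rightarrow> int list" where
  "percep_step Z B y =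
     (let v = violated Z B y in if v = [] then y else increment y (nth_default 0 v 0))"

text \<open>
  After \<open>8 m\<^sup>3\<close> unsuccessful steps some coefficient is at least \<open>8 m\<^sup>2\<close>, whereas the potential
  has grown by at most \<open>2\<close> per step.
\<close>

definition perceptron :: "int list list \<Rightarrow> int list list \<Rightarrow> int list" where
  "perceptron Z B = foldl (\<lambda>y a. percep_step Z B y) (map (\<lambda>u. 0) B) [0..<8 * length B ^ 3]"

text \<open>
  The matrix \<open>Z / H\<close> is updated by the Sherman--Morrison formula; the term \<open>length Z\<close> on the
  diagonal makes the total rounding error positive semidefinite.
\<close>

definition shrink :: "int \<Rightarrow> int list list \<Rightarrow> int list \<Rightarrow> int list list" where
  "shrink H Z b =
     (let s = matvec Z b; d = H + 3 * vdot b s in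
      map (\<lambda>i. map (\<lambda>j. vnth (rnth Z i) j - 3 * vnth s i * vnth s j div d + (if i = j then int (length Z) else 0))
        [0..<length Z]) [0..<length Z])"

definition double_row :: "int list list \<Rightarrow> nat \<Rightarrow> int list list" where
  "double_row B k = map (\<lambda>i. if i = k then map (\<lambda>a. 2 * a) (rnth B i) else rnth B i) [0..<length B]"

text \<open>If no coefficient is heavy, the default doubles row 0. This is harmless for soundness
  and for sizes; the completeness argument only meets states with a heavy row.\<close>

definition rescale :: "int \<Rightarrow> int list list \<times> int list list \<Rightarrow> int list list \<times> int list list" where
  "rescale H s =
     (let Z = fst s; B = snd s; y = perceptron Z B in
      if violated Z B y = [] then s
      else let k = nth_default 0 (filter (\<lambda>k. 8 * int (length B) ^ 2 \<le> vnth y k) [0..<length B]) 0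
           in (shrink H Z (rnth B k), double_row B k))"

definition row_bound :: "int list list \<Rightarrow> int" where
  "row_bound R = 1 + (\<Sum>u\<leftarrow>R. \<Sum>a\<leftarrow>u. \<bar>a\<bar>)"

text \<open>For \<open>\<sigma> = row_bound R\<close> the power \<open>2 ^ row_bits R\<close>
  exceeds \<open>4 * \<sigma>^2 * (\<sigma> + 2)\<close>. Its inverse bounds from below the product
  of each original row with the normalised solution, so no row is doubled more than
  \<open>row_bits R\<close> times.\<close>

definition row_bits :: "int list list \<Rightarrow> nat" where
  "row_bits R = floorlog 2 (nat (4 * row_bound R * row_bound R * (row_bound R + 2)))"

text \<open>The added multiples of unit vectors force solutions to be strictly positive. They also
  make the Gram form at least \<open>(row_bound R)^2\<close> times the squared norm, so that a
  multiple of the identity can serve as the first matrix.\<close>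

definition all_rows :: "int list list \<Rightarrow> int list list" where
  "all_rows R = R @ map (\<lambda>v. map (\<lambda>i. if i = v then row_bound R else 0) [0..<length (rnth R 0)])
     [0..<length (rnth R 0)]"

text \<open>One more than the number of doublings that a suitable solution allows for all rows
  together.\<close>

definition rounds :: "int list list \<Rightarrow> nat" where
  "rounds R = length (all_rows R) * row_bits R + 1"

text \<open>The factors are those by which rounding can act: \<open>2 * n\<close> from a single
  update, \<open>2 ^ (2 * row_bits R)\<close> from the growth of squared row norms, and
  \<open>rounds R\<close> so that the errors of all rounds add up to at most 1.\<close>

definition init_diag :: "int list list \<Rightarrow> int" where
  "init_diag R = 2 * int (length (rnth R 0)) * int (rounds R) * 2 ^ (2 * row_bits R)"

definition init_mat :: "int list list \<Rightarrow> int list list" where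
  "init_mat R = map (\<lambda>i. map (\<lambda>j. if i = j then init_diag R else 0) [0..<length (rnth R 0)])
     [0..<length (rnth R 0)]"

text \<open>Divided by this number the initial diagonal becomes \<open>1 / (row_bound R)^2\<close>,
  which matches the rows added in \<open>all_rows\<close>.\<close>

definition mat_denom :: "int list list \<Rightarrow> int" where
  "mat_denom R = init_diag R * row_bound R * row_bound R"

definition final_state :: "int list list \<Rightarrow> int list list \<times> int list list" where
  "final_state R = foldl (\<lambda>s a. rescale (mat_denom R) s) (init_mat R, all_rows R) [0..<rounds R]"

definition solve_rows :: "int list list \<Rightarrow> int list" where
  "solve_rows R =
     (let s = final_state R; y = perceptron (fst s) (snd s) in
      if violated (fst s) (snd s) y = [] then matvec (fst s) (row_comb y (snd s)) else [])"

section \<open>Running time of the solver's operations\<close>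

lemma ptime_power_const [pt]: "ptime A f \<Longrightarrow> ptime A (\<lambda>x. f x ^ k :: int)"
  by (induction k) (simp_all add: pt)

lemma ptime_power_const_nat [pt]: "ptime A f \<Longrightarrow> ptime A (\<lambda>x. f x ^ k :: nat)"
  by (induction k) (simp_all add: pt)

lemma ptime_vdot [pt]: "ptime A f \<Longrightarrow> ptime A g \<Longrightarrow> ptime A (\<lambda>x. vdot (f x) (g x))"
  by (erule (1) ptime_compose2[rotated]) (unfold vdot_def, intro pt)

lemma ptime_matvec [pt]: "ptime A f \<Longrightarrow> ptime A g \<Longrightarrow> ptime A (\<lambda>x. matvec (f x) (g x))"
  by (erule (1) ptime_compose2[rotated]) (unfold matvec_def, intro pt)

lemma ptime_row_comb [pt]: "ptime A f \<Longrightarrow> ptime A g \<Longrightarrow> ptime A (\<lambda>x. row_comb (f x) (g x))"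
  by (erule (1) ptime_compose2[rotated]) (unfold row_comb_def, intro pt)

lemma ptime_violated [pt]:
  "ptime A f \<Longrightarrow> ptime A g \<Longrightarrow> ptime A h \<Longrightarrow> ptime A (\<lambda>x. violated (f x) (g x) (h x))"
  by (erule (2) ptime_compose3[rotated]) (unfold violated_def, intro pt)

lemma ptime_increment [pt]: "ptime A f \<Longrightarrow> ptime A g \<Longrightarrow> ptime A (\<lambda>x. increment (f x) (g x))"
  by (erule (1) ptime_compose2[rotated]) (unfold increment_def, intro pt)

lemma ptime_percep_step [pt]:
  "ptime A f \<Longrightarrow> ptime A g \<Longrightarrow> ptime A h \<Longrightarrow> ptime A (\<lambda>x. percep_step (f x) (g x) (h x))"
  by (erule (2) ptime_compose3[rotated]) (unfold percep_step_def, intro pt)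

lemma ptime_shrink [pt]:
  "ptime A f \<Longrightarrow> ptime A g \<Longrightarrow> ptime A h \<Longrightarrow> ptime A (\<lambda>x. shrink (f x) (g x) (h x))"
  by (erule (2) ptime_compose3[rotated]) (unfold shrink_def, intro pt)

lemma ptime_double_row [pt]: "ptime A f \<Longrightarrow> ptime A g \<Longrightarrow> ptime A (\<lambda>x. double_row (f x) (g x))"
  by (erule (1) ptime_compose2[rotated]) (unfold double_row_def, intro pt)

lemma length_percep_step [simp]: "length (percep_step Z B y) = length y"
  by (simp add: percep_step_def increment_def Let_def)

lemma vnth_percep_step_cases:
  obtains "percep_step Z B y = y" "violated Z B y = []"
  | k where "percep_step Z B y = increment y k" "k \<in> set (violated Z B y)"
  by (cases "violated Z B y") (auto simp: percep_step_def Let_def nth_default_def)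

lemma percep_step_bounds: "vnth y i \<le> vnth (percep_step Z B y) i \<and> vnth (percep_step Z B y) i \<le> vnth y i + 1"
  by (rule vnth_percep_step_cases[of Z B y]) (auto simp: increment_def nth_default_def)

lemma perceptron_fold_bounds:
  "length (foldl (\<lambda>y a. percep_step Z B y) (map (\<lambda>u. 0) B) l) = length B"
  "0 \<le> vnth (foldl (\<lambda>y a. percep_step Z B y) (map (\<lambda>u. 0) B) l) i"
  "vnth (foldl (\<lambda>y a. percep_step Z B y) (map (\<lambda>u. 0) B) l) i \<le> int (length l)"
proof (induction l rule: rev_induct)
  case (snoc a l)
  { case 1 show ?case using snoc by simp }
  { case 2 show ?case using snoc percep_step_bounds[of "foldl (\<lambda>y a. percep_step Z B y) (map (\<lambda>u. 0) B) l" i Z B] by simp }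
  { case 3 show ?case using snoc percep_step_bounds[of "foldl (\<lambda>y a. percep_step Z B y) (map (\<lambda>u. 0) B) l" i Z B] by simp }
qed (auto simp: nth_default_def)

lemma csize_list_le: "(\<And>a. a \<in> set l \<Longrightarrow> csize a \<le> c) \<Longrightarrow> csize l \<le> 1 + length l * (1 + c)"
proof -
  assume "\<And>a. a \<in> set l \<Longrightarrow> csize a \<le> c"
  then have "(\<Sum>a\<leftarrow>l. 1 + csize a) \<le> (\<Sum>a\<leftarrow>l. 1 + c)" by (intro sum_list_mono) auto
  then show ?thesis by (simp add: csize_list sum_list_triv)
qed

text \<open>Coefficients start at 0 and rise by at most 1 per step, so even their values, not just
  their bit lengths, stay polynomial.\<close>

lemma ptime_perceptron [pt]:
  "ptime A f \<Longrightarrow> ptime A g \<Longrightarrow> ptime A (\<lambda>x. perceptron (f x) (g x))"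
proof (erule (1) ptime_compose2[rotated])
  show "ptime UNIV (\<lambda>p. perceptron (fst p) (snd p))"
    unfolding perceptron_def
  proof (rule ptime_foldl_UNIV)
    show "poly_bounded UNIV (\<lambda>p :: int list list \<times> int list list. 1 + length (snd p) * (1 + (1 + 8 * length (snd p) ^ 3)))"
      by (intro pt)
    show "csize (foldl (\<lambda>y a. percep_step (fst p) (snd p) y) (map (\<lambda>u. 0) (snd p)) (take k [0..<8 * length (snd p) ^ 3]))
      \<le> 1 + length (snd p) * (1 + (1 + 8 * length (snd p) ^ 3))" (is "csize ?y \<le> _")
      if "k \<le> length [0..<8 * length (snd p) ^ 3]" for p :: "int list list \<times> int list list" and k
    proof -
      have "csize a \<le> 1 + 8 * length (snd p) ^ 3" if a: "a \<in> set ?y" for a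
      proof -
        obtain i where "i < length ?y" "?y ! i = a" using a[unfolded in_set_conv_nth] by blast
        then have "a = vnth ?y i" by (simp only: nth_default_def if_True)
        moreover have "int (length (take k [0..<8 * length (snd p) ^ 3])) \<le> int (8 * length (snd p) ^ 3)"
          by (rule of_nat_mono) simp
        ultimately have a_bounds: "0 \<le> a" "a \<le> int (8 * length (snd p) ^ 3)"
          using perceptron_fold_bounds(2,3)[of "fst p" "snd p" "take k [0..<8 * length (snd p) ^ 3]" i]
          by linarith+
        from a_bounds have "csize a = csize (nat a)" by (simp add: csize_int csize_nat)
        also have "\<dots> \<le> 1 + nat a" by (rule csize_nat_le)
        finally show ?thesis using a_bounds by linarith
      qed
      then show ?thesis using csize_list_le[of ?y] by (simp only: perceptron_fold_bounds(1))
    qed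
  qed (intro pt)+
qed

lemma ptime_rescale [pt]: "ptime A f \<Longrightarrow> ptime A g \<Longrightarrow> ptime A (\<lambda>x. rescale (f x) (g x))"
  by (erule (1) ptime_compose2[rotated]) (unfold rescale_def, intro pt)

lemma ptime_row_bound [pt]: "ptime A f \<Longrightarrow> ptime A (\<lambda>x. row_bound (f x))"
  by (erule ptime_compose_UNIV[rotated]) (unfold row_bound_def, intro pt)

lemma ptime_row_bits [pt]: "ptime A f \<Longrightarrow> ptime A (\<lambda>x. row_bits (f x))"
  by (erule ptime_compose_UNIV[rotated]) (unfold row_bits_def, intro pt)

lemma poly_bounded_row_bits [pt]: "ptime A f \<Longrightarrow> poly_bounded A (\<lambda>x. row_bits (f x))"
  unfolding row_bits_def by (intro pt)

lemma ptime_all_rows [pt]: "ptime A f \<Longrightarrow> ptime A (\<lambda>x. all_rows (f x))"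
  by (erule ptime_compose_UNIV[rotated]) (unfold all_rows_def, intro pt)

lemma ptime_rounds [pt]: "ptime A f \<Longrightarrow> ptime A (\<lambda>x. rounds (f x))"
  unfolding rounds_def by (intro pt)

lemma poly_bounded_rounds [pt]: "ptime A f \<Longrightarrow> poly_bounded A (\<lambda>x. rounds (f x))"
  unfolding rounds_def by (intro pt)

lemma ptime_init_diag [pt]: "ptime A f \<Longrightarrow> ptime A (\<lambda>x. init_diag (f x))"
  unfolding init_diag_def by (intro pt)

lemma ptime_init_mat [pt]: "ptime A f \<Longrightarrow> ptime A (\<lambda>x. init_mat (f x))"
  by (erule ptime_compose_UNIV[rotated]) (unfold init_mat_def, intro pt)

lemma ptime_mat_denom [pt]: "ptime A f \<Longrightarrow> ptime A (\<lambda>x. mat_denom (f x))"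
  unfolding mat_denom_def by (intro pt)

section \<open>Integer lists as real vectors and matrices\<close>

definition vfun :: "int list \<Rightarrow> nat \<Rightarrow> real" where
  "vfun u i = real_of_int (vnth u i)"

definition rfun :: "int list list \<Rightarrow> nat \<Rightarrow> nat \<Rightarrow> real" where
  "rfun B k = vfun (rnth B k)"

definition qfun :: "int \<Rightarrow> int list list \<Rightarrow> nat \<Rightarrow> nat \<Rightarrow> real" where
  "qfun H Z i j = rfun Z i j / real_of_int H"

definition dims :: "nat \<Rightarrow> nat \<Rightarrow> int list list \<Rightarrow> bool" where
  "dims m n B \<longleftrightarrow> length B = m \<and> (\<forall>u\<in>set B. length u = n)"

lemma dims_rnth: "dims m n B \<Longrightarrow> k < m \<Longrightarrow> length (rnth B k) = n"
  by (simp add: dims_def nth_default_def)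

lemma vdot_eq: "length u = n \<Longrightarrow> real_of_int (vdot u v) = dot n (vfun u) (vfun v)"
  by (simp add: vdot_def dot_def vfun_def)

lemma vfun_matvec:
  "dims n n Z \<Longrightarrow> i < n \<Longrightarrow> vfun (matvec Z v) i = dot n (rfun Z i) (vfun v)"
  by (simp add: matvec_def vfun_def[of "map _ _"] nth_default_def dims_def rfun_def vdot_eq)

lemma length_matvec [simp]: "length (matvec Z v) = length Z"
  by (simp add: matvec_def)

lemma vfun_row_comb:
  "dims m n B \<Longrightarrow> 0 < m \<Longrightarrow> i < n \<Longrightarrow> vfun (row_comb y B) i = (\<Sum>k<m. vfun y k * rfun B k i)"
  using dims_rnth[of m n B 0] by (simp add: row_comb_def vfun_def rfun_def dims_def)

lemma dot_cong: "(\<And>i. i < n \<Longrightarrow> f i = f' i) \<Longrightarrow> (\<And>i. i < n \<Longrightarrow> g i = g' i) \<Longrightarrow> dot n f g = dot n f' g'"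
  by (simp add: dot_def)

lemma bform_cong:
  "(\<And>i j. i < n \<Longrightarrow> j < n \<Longrightarrow> Q i j = Q' i j) \<Longrightarrow> (\<And>i. i < n \<Longrightarrow> f i = f' i) \<Longrightarrow>
    (\<And>i. i < n \<Longrightarrow> g i = g' i) \<Longrightarrow> bform n Q f g = bform n Q' f' g'"
  by (simp add: bform_def)

lemma bform_add_smult: "bform n (\<lambda>i j. Q i j + c * E i j) g h = bform n Q g h + c * bform n E g h"
  by (simp add: bform_def algebra_simps sum.distrib sum_distrib_left)

definition state_ok :: "nat \<Rightarrow> nat \<Rightarrow> int \<Rightarrow> int list list \<Rightarrow> int list list \<Rightarrow> bool" where
  "state_ok n m H Z B \<longleftrightarrow> 0 < H \<and> 0 < m \<and> dims n n Z \<and> dims m n B \<and>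
     sym_mat n (\<lambda>i j. vnth (rnth Z i) j) \<and> gram_dual n m (qfun H Z) (rfun B)"

lemma sym_qfun: "sym_mat n (\<lambda>i j. vnth (rnth Z i) j) \<Longrightarrow> sym_mat n (qfun H Z)"
  by (simp add: sym_mat_def qfun_def rfun_def vfun_def)

lemma dot_qfun: "0 < H \<Longrightarrow> dot n (rfun Z i) v = H * dot n (qfun H Z i) v"
  by (simp add: dot_def qfun_def sum_distrib_left)

lemma dims_double_row: "dims m n B \<Longrightarrow> dims m n (double_row B k)"
  by (auto simp: dims_def double_row_def nth_default_def)

lemma rfun_double_row:
  "k < length B \<Longrightarrow> rfun (double_row B k) = (rfun B)(k := (\<lambda>i. 2 * rfun B k i))"
  by (rule ext, rule ext) (auto simp: rfun_def vfun_def double_row_def nth_default_def)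

text \<open>Each entry exceeds its exact Sherman--Morrison value by a rounding error
  \<open>e i j\<close> in the unit interval and the diagonal term. The excess is positive
  semidefinite, which preserves duality, and the second claim measures its cost. A diagonal entry
  loses a nonnegative multiple of a square and gains at most \<open>n\<close>, which controls the
  size of the matrix.\<close>

lemma shrink_facts:
  assumes ok: "state_ok n m H Z B" and k: "k < m"
  defines "a \<equiv> bform n (qfun H Z) (rfun B k) (rfun B k)"
    and "s \<equiv> \<lambda>i. dot n (qfun H Z i) (rfun B k)"
    and "Z' \<equiv> shrink H Z (rnth B k)"
  shows "state_ok n m H Z' (double_row B k)"
    and "\<And>g. bform n (qfun H Z') g g \<le> bform n (qfun H Z) g g - 3 / (1 + 3 * a) * (dot n s g)\<^sup>2
           + 2 * real n / H * (\<Sum>i<n. (g i)\<^sup>2)"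
    and "\<And>i. i < n \<Longrightarrow> vnth (rnth Z' i) i \<le> vnth (rnth Z i) i + int n"
proof -
  have H: "0 < H" "0 < real_of_int H" and m: "0 < m" and dZ: "dims n n Z" and dB: "dims m n B"
    and sym: "sym_mat n (\<lambda>i j. vnth (rnth Z i) j)" and dual: "gram_dual n m (qfun H Z) (rfun B)"
    using ok unfolding state_ok_def by auto
  have lZ: "length Z = n" using dZ by (simp add: dims_def)
  define b where "b = rnth B k"
  define v where "v = matvec Z b"
  define d where "d = H + 3 * vdot b v"
  have lb: "length b = n" using dims_rnth[OF dB k] by (simp add: b_def)
  have v: "vfun v i = H * s i" if "i < n" for i
    using vfun_matvec[OF dZ that] dot_qfun[OF H(1)] by (simp add: v_def s_def b_def rfun_def)
  have a: "0 \<le> a" unfolding a_def by (rule gram_dual_nonneg[OF dual])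
  have "dot n (vfun b) (vfun v) = dot n (vfun b) (\<lambda>i. H * s i)"
    by (rule dot_cong) (auto simp: v)
  also have "\<dots> = H * a" by (simp add: dot_lin a_def bform_eq_dot s_def b_def rfun_def)
  finally have dr: "real_of_int d = H * (1 + 3 * a)"
    using vdot_eq[OF lb, of v] by (simp add: d_def algebra_simps)
  have "0 < real_of_int d" unfolding dr using H(2) a by (intro mult_pos_pos) auto
  then have d: "0 < d" by simp
  have Z': "vnth (rnth Z' i) j = vnth (rnth Z i) j - 3 * vnth v i * vnth v j div d + (if i = j then int n else 0)"
    if "i < n" "j < n" for i j
    using that by (simp add: Z'_def shrink_def Let_def lZ v_def d_def b_def)
  define e where "e i j = (3 * vfun v i * vfun v j) / d - real_of_int (3 * vnth v i * vnth v j div d)" for i j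
  have e: "0 \<le> e i j \<and> e i j \<le> 1" for i j
  proof -
    have eq: "(3 * vfun v i * vfun v j) / d = real_of_int (3 * vnth v i * vnth v j) / real_of_int d"
      by (simp add: vfun_def)
    show ?thesis unfolding e_def eq floor_divide_of_int_eq[symmetric, where 'a = real]
      by linarith
  qed
  define Qx where "Qx i j = qfun H Z i j - 3 / (1 + 3 * a) * s i * s j" for i j
  have Q': "qfun H Z' i j = Qx i j + 1 / H * (e i j + (if i = j then real n else 0))"
    if "i < n" "j < n" for i j
  proof -
    have "(3 * (H * si) * (H * sj)) / (H * c) = H * (3 / c * si * sj)" if "0 < c" for c si sj :: real
      using H that by simp
    then have "(3 * vfun v i * vfun v j) / d = H * (3 / (1 + 3 * a) * s i * s j)"
      using a unfolding v[OF that(1)] v[OF that(2)] dr by simp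
    then have "real_of_int (vnth (rnth Z' i) j)
        = rfun Z i j - (H * (3 / (1 + 3 * a) * s i * s j) - e i j) + (if i = j then real n else 0)"
      unfolding Z'[OF that] by (simp add: e_def rfun_def vfun_def)
    then have "qfun H Z' i j = (rfun Z i j - (H * (3 / (1 + 3 * a) * s i * s j) - e i j) + (if i = j then real n else 0)) / H"
      by (simp add: qfun_def rfun_def[of Z'] vfun_def)
    also have "\<dots> = Qx i j + 1 / H * (e i j + (if i = j then real n else 0))"
      using H(2) by (simp add: Qx_def qfun_def diff_divide_distrib add_divide_distrib)
    finally show ?thesis .
  qed
  have bQ': "bform n (qfun H Z') g g
      = bform n Qx g g + 1 / H * bform n (\<lambda>i j. e i j + (if i = j then real n else 0)) g g" for g
    unfolding bform_add_smult[symmetric] by (rule bform_cong) (auto simp: Q')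
  have bQx: "bform n Qx g g = bform n (qfun H Z) g g - 3 / (1 + 3 * a) * (dot n s g)\<^sup>2" for g
    unfolding Qx_def by (rule bform_rank_one)
  have "gram_dual n m Qx (rfun (double_row B k))"
    unfolding Qx_def a_def rfun_double_row[OF k[folded dB[unfolded dims_def, THEN conjunct1]]]
    by (rule gram_dual_double_row[OF dual sym_qfun[OF sym] k]) (simp add: s_def)
  then have "gram_dual n m (qfun H Z') (rfun (double_row B k))"
  proof (rule gram_dual_mono)
    show "bform n Qx g g \<le> bform n (qfun H Z') g g" for g
      unfolding bQ' using bform_rounding(1)[of n e g] e H by simp
  qed
  moreover have "sym_mat n (\<lambda>i j. vnth (rnth Z' i) j)"
    unfolding sym_mat_def
  proof (intro allI impI)
    fix i j assume ij: "i < n" "j < n"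
    show "vnth (rnth Z' i) j = vnth (rnth Z' j) i"
      using sym ij unfolding Z'[OF ij] Z'[OF ij(2,1)] sym_mat_def by (auto simp: ac_simps)
  qed
  moreover have "dims n n Z'" by (auto simp: Z'_def shrink_def dims_def Let_def lZ)
  ultimately show "state_ok n m H Z' (double_row B k)"
    unfolding state_ok_def using H m dims_double_row[OF dB] by simp
  show "bform n (qfun H Z') g g \<le> bform n (qfun H Z) g g - 3 / (1 + 3 * a) * (dot n s g)\<^sup>2
           + 2 * real n / H * (\<Sum>i<n. (g i)\<^sup>2)" for g
  proof -
    have "1 / H * bform n (\<lambda>i j. e i j + (if i = j then real n else 0)) g g
        \<le> 1 / H * (2 * real n * (\<Sum>i<n. (g i)\<^sup>2))"
      using e H(2) by (intro mult_left_mono bform_rounding) auto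
    then show ?thesis unfolding bQ' bQx by simp
  qed
  show "vnth (rnth Z' i) i \<le> vnth (rnth Z i) i + int n" if "i < n" for i
  proof -
    have "0 \<le> 3 * vnth v i * vnth v i" by simp
    then have "0 \<le> 3 * vnth v i * vnth v i div d" using d by (simp add: pos_imp_zdiv_nonneg_iff)
    then show ?thesis using that by (simp add: Z')
  qed
qed

text \<open>Duality makes the matrix positive semidefinite. Testing its form on the sum and the
  difference of two unit vectors bounds an off-diagonal entry by the mean of two diagonal
  entries.\<close>

lemma state_ok_entry_bound:
  assumes ok: "state_ok n m H Z B" and D: "\<And>i. i < n \<Longrightarrow> vnth (rnth Z i) i \<le> D"
    and ij: "i < n" "j < n"
  shows "\<bar>vnth (rnth Z i) j\<bar> \<le> D"
proof -
  have H: "0 < real_of_int H" and sym: "sym_mat n (\<lambda>i j. vnth (rnth Z i) j)" and dual: "gram_dual n m (qfun H Z) (rfun B)"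
    using ok unfolding state_ok_def by auto
  have pos: "0 \<le> bform n (rfun Z) g g" for g
  proof -
    have "bform n (qfun H Z) g g = bform n (rfun Z) g g / H"
      by (simp add: bform_def qfun_def sum_divide_distrib)
    then show ?thesis using gram_dual_nonneg[OF dual, of g] H by (simp add: zero_le_divide_iff)
  qed
  have unit: "bform n (rfun Z) (\<lambda>k. if k = p then x else 0) (\<lambda>k. if k = q then y else 0) = x * rfun Z p q * y"
    if "p < n" "q < n" for p q x y
  proof -
    have "(if i = p then x else 0) * rfun Z i j * (if j = q then y else 0)
        = (if j = q then if i = p then x * rfun Z p q * y else 0 else 0)" for i j
      by simp
    then show ?thesis using that by (simp add: bform_def sum.delta)
  qed
  have rs: "rfun Z j i = rfun Z i j" using sym ij unfolding sym_mat_def rfun_def vfun_def by simp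
  have "0 \<le> rfun Z i i + 2 * c * rfun Z i j + c * c * rfun Z j j" for c
    using pos[of "\<lambda>k. (if k = i then 1 else 0) + (if k = j then c else 0)"]
    unfolding bform_lin1 bform_lin2 using ij by (simp add: unit rs algebra_simps)
  from this[of 1] this[of "- 1"] have "2 * \<bar>rfun Z i j\<bar> \<le> rfun Z i i + rfun Z j j" by simp
  then have "2 * \<bar>vnth (rnth Z i) j\<bar> \<le> vnth (rnth Z i) i + vnth (rnth Z j) j"
    unfolding rfun_def vfun_def by linarith
  then show ?thesis using D[OF ij(1)] D[OF ij(2)] by linarith
qed

lemma set_violated:
  assumes "dims m n B"
  shows "k \<in> set (violated Z B y) \<longleftrightarrow> k < m \<and> vdot (rnth B k) (matvec Z (row_comb y B)) \<le> 0"
  using assms by (simp add: violated_def Let_def dims_def)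

lemma vfun_increment:
  "k < length y \<Longrightarrow> vfun (increment y k) i = vfun y i + (if i = k then 1 else 0)"
  by (simp add: increment_def vfun_def nth_default_def)

lemma violated_bform:
  assumes ok: "state_ok n m H Z B" and "k \<in> set (violated Z B y)"
  shows "k < m"
    and "bform n (qfun H Z) (rfun B k) (\<lambda>i. \<Sum>k<m. vfun y k * rfun B k i) \<le> 0"
proof -
  have H: "0 < H" and m: "0 < m" and dZ: "dims n n Z" and dB: "dims m n B"
    using ok unfolding state_ok_def by auto
  have k: "k < m" "vdot (rnth B k) (matvec Z (row_comb y B)) \<le> 0"
    using assms(2) by (simp_all add: set_violated[OF dB])
  let ?g = "\<lambda>i. \<Sum>k<m. vfun y k * rfun B k i"
  have "real_of_int (vdot (rnth B k) (matvec Z (row_comb y B)))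
      = dot n (rfun B k) (vfun (matvec Z (row_comb y B)))"
    by (simp add: vdot_eq[OF dims_rnth[OF dB k(1)]] rfun_def)
  also have "\<dots> = dot n (rfun B k) (\<lambda>i. H * dot n (qfun H Z i) ?g)"
  proof (rule dot_cong)
    fix i assume i: "i < n"
    have "vfun (matvec Z (row_comb y B)) i = dot n (rfun Z i) (vfun (row_comb y B))"
      by (rule vfun_matvec[OF dZ i])
    also have "\<dots> = dot n (rfun Z i) ?g"
      by (rule dot_cong) (simp_all add: vfun_row_comb[OF dB m])
    finally show "vfun (matvec Z (row_comb y B)) i = H * dot n (qfun H Z i) ?g"
      by (simp add: dot_qfun[OF H])
  qed simp
  also have "\<dots> = H * bform n (qfun H Z) (rfun B k) ?g"
    by (simp add: dot_lin bform_eq_dot)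
  finally have "H * bform n (qfun H Z) (rfun B k) ?g \<le> 0"
    using k(2) by (metis of_int_le_0_iff)
  then show "bform n (qfun H Z) (rfun B k) ?g \<le> 0"
    using H by (simp add: mult_le_0_iff)
  show "k < m" by (rule k(1))
qed

text \<open>A violated row has a nonpositive mixed term with the current combination. Adding it
  therefore raises the form by at most the form of that row itself, while the coefficient sum rises
  by exactly 1.\<close>

lemma perceptron_potential:
  assumes ok: "state_ok n m H Z B"
    and L: "\<And>k. k < m \<Longrightarrow> bform n (qfun H Z) (rfun B k) (rfun B k) \<le> 2"
  defines "y \<equiv> \<lambda>l. foldl (\<lambda>y a. percep_step Z B y) (map (\<lambda>u. 0) B) (l :: nat list)"
    and "g \<equiv> \<lambda>y i. \<Sum>k<m. vfun y k * rfun B k i"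
  shows "violated Z B (y l) = [] \<or>
    (\<Sum>k<m. vfun (y l) k) = length l \<and> bform n (qfun H Z) (g (y l)) (g (y l)) \<le> 2 * length l"
proof (induction l rule: rev_induct)
  case Nil
  have "vfun (y []) k = 0" for k by (simp add: y_def vfun_def nth_default_def)
  then show ?case by (simp add: g_def bform_def)
next
  case (snoc a l)
  have dB: "dims m n B" and sym: "sym_mat n (\<lambda>i j. vnth (rnth Z i) j)"
    using ok unfolding state_ok_def by auto
  have step: "y (l @ [a]) = percep_step Z B (y l)" by (simp add: y_def)
  have len: "length (y l) = m" using dB by (simp add: y_def perceptron_fold_bounds dims_def)
  show ?case
  proof (rule vnth_percep_step_cases[of Z B "y l"])
    fix k assume k: "percep_step Z B (y l) = increment (y l) k" "k \<in> set (violated Z B (y l))"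
    note viol = violated_bform[OF ok k(2)]
    from k(2) have "violated Z B (y l) \<noteq> []" by auto
    with snoc have IH: "(\<Sum>k<m. vfun (y l) k) = length l"
      "bform n (qfun H Z) (g (y l)) (g (y l)) \<le> 2 * length l" by auto
    have inc: "vfun (y (l @ [a])) i = vfun (y l) i + (if i = k then 1 else 0)" for i
      unfolding step k(1) using viol(1) len by (intro vfun_increment) simp
    have "g (y (l @ [a])) = (\<lambda>i. g (y l) i + rfun B k i)"
      unfolding g_def inc using viol(1) by (auto simp: distrib_right sum.distrib if_distrib[of "\<lambda>t. t * _"] cong: if_cong)
    then have "bform n (qfun H Z) (g (y (l @ [a]))) (g (y (l @ [a]))) \<le> 2 * length l + 2"
      using bform_perceptron_step[OF sym_qfun[OF sym] viol(2)[folded g_def]] IH(2) L[OF viol(1)]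
      unfolding g_def by fastforce
    moreover have "(\<Sum>k<m. vfun (y (l @ [a])) k) = length l + 1"
      unfolding inc using viol(1) IH(1) by (simp add: sum.distrib)
    ultimately show ?thesis by simp
  next
    assume "percep_step Z B (y l) = y l" "violated Z B (y l) = []"
    then show ?thesis unfolding step by simp
  qed
qed

lemma heavy_row_exists:
  fixes v :: "nat \<Rightarrow> real"
  assumes "(\<Sum>k<m. v k) = 8 * real m ^ 3" "0 < m"
  shows "\<exists>k<m. 8 * real m ^ 2 \<le> v k"
proof (rule ccontr)
  assume "\<not> ?thesis"
  then have "(\<Sum>k<m. v k) < (\<Sum>k<m. 8 * real m ^ 2)"
    using assms(2) by (intro sum_strict_mono) auto
  then show False using assms(1) by (simp add: power2_eq_square power3_eq_cube)
qed

lemma rescale_progress: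
  assumes ok: "state_ok n m H Z B"
    and L: "\<And>k. k < m \<Longrightarrow> bform n (qfun H Z) (rfun B k) (rfun B k) \<le> 2"
    and w: "\<And>k. k < m \<Longrightarrow> 0 \<le> dot n (rfun B k) w \<and> dot n (rfun B k) w \<le> 1"
    and fail: "violated Z B (perceptron Z B) \<noteq> []"
  obtains k where "k < m" "rescale H (Z, B) = (shrink H Z (rnth B k), double_row B k)"
    "dot n (rfun B k) w \<le> 1 / 2"
proof -
  have m: "0 < m" and dB: "dims m n B" and dual: "gram_dual n m (qfun H Z) (rfun B)"
    using ok unfolding state_ok_def by auto
  have len: "length B = m" using dB by (simp add: dims_def)
  let ?y = "perceptron Z B"
  have y: "(\<Sum>k<m. vfun ?y k) = 8 * real m ^ 3"
    "bform n (qfun H Z) (\<lambda>i. \<Sum>k<m. vfun ?y k * rfun B k i) (\<lambda>i. \<Sum>k<m. vfun ?y k * rfun B k i)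
       \<le> 16 * real m ^ 3"
    using perceptron_potential[OF ok L, of "[0..<8 * m ^ 3]"] fail
    unfolding perceptron_def len by auto
  define F where "F = filter (\<lambda>k. 8 * int m ^ 2 \<le> vnth ?y k) [0..<m]"
  have iff: "8 * real m ^ 2 \<le> vfun ?y k \<longleftrightarrow> 8 * int m ^ 2 \<le> vnth ?y k" for k
  proof -
    have "8 * real m ^ 2 = real_of_int (8 * int m ^ 2)" by simp
    then show ?thesis unfolding vfun_def by (metis of_int_le_iff)
  qed
  have "F \<noteq> []"
    using heavy_row_exists[OF y(1) m] unfolding F_def iff by (auto simp: filter_empty_conv)
  then have k: "nth_default 0 F 0 \<in> set F" by (simp add: nth_default_def)
  define k where "k = nth_default 0 F 0"
  have k: "k < m" "8 * real m ^ 2 \<le> vfun ?y k"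
    using k unfolding k_def[symmetric] iff by (auto simp: F_def)
  have "dot n (rfun B k) w \<le> 1 / 2"
  proof (rule perceptron_cut[OF dual k(1) _ _ y(2) k(2)])
    show "0 \<le> vfun ?y i" for i unfolding vfun_def perceptron_def by (simp add: perceptron_fold_bounds(2))
  qed (use w in auto)
  moreover have "rescale H (Z, B) = (shrink H Z (rnth B k), double_row B k)"
    using fail by (simp add: rescale_def Let_def len F_def[symmetric] k_def[symmetric])
  ultimately show ?thesis using that k(1) by blast
qed

lemma rescale_success: "violated Z B (perceptron Z B) = [] \<Longrightarrow> rescale H (Z, B) = (Z, B)"
  by (simp add: rescale_def Let_def)

lemma rescale_cases:
  assumes "length B = m" "0 < m"
  obtains "rescale H (Z, B) = (Z, B)"
  | k where "k < m" "rescale H (Z, B) = (shrink H Z (rnth B k), double_row B k)"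
proof -
  define F where "F = filter (\<lambda>k. 8 * int (length B) ^ 2 \<le> vnth (perceptron Z B) k) [0..<length B]"
  have "nth_default 0 F 0 < m"
  proof (cases "F = []")
    case False
    then have "nth_default 0 F 0 \<in> set F" by (simp add: nth_default_def)
    then show ?thesis using assms by (auto simp: F_def)
  qed (use assms in simp)
  then show ?thesis
    using that unfolding rescale_def Let_def F_def[symmetric] fst_conv snd_conv by metis
qed

section \<open>The rounds of the solver on a fixed system\<close>

definition row_count :: "int list list \<Rightarrow> nat \<Rightarrow> nat" where
  "row_count R n = length R + n"

context
  fixes R :: "int list list" and n :: nat
  assumes R_ne: "R \<noteq> []" and R_len: "\<And>u. u \<in> set R \<Longrightarrow> length u = n" and n_pos: "0 < n"
begin

private lemma len0: "length (rnth R 0) = n"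
  using R_ne R_len by (simp add: nth_default_def)

private abbreviation "numrows \<equiv> row_count R n"

private abbreviation "row0 \<equiv> rfun (all_rows R)"
private abbreviation "\<sigma> \<equiv> real_of_int (row_bound R)"

private lemma dims_all: "dims numrows n (all_rows R)"
  using R_len by (auto simp: dims_def all_rows_def len0 row_count_def)

private lemma sum_abs_nonneg: "0 \<le> (\<Sum>a\<leftarrow>u. \<bar>a :: int\<bar>)"
  by (rule sum_list_nonneg) auto

private lemma row_bound_ge1: "1 \<le> row_bound R"
proof -
  have "0 \<le> (\<Sum>u\<leftarrow>R. \<Sum>a\<leftarrow>u. \<bar>a\<bar>)" by (rule sum_list_nonneg) (auto intro: sum_abs_nonneg)
  then show ?thesis by (simp add: row_bound_def)
qed

private lemma sum_abs_le_row_bound: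
  assumes "u \<in> set R"
  shows "(\<Sum>a\<leftarrow>u. \<bar>a\<bar>) \<le> row_bound R"
proof -
  have "(\<Sum>a\<leftarrow>u. \<bar>a\<bar>) \<in> set (map (\<lambda>u. \<Sum>a\<leftarrow>u. \<bar>a\<bar>) R)" using assms by auto
  then have "(\<Sum>a\<leftarrow>u. \<bar>a\<bar>) \<le> (\<Sum>u\<leftarrow>R. \<Sum>a\<leftarrow>u. \<bar>a\<bar>)"
    by (rule member_le_sum_list) (auto intro: sum_abs_nonneg)
  then show ?thesis by (simp add: row_bound_def)
qed

private lemma sum_abs_eq:
  assumes "length u = n"
  shows "(\<Sum>i<n. \<bar>vfun u i\<bar>) = real_of_int (\<Sum>a\<leftarrow>u. \<bar>a\<bar>)"
proof -
  have "(\<Sum>a\<leftarrow>u. \<bar>a\<bar>) = (\<Sum>i<n. \<bar>vnth u i\<bar>)"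
    using assms by (simp add: sum_list_sum_nth atLeast0LessThan nth_default_def)
  then show ?thesis by (simp add: vfun_def)
qed

lemma rnth_all_rows:
  assumes "k < numrows"
  obtains "rnth (all_rows R) k \<in> set R"
  | v where "v < n" "\<And>i. i < n \<Longrightarrow> row0 k i = (if i = v then \<sigma> else 0)"
proof (cases "k < length R")
  case True
  then have "rnth (all_rows R) k \<in> set R" by (simp add: all_rows_def nth_default_def nth_append)
  then show ?thesis by (rule that(1))
next
  case False
  then show ?thesis using assms
    by (intro that(2)[of "k - length R"])
      (auto simp: all_rows_def row_count_def len0 rfun_def vfun_def nth_default_append)
qed

private lemma row_abs_sum:
  assumes "k < numrows"
  shows "(\<Sum>i<n. \<bar>row0 k i\<bar>) \<le> row_bound R"
proof (rule rnth_all_rows[OF assms])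
  assume k: "rnth (all_rows R) k \<in> set R"
  show ?thesis
    unfolding rfun_def sum_abs_eq[OF R_len[OF k]] using sum_abs_le_row_bound[OF k] by simp
next
  fix v assume v: "v < n" "\<And>i. i < n \<Longrightarrow> row0 k i = (if i = v then \<sigma> else 0)"
  have "(\<Sum>i<n. \<bar>row0 k i\<bar>) = (\<Sum>i<n. if i = v then \<sigma> else 0)"
    by (rule sum.cong) (use v row_bound_ge1 in auto)
  then show ?thesis using v by simp
qed

private lemma row_sq_sum:
  assumes "k < numrows"
  shows "(\<Sum>i<n. (row0 k i)\<^sup>2) \<le> (\<sigma>)\<^sup>2"
proof -
  have "(\<Sum>i<n. (row0 k i)\<^sup>2) = (\<Sum>i<n. \<bar>row0 k i\<bar> * \<bar>row0 k i\<bar>)"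
    by (simp add: power2_eq_square)
  also have "\<dots> \<le> (\<Sum>i<n. \<bar>row0 k i\<bar> * (\<Sum>i<n. \<bar>row0 k i\<bar>))"
    by (intro sum_mono mult_left_mono member_le_sum) auto
  also have "\<dots> = (\<Sum>i<n. \<bar>row0 k i\<bar>)\<^sup>2"
    by (simp add: sum_distrib_right[symmetric] power2_eq_square)
  also have "\<dots> \<le> (\<sigma>)\<^sup>2"
    by (intro power_mono row_abs_sum assms sum_nonneg) auto
  finally show ?thesis .
qed

private lemma rounds_pos: "0 < rounds R"
  by (simp add: rounds_def)

private lemma denom_facts: "0 < init_diag R" "0 < mat_denom R"
  using n_pos row_bound_ge1 rounds_pos by (simp_all add: init_diag_def mat_denom_def len0)

private lemma qfun_init:
  "i < n \<Longrightarrow> j < n \<Longrightarrow> qfun (mat_denom R) (init_mat R) i j = (if i = j then 1 / (\<sigma>)\<^sup>2 else 0)"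
  using denom_facts(1) by (simp add: qfun_def rfun_def vfun_def init_mat_def len0 mat_denom_def power2_eq_square)

private lemma bform_init:
  "bform n (qfun (mat_denom R) (init_mat R)) g g = (\<Sum>i<n. (g i)\<^sup>2) / (\<sigma>)\<^sup>2"
proof -
  have "bform n (qfun (mat_denom R) (init_mat R)) g g
      = (\<Sum>i<n. \<Sum>j<n. if i = j then (g i)\<^sup>2 / (\<sigma>)\<^sup>2 else 0)"
    unfolding bform_def by (intro sum.cong refl) (auto simp: qfun_init power2_eq_square)
  then show ?thesis by (simp add: sum_divide_distrib)
qed

text \<open>The added rows alone contribute \<open>\<sigma>^2\<close> times the squared norm of
  \<open>w\<close>; completing the square in each coordinate then gives the conjugate bound.\<close>

private lemma state_ok_init: "state_ok n numrows (mat_denom R) (init_mat R) (all_rows R)"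
proof -
    have s: "0 < \<sigma>" using row_bound_ge1 by simp
  have "gram_dual n numrows (qfun (mat_denom R) (init_mat R)) (row0)"
    unfolding gram_dual_def
  proof (intro allI)
    fix g w :: "nat \<Rightarrow> real"
    have unit: "dot n (row0 (length R + v)) w = \<sigma> * w v" if "v < n" for v
    proof -
      have "dot n (row0 (length R + v)) w = (\<Sum>i<n. if i = v then \<sigma> * w v else 0)"
        unfolding dot_def using that
        by (intro sum.cong refl) (auto simp: all_rows_def len0 rfun_def vfun_def nth_default_append)
      then show ?thesis using that by simp
    qed
    have "(\<Sum>v<n. (\<sigma> * w v)\<^sup>2) = (\<Sum>k\<in>(+) (length R) ` {..<n}. (dot n (row0 k) w)\<^sup>2)"
      by (subst sum.reindex) (auto simp: unit)
    also have "\<dots> \<le> (\<Sum>k<numrows. (dot n (row0 k) w)\<^sup>2)"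
      by (rule sum_mono2) (auto simp: row_count_def)
    finally have le: "(\<Sum>v<n. (\<sigma> * w v)\<^sup>2) \<le> (\<Sum>k<numrows. (dot n (row0 k) w)\<^sup>2)" .
    have "2 * dot n g w - (\<Sum>v<n. (\<sigma> * w v)\<^sup>2) = (\<Sum>v<n. 2 * (g v * w v) - (\<sigma> * w v)\<^sup>2)"
      by (simp add: dot_def sum_subtractf sum_distrib_left)
    also have "\<dots> \<le> (\<Sum>v<n. (g v)\<^sup>2 / \<sigma>\<^sup>2)"
    proof (rule sum_mono)
      fix v
      have "0 \<le> (g v / \<sigma> - \<sigma> * w v)\<^sup>2" by simp
      then show "2 * (g v * w v) - (\<sigma> * w v)\<^sup>2 \<le> (g v)\<^sup>2 / \<sigma>\<^sup>2"
        using s by (simp add: power2_diff power_divide)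
    qed
    finally show "2 * dot n g w - (\<Sum>k<numrows. (dot n (row0 k) w)\<^sup>2)
        \<le> bform n (qfun (mat_denom R) (init_mat R)) g g"
      using le by (simp add: bform_init sum_divide_distrib)
  qed
  moreover have "dims n n (init_mat R)" by (auto simp: dims_def init_mat_def len0)
  moreover have "sym_mat n (\<lambda>i j. vnth (rnth (init_mat R) i) j)"
    by (simp add: sym_mat_def init_mat_def len0)
  ultimately show ?thesis
    unfolding state_ok_def using denom_facts(2) dims_all n_pos by (simp add: row_count_def)
qed

private definition "state r = ((\<lambda>s. rescale (mat_denom R) s) ^^ r) (init_mat R, all_rows R)"

private lemma foldl_state: "foldl (\<lambda>s a. rescale (mat_denom R) s) (init_mat R, all_rows R) l = state (length l)"
  by (induction l rule: rev_induct) (simp_all add: state_def)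

private lemma state_Suc: "state (Suc r) = rescale (mat_denom R) (fst (state r), snd (state r))"
  by (simp add: state_def)

text \<open>Solvability is not assumed, since failing runs must be short as well. A round at most
  doubles the entries of the rows and adds at most \<open>n\<close> to each diagonal entry of the
  matrix.\<close>

private lemma state_inv:
  "state_ok n numrows (mat_denom R) (fst (state r)) (snd (state r)) \<and>
   (\<forall>i<n. vnth (rnth (fst (state r)) i) i \<le> init_diag R + int r * int n) \<and>
   (\<forall>k<numrows. \<forall>i<n. \<bar>vnth (rnth (snd (state r)) k) i\<bar> \<le> 2 ^ r * row_bound R)"
proof (induction r)
  case 0
  have "\<bar>vnth (rnth (all_rows R) k) i\<bar> \<le> row_bound R" if "k < numrows" "i < n" for k i
  proof -
    have "\<bar>row0 k i\<bar> \<le> (\<Sum>i<n. \<bar>row0 k i\<bar>)"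
      by (rule member_le_sum) (use that in auto)
    also have "\<dots> \<le> row_bound R" by (rule row_abs_sum[OF that(1)])
    finally show ?thesis unfolding rfun_def vfun_def by linarith
  qed
  then show ?case using state_ok_init by (simp add: state_def init_mat_def len0)
next
  case (Suc r)
  then have ok: "state_ok n numrows (mat_denom R) (fst (state r)) (snd (state r))" by simp
  have dB: "dims numrows n (snd (state r))" and m: "0 < numrows" using ok by (auto simp: state_ok_def)
  have double: "2 ^ r * row_bound R \<le> 2 * 2 ^ r * row_bound R"
    using row_bound_ge1 by simp
  show ?case
  proof (rule rescale_cases[of "snd (state r)" numrows "mat_denom R" "fst (state r)"])
    assume "rescale (mat_denom R) (fst (state r), snd (state r)) = (fst (state r), snd (state r))"
    moreover have "\<bar>b\<bar> \<le> 2 ^ Suc r * row_bound R" if "\<bar>b\<bar> \<le> 2 ^ r * row_bound R" for b :: int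
      using that double by simp
    ultimately show ?thesis unfolding state_Suc using Suc n_pos
      by (auto simp: distrib_right)
  next
    fix k assume k: "k < numrows" and eq: "rescale (mat_denom R) (fst (state r), snd (state r)) =
      (shrink (mat_denom R) (fst (state r)) (rnth (snd (state r)) k), double_row (snd (state r)) k)"
    have "\<bar>vnth (rnth (double_row (snd (state r)) k) k') i\<bar> \<le> 2 ^ Suc r * row_bound R"
      if "k' < numrows" "i < n" for k' i
    proof -
      have B: "\<bar>vnth (rnth (snd (state r)) k') i\<bar> \<le> 2 ^ r * row_bound R" using Suc that by simp
      have "vnth (map (\<lambda>a. 2 * a) u) i = 2 * vnth u i" for u by (simp add: nth_default_def)
      then have "\<bar>vnth (rnth (double_row (snd (state r)) k) k') i\<bar> \<le> 2 * \<bar>vnth (rnth (snd (state r)) k') i\<bar>"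
        using that dB by (simp add: double_row_def dims_def abs_mult)
      then show ?thesis using B by simp
    qed
    moreover have "vnth (rnth (fst (state (Suc r))) i) i \<le> init_diag R + int (Suc r) * int n" if "i < n" for i
      using shrink_facts(3)[OF ok k that] Suc that unfolding state_Suc eq by (fastforce simp: distrib_right)
    ultimately show ?thesis
      unfolding state_Suc eq using shrink_facts(1)[OF ok k] by simp
  qed (use dB m in \<open>simp_all add: dims_def\<close>)
qed

lemma csize_state:
  assumes "r \<le> rounds R"
  shows "csize (foldl (\<lambda>s a. rescale (mat_denom R) s) (init_mat R, all_rows R) (take r [0..<rounds R]))
    \<le> 1 + (1 + n * (1 + (1 + n * (1 + csize (init_diag R + int (rounds R) * int n)))))
      + (1 + numrows * (1 + (1 + n * (1 + csize (2 ^ rounds R * row_bound R)))))"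
proof -
  note inv = state_inv[of r]
  then have ok: "state_ok n numrows (mat_denom R) (fst (state r)) (snd (state r))" by simp
  have dZ: "dims n n (fst (state r))" and dB: "dims numrows n (snd (state r))"
    using ok by (auto simp: state_ok_def)
  have mat: "csize M \<le> 1 + p * (1 + (1 + n * (1 + csize b)))"
    if d: "dims p n M" and b: "\<And>k i. k < p \<Longrightarrow> i < n \<Longrightarrow> \<bar>vnth (rnth M k) i\<bar> \<le> b" for M p and b :: int
  proof -
    have "csize u \<le> 1 + n * (1 + csize b)" if u: "u \<in> set M" for u
    proof -
      obtain k where k: "k < p" "u = rnth M k"
        using u d by (auto simp: in_set_conv_nth dims_def nth_default_def)
      have "length u = n" using u d by (simp add: dims_def)
      moreover have "csize a \<le> csize b" if a: "a \<in> set u" for a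
      proof -
        obtain i where "i < n" "a = vnth u i"
          using a \<open>length u = n\<close> by (auto simp: in_set_conv_nth nth_default_def)
        then show ?thesis using b[OF k(1), of i] k(2) by (intro csize_int_mono) auto
      qed
      ultimately show ?thesis using csize_list_le[of u "csize b"] by simp
    qed
    from csize_list_le[of M, OF this] show ?thesis using d by (simp add: dims_def)
  qed
  have "csize (fst (state r)) \<le> 1 + n * (1 + (1 + n * (1 + csize (init_diag R + int (rounds R) * int n))))"
  proof (rule mat[OF dZ])
    have "int r * int n \<le> int (rounds R) * int n" using assms by (intro mult_right_mono) auto
    then have diag: "vnth (rnth (fst (state r)) i) i \<le> init_diag R + int (rounds R) * int n" if "i < n" for i
      using inv that by (meson add_left_mono order_trans)
    show "\<bar>vnth (rnth (fst (state r)) k) i\<bar> \<le> init_diag R + int (rounds R) * int n"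
      if "k < n" "i < n" for k i
      by (rule state_ok_entry_bound[OF ok diag that])
  qed
  moreover have "csize (snd (state r)) \<le> 1 + numrows * (1 + (1 + n * (1 + csize (2 ^ rounds R * row_bound R))))"
  proof (rule mat[OF dB])
    fix k i assume ki: "k < numrows" "i < n"
    have "\<bar>vnth (rnth (snd (state r)) k) i\<bar> \<le> 2 ^ r * row_bound R" using inv ki by simp
    also have "\<dots> \<le> 2 ^ rounds R * row_bound R"
      using assms row_bound_ge1 by (intro mult_right_mono power_increasing) auto
    finally show "\<bar>vnth (rnth (snd (state r)) k) i\<bar> \<le> 2 ^ rounds R * row_bound R" .
  qed
  ultimately show ?thesis
    using csize_pair[of "fst (state r)" "snd (state r)"] assms by (simp add: foldl_state)
qed

private lemma final_state_eq: "final_state R = state (rounds R)"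
  by (simp add: final_state_def foldl_state)

text \<open>
  The exponents \<open>e k\<close> count the doublings of row \<open>k\<close>. As the product of row \<open>k\<close> with \<open>w\<close> stays at most \<open>1\<close>,
  none of them exceeds \<open>row_bits R\<close>.
\<close>

private definition "progress w r \<longleftrightarrow>
  (\<exists>e. (\<forall>k<numrows. rfun (snd (state r)) k = (\<lambda>i. 2 ^ e k * row0 k i)) \<and>
     (\<Sum>k<numrows. e k) = r \<and> (\<forall>k<numrows. dot n (rfun (snd (state r)) k) w \<le> 1) \<and>
     (\<forall>k<numrows. bform n (qfun (mat_denom R) (fst (state r))) (rfun (snd (state r)) k) (rfun (snd (state r)) k)
        \<le> 1 + real r / real (rounds R)))"

private definition "success r \<longleftrightarrow>
  violated (fst (state r)) (snd (state r)) (perceptron (fst (state r)) (snd (state r))) = []"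

private lemma exponent_le:
  assumes w: "1 / 2 ^ row_bits R \<le> c" and "2 ^ e * c \<le> (1 :: real)"
  shows "e \<le> row_bits R"
proof (rule ccontr)
  assume "\<not> ?thesis"
  then have "(2 :: real) ^ row_bits R < 2 ^ e" by simp
  moreover have "2 ^ e * (1 / 2 ^ row_bits R) \<le> (1 :: real)"
    by (rule order_trans[OF mult_left_mono[OF w] assms(2)]) simp
  ultimately show False by (simp add: field_simps)
qed

text \<open>If the doubled row had form \<open>a\<close> before, the exact update leaves it with
  \<open>4 * a / (1 + 3 * a)\<close>, which is at most \<open>max 1 a\<close>; the forms of the
  other rows cannot rise. Rounding adds at most \<open>1 / rounds R\<close>, so all forms stay at
  most 2 as the perceptron needs. The product of the doubled row with \<open>w\<close> was at most
  \<open>1 / 2\<close> and stays at most 1.\<close>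

private lemma progress_Suc:
  assumes w: "\<And>k. k < numrows \<Longrightarrow> 1 / 2 ^ row_bits R \<le> dot n (row0 k) w"
    and prog: "progress w r" and r: "r < rounds R" and fail: "\<not> success r"
  shows "progress w (Suc r)"
proof -
  define Z B where "Z = fst (state r)" and "B = snd (state r)"
  obtain e where e: "\<And>k. k < numrows \<Longrightarrow> rfun B k = (\<lambda>i. 2 ^ e k * row0 k i)"
     "(\<Sum>k<numrows. e k) = r" "\<And>k. k < numrows \<Longrightarrow> dot n (rfun B k) w \<le> 1"
     "\<And>k. k < numrows \<Longrightarrow> bform n (qfun (mat_denom R) Z) (rfun B k) (rfun B k)
        \<le> 1 + real r / real (rounds R)"
    using prog unfolding progress_def Z_def B_def by blast
  have ok: "state_ok n numrows (mat_denom R) Z B"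
    using state_inv[of r] by (simp add: Z_def B_def)
  have G: "0 < real (rounds R)" using rounds_pos by simp
  have "real r / real (rounds R) \<le> 1" using r by simp
  then have L: "bform n (qfun (mat_denom R) Z) (rfun B k) (rfun B k) \<le> 2" if "k < numrows" for k
    using e(4)[OF that] by linarith
  have w0: "0 < dot n (row0 k) w" if "k < numrows" for k
    using w[OF that] by (rule less_le_trans[rotated]) simp
  have wB: "0 \<le> dot n (rfun B k) w \<and> dot n (rfun B k) w \<le> 1" if "k < numrows" for k
    using e(3)[OF that] w0[OF that] by (simp add: e(1)[OF that] dot_lin)
  obtain k where k: "k < numrows" "rescale (mat_denom R) (Z, B) = (shrink (mat_denom R) Z (rnth B k), double_row B k)"
      "dot n (rfun B k) w \<le> 1 / 2"
    by (rule rescale_progress[OF ok L wB]) (use fail in \<open>auto simp: success_def Z_def B_def\<close>)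
  define Z' B' where "Z' = shrink (mat_denom R) Z (rnth B k)" and "B' = double_row B k"
  have st: "fst (state (Suc r)) = Z'" "snd (state (Suc r)) = B'"
    using k(2) by (simp_all add: state_Suc Z_def[symmetric] B_def[symmetric] Z'_def B'_def)
  define e' where "e' = e(k := Suc (e k))"
  have "length B = numrows" using ok by (simp add: state_ok_def dims_def)
  then have B': "rfun B' = (rfun B)(k := (\<lambda>i. 2 * rfun B k i))"
    unfolding B'_def using k(1) by (intro rfun_double_row) simp
  have row: "rfun B' j = (\<lambda>i. 2 ^ e' j * row0 j i)" if "j < numrows" for j
    using e(1)[OF that] by (auto simp: B' e'_def fun_eq_iff)
  have "(\<Sum>j<numrows. e' j) = (\<Sum>j<numrows. e j + (if j = k then 1 else 0))"
    by (rule sum.cong) (auto simp: e'_def)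
  also have "\<dots> = Suc r" using k(1) e(2) by (simp add: sum.distrib)
  finally have sum: "(\<Sum>j<numrows. e' j) = Suc r" .
  have le1: "dot n (rfun B' j) w \<le> 1" if "j < numrows" for j
    using e(3)[OF that] k(3) by (auto simp: B' dot_lin)
  have bf: "bform n (qfun (mat_denom R) Z') (rfun B' j) (rfun B' j) \<le> 1 + real (Suc r) / real (rounds R)"
    if j: "j < numrows" for j
  proof -
    let ?H = "real_of_int (mat_denom R)"
    let ?a = "bform n (qfun (mat_denom R) Z) (rfun B k) (rfun B k)"
    let ?t = "\<lambda>i. dot n (qfun (mat_denom R) Z i) (rfun B k)"
    have a: "0 \<le> ?a" using ok gram_dual_nonneg by (auto simp: state_ok_def)
    \<comment> \<open>This limits the squared norm of the scaled row to
      \<open>2 ^ (2 * row_bits R) * \<sigma>^2\<close>, which the denominator of the matrix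
      cancels.\<close>
    have "e' j \<le> row_bits R"
      using exponent_le[OF w[OF j], of "e' j"] le1[OF j] unfolding row[OF j] dot_lin .
    then have "(2 ^ e' j)\<^sup>2 \<le> (2 ^ row_bits R :: real)\<^sup>2" by (intro power_mono power_increasing) auto
    then have "(2 ^ e' j)\<^sup>2 * (\<Sum>i<n. (row0 j i)\<^sup>2) \<le> (2 ^ row_bits R)\<^sup>2 * \<sigma>\<^sup>2"
      by (intro mult_mono row_sq_sum j) (auto intro: sum_nonneg)
    then have "(\<Sum>i<n. (rfun B' j i)\<^sup>2) \<le> (2 ^ row_bits R)\<^sup>2 * \<sigma>\<^sup>2"
      unfolding row[OF j] by (simp add: power_mult_distrib sum_distrib_left)
    then have "2 * real n / ?H * (\<Sum>i<n. (rfun B' j i)\<^sup>2) \<le> 2 * real n / ?H * ((2 ^ row_bits R)\<^sup>2 * \<sigma>\<^sup>2)"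
      using denom_facts(2) by (intro mult_left_mono) auto
    also have "\<dots> = 1 / real (rounds R)"
    proof -
      have "?H = 2 * real n * real (rounds R) * (2 ^ row_bits R)\<^sup>2 * \<sigma>\<^sup>2"
        by (simp add: mat_denom_def init_diag_def len0 power_even_eq power2_eq_square[of \<sigma>])
      then show ?thesis using n_pos G row_bound_ge1 by simp
    qed
    finally have err: "2 * real n / ?H * (\<Sum>i<n. (rfun B' j i)\<^sup>2) \<le> 1 / real (rounds R)" .
    have main: "bform n (qfun (mat_denom R) Z) (rfun B' j) (rfun B' j) - 3 / (1 + 3 * ?a) * (dot n ?t (rfun B' j))\<^sup>2
        \<le> 1 + real r / real (rounds R)"
    proof (cases "j = k")
      case False
      have "0 \<le> 3 / (1 + 3 * ?a) * (dot n ?t (rfun B' j))\<^sup>2" using a by simp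
      then show ?thesis using False e(4)[OF j] by (simp add: B')
    next
      case True
      have "dot n ?t (rfun B k) = ?a"
        by (simp add: bform_eq_dot dot_def mult.commute)
      then have "bform n (qfun (mat_denom R) Z) (rfun B' j) (rfun B' j) - 3 / (1 + 3 * ?a) * (dot n ?t (rfun B' j))\<^sup>2
          = 4 * ?a - 3 / (1 + 3 * ?a) * (2 * ?a)\<^sup>2"
        by (simp add: True B' bform_lin1 bform_lin2 dot_lin)
      also have "\<dots> = 4 * ?a / (1 + 3 * ?a)"
      proof -
        have "4 * x - 3 / (1 + 3 * x) * (2 * x)\<^sup>2 = 4 * x / (1 + 3 * x)" if "0 \<le> x" for x :: real
        proof -
          have "1 + 3 * x \<noteq> 0" using that by linarith
          then show ?thesis by (simp add: field_simps power2_eq_square)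
        qed
        then show ?thesis using a by blast
      qed
      also have "\<dots> \<le> max 1 ?a"
      proof (cases "?a \<le> 1")
        case True
        then have "4 * ?a / (1 + 3 * ?a) \<le> 1" using a by (simp add: divide_le_eq)
        then show ?thesis by simp
      next
        case False
        then have "4 * ?a \<le> ?a * (1 + 3 * ?a)"
          using mult_left_mono[of 4 "1 + 3 * ?a" ?a] by (simp add: mult.commute)
        then have "4 * ?a / (1 + 3 * ?a) \<le> ?a" using a by (simp add: pos_divide_le_eq)
        then show ?thesis by simp
      qed
      also have "\<dots> \<le> 1 + real r / real (rounds R)" using e(4)[OF k(1)] by simp
      finally show ?thesis .
    qed
    show ?thesis
      using shrink_facts(2)[OF ok k(1), of "rfun B' j"] main err unfolding Z'_def[symmetric]
      by (simp add: add_divide_distrib)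
  qed
  show ?thesis unfolding progress_def st using row sum le1 bf by blast
qed

text \<open>Suppose that every round fails. Each failure doubles a row whose product with the
  normalised solution is at most \<open>1 / 2\<close>, so \<open>rounds R\<close> doublings take
  place, more than the exponents of all rows together allow.\<close>

lemma solve_rows_complete:
  assumes lower: "\<And>u. u \<in> set R \<Longrightarrow> 1 / (4 * \<sigma>) \<le> dot n (vfun u) w"
    and w: "\<And>i. i < n \<Longrightarrow> 1 / (4 * \<sigma>) \<le> w i \<and> w i \<le> \<sigma> + 2"
  shows "solve_rows R \<noteq> []"
proof -
    have s: "1 \<le> \<sigma>" using row_bound_ge1 by simp
  \<comment> \<open>The absolute values in a row add up to at most \<open>\<sigma>\<close> and the
    entries of \<open>w\<close> are at most \<open>\<sigma> + 2\<close>, so division by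
    \<open>c\<close> brings all products to at most 1.\<close>
  define c where "c = \<sigma> * (\<sigma> + 2)"
  have c: "0 < c" using s by (simp add: c_def)
  define w' where "w' = (\<lambda>i. 1 / c * w i)"
  have wn: "0 \<le> w i" if "i < n" for i
    using w[OF that] s by (meson order_trans divide_nonneg_pos mult_pos_pos zero_le_one zero_less_numeral less_le_trans zero_less_one)
  have dotw': "dot n f w' = dot n f w / c" for f unfolding w'_def dot_lin(4) by simp
  have "4 * \<sigma> * \<sigma> * (\<sigma> + 2) \<le> 2 ^ row_bits R"
  proof -
    have "nat (4 * row_bound R * row_bound R * (row_bound R + 2)) < 2 ^ row_bits R"
      unfolding row_bits_def by (rule less_two_power_floorlog)
    then have "4 * row_bound R * row_bound R * (row_bound R + 2) < 2 ^ row_bits R"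
      by (simp add: nat_less_iff nat_less_numeral_power_cancel_iff)
    then have "real_of_int (4 * row_bound R * row_bound R * (row_bound R + 2)) < real_of_int (2 ^ row_bits R)"
      by (simp only: of_int_less_iff)
    then show ?thesis by simp
  qed
  then have "1 / 2 ^ row_bits R \<le> 1 / (4 * \<sigma> * \<sigma> * (\<sigma> + 2))"
    using s by (intro divide_left_mono mult_pos_pos) auto
  then have bits: "1 / 2 ^ row_bits R \<le> 1 / (4 * \<sigma>) / c" by (simp add: c_def mult.assoc)
  have low: "1 / 2 ^ row_bits R \<le> dot n (row0 k) w'" if "k < numrows" for k
  proof -
    have "1 / (4 * \<sigma>) \<le> dot n (row0 k) w"
    proof (rule rnth_all_rows[OF that])
      assume "rnth (all_rows R) k \<in> set R"
      from lower[OF this] show ?thesis by (simp add: rfun_def)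
    next
      fix v assume v: "v < n" "\<And>i. i < n \<Longrightarrow> row0 k i = (if i = v then \<sigma> else 0)"
      have "dot n (row0 k) w = (\<Sum>i<n. if i = v then \<sigma> * w v else 0)"
        unfolding dot_def by (intro sum.cong refl) (auto simp: v)
      then have "dot n (row0 k) w = \<sigma> * w v" using v by simp
      moreover have "1 * w v \<le> \<sigma> * w v" using s wn[OF v(1)] by (intro mult_right_mono) auto
      ultimately show ?thesis using w[OF v(1)] by linarith
    qed
    then have "1 / (4 * \<sigma>) / c \<le> dot n (row0 k) w / c" using c by (intro divide_right_mono) auto
    then show ?thesis using bits by (simp add: dotw')
  qed
  have up: "dot n (row0 k) w' \<le> 1" if "k < numrows" for k
  proof -
    have "dot n (row0 k) w \<le> (\<Sum>i<n. \<bar>row0 k i\<bar> * (\<sigma> + 2))"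
      unfolding dot_def
    proof (rule sum_mono)
      fix i assume "i \<in> {..<n}"
      then have "0 \<le> w i" "w i \<le> \<sigma> + 2" using w wn by auto
      then have "row0 k i * w i \<le> \<bar>row0 k i\<bar> * w i" by (intro mult_right_mono) auto
      also have "\<dots> \<le> \<bar>row0 k i\<bar> * (\<sigma> + 2)" using \<open>w i \<le> \<sigma> + 2\<close> by (intro mult_left_mono) auto
      finally show "row0 k i * w i \<le> \<bar>row0 k i\<bar> * (\<sigma> + 2)" .
    qed
    also have "\<dots> \<le> c"
      unfolding c_def sum_distrib_right[symmetric] using s by (intro mult_right_mono row_abs_sum that) auto
    finally show ?thesis using c by (simp add: dotw')
  qed
  have "success r \<or> progress w' r" if "r \<le> rounds R" for r
    using that
  proof (induction r)
    case 0
    have "(\<Sum>i<n. (row0 k i)\<^sup>2) / \<sigma>\<^sup>2 \<le> 1" if "k < numrows" for k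
      using row_sq_sum[OF that] s by simp
    then have "progress w' 0"
      unfolding progress_def using up
      by (intro exI[of _ "\<lambda>_. 0"]) (simp add: state_def bform_init)
    then show ?case ..
  next
    case (Suc r)
    show ?case
    proof (cases "success r")
      case True
      then have "state (Suc r) = state r"
        using rescale_success[OF True[unfolded success_def], of "mat_denom R"] by (simp add: state_Suc)
      then show ?thesis using True by (simp add: success_def)
    next
      case False
      then show ?thesis using Suc progress_Suc[OF low] by simp
    qed
  qed
  then have "success (rounds R) \<or> progress w' (rounds R)" by simp
  moreover have "\<not> progress w' (rounds R)"
  proof
    assume "progress w' (rounds R)"
    then obtain e where e: "\<And>k. k < numrows \<Longrightarrow> rfun (snd (state (rounds R))) k = (\<lambda>i. 2 ^ e k * row0 k i)"
       "(\<Sum>k<numrows. e k) = rounds R" "\<And>k. k < numrows \<Longrightarrow> dot n (rfun (snd (state (rounds R))) k) w' \<le> 1"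
      unfolding progress_def by blast
    have "e k \<le> row_bits R" if "k < numrows" for k
      using exponent_le[OF low[OF that], of "e k"] e(3)[OF that] unfolding e(1)[OF that] dot_lin .
    then have "(\<Sum>k<numrows. e k) \<le> numrows * row_bits R"
      using sum_bounded_above[of "{..<numrows}" e "row_bits R"] by simp
    moreover have "length (all_rows R) = numrows" using dims_all by (simp add: dims_def)
    ultimately show False using e(2) by (simp add: rounds_def)
  qed
  ultimately have "success (rounds R)" by blast
  then have "solve_rows R = matvec (fst (state (rounds R)))
      (row_comb (perceptron (fst (state (rounds R))) (snd (state (rounds R)))) (snd (state (rounds R))))"
    by (simp add: solve_rows_def Let_def final_state_eq success_def)
  moreover have "length (fst (state (rounds R))) = n"
    using state_inv[of "rounds R"] by (simp add: state_ok_def dims_def)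
  ultimately show ?thesis using n_pos by (metis length_matvec length_0_conv less_irrefl)
qed

text \<open>Positive factors do not change signs, so a vector that satisfies the final rows strictly
  also satisfies the original ones. Soundness thus does not depend on the accuracy of the
  matrix.\<close>

private lemma state_rows_scaled:
  "k < numrows \<Longrightarrow> \<exists>c>0. rfun (snd (state r)) k = (\<lambda>i. c * row0 k i)"
proof (induction r)
  case 0
  show ?case by (rule exI[of _ 1]) (simp add: state_def)
next
  case (Suc r)
  then obtain c where c: "c > 0" "rfun (snd (state r)) k = (\<lambda>i. c * row0 k i)" by blast
  have B: "length (snd (state r)) = numrows" "0 < numrows"
    using state_inv[of r] by (auto simp: state_ok_def dims_def)
  show ?case
  proof (rule rescale_cases[OF B, of "mat_denom R" "fst (state r)"])
    assume "rescale (mat_denom R) (fst (state r), snd (state r)) = (fst (state r), snd (state r))"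
    then show ?thesis unfolding state_Suc using c by auto
  next
    fix j assume j: "j < numrows" and eq: "rescale (mat_denom R) (fst (state r), snd (state r)) =
      (shrink (mat_denom R) (fst (state r)) (rnth (snd (state r)) j), double_row (snd (state r)) j)"
    have "rfun (snd (state (Suc r))) k = (if k = j then (\<lambda>i. (2 * c) * row0 k i) else (\<lambda>i. c * row0 k i))"
      unfolding state_Suc eq snd_conv using j c(2) by (subst rfun_double_row) (auto simp: B)
    then show ?thesis using c(1) by (intro exI[of _ "if k = j then 2 * c else c"]) auto
  qed
qed

lemma solve_rows_sound:
  assumes "solve_rows R \<noteq> []"
  shows "length (solve_rows R) = n" "\<And>u. u \<in> set R \<Longrightarrow> 0 < dot n (vfun u) (vfun (solve_rows R))"
    "\<And>i. i < n \<Longrightarrow> 0 < vnth (solve_rows R) i"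
proof -
  define Z B where "Z = fst (state (rounds R))" and "B = snd (state (rounds R))"
  have dZ: "dims n n Z" and dB: "dims numrows n B"
    using state_inv[of "rounds R"] by (auto simp: state_ok_def Z_def B_def)
  have *: "violated Z B (perceptron Z B) = []" "solve_rows R = matvec Z (row_comb (perceptron Z B) B)"
    using assms by (auto simp: solve_rows_def Let_def final_state_eq Z_def B_def split: if_splits)
  show "length (solve_rows R) = n" using *(2) dZ by (simp add: dims_def)
  have pos: "0 < dot n (row0 k) (vfun (solve_rows R))" if k: "k < numrows" for k
  proof -
    obtain c where c: "c > 0" "rfun B k = (\<lambda>i. c * row0 k i)"
      using state_rows_scaled[OF k] unfolding B_def by blast
    have "0 < vdot (rnth B k) (solve_rows R)"
      using set_violated[OF dB, of k Z "perceptron Z B"] k * by auto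
    then have "0 < real_of_int (vdot (rnth B k) (solve_rows R))" by simp
    then have "0 < c * dot n (row0 k) (vfun (solve_rows R))"
      unfolding vdot_eq[OF dims_rnth[OF dB k]] rfun_def[symmetric] c(2) dot_lin .
    then show ?thesis using c(1) by (simp add: zero_less_mult_iff)
  qed
  show "0 < dot n (vfun u) (vfun (solve_rows R))" if u: "u \<in> set R" for u
  proof -
    obtain k where "k < length R" "u = R ! k" using u by (auto simp: in_set_conv_nth)
    then show ?thesis using pos[of k]
      by (simp add: row_count_def rfun_def all_rows_def nth_default_def nth_append)
  qed
  show "0 < vnth (solve_rows R) i" if i: "i < n" for i
  proof -
    have "dot n (row0 (length R + i)) (vfun (solve_rows R))
        = (\<Sum>j<n. if j = i then row_bound R * vfun (solve_rows R) i else 0)"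
      unfolding dot_def using i
      by (intro sum.cong refl) (auto simp: all_rows_def len0 rfun_def vfun_def nth_default_append)
    then have "dot n (row0 (length R + i)) (vfun (solve_rows R))
        = row_bound R * vfun (solve_rows R) i" using i by simp
    then have "0 < row_bound R * vfun (solve_rows R) i"
      using pos[of "length R + i"] i by (simp add: row_count_def)
    then show ?thesis using row_bound_ge1 by (simp add: vfun_def zero_less_mult_iff)
  qed
qed

end

definition wf_rows :: "int list list \<Rightarrow> bool" where
  "wf_rows R \<longleftrightarrow> R \<noteq> [] \<and> (\<exists>n>0. \<forall>u\<in>set R. length u = n)"

lemma ptime_solve_rows: "ptime {R. wf_rows R} solve_rows"
proof -
  have "ptime {R. wf_rows R} final_state"
    unfolding final_state_def
  proof (rule ptime_foldl_UNIV)
    let ?n = "\<lambda>R :: int list list. length (rnth R 0)"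
    show "poly_bounded {R. wf_rows R} (\<lambda>R.
      1 + (1 + ?n R * (1 + (1 + ?n R * (1 + csize (init_diag R + int (rounds R) * int (?n R))))))
      + (1 + (length R + ?n R) * (1 + (1 + ?n R * (1 + csize (2 ^ rounds R * row_bound R))))))"
      by (intro pt poly_bounded_csize_ptime)
    fix R k assume R: "R \<in> {R. wf_rows R}" and k: "k \<le> length [0..<rounds R]"
    then obtain n where n: "R \<noteq> []" "0 < n" "\<And>u. u \<in> set R \<Longrightarrow> length u = n"
      unfolding wf_rows_def by auto
    have "?n R = n" using n by (simp add: nth_default_def)
    then show "csize (foldl (\<lambda>s a. rescale (mat_denom R) s) (init_mat R, all_rows R) (take k [0..<rounds R]))
       \<le> 1 + (1 + ?n R * (1 + (1 + ?n R * (1 + csize (init_diag R + int (rounds R) * int (?n R))))))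
      + (1 + (length R + ?n R) * (1 + (1 + ?n R * (1 + csize (2 ^ rounds R * row_bound R)))))"
      using csize_state[OF n(1,3,2), of k] k by (simp add: row_count_def)
  qed (intro pt)+
  moreover have "ptime UNIV (\<lambda>s. let y = perceptron (fst s) (snd s) in
      if violated (fst s) (snd s) y = [] then matvec (fst s) (row_comb y (snd s)) else [])"
    by (intro pt)
  ultimately show ?thesis
    using ptime_compose_UNIV unfolding solve_rows_def Let_def[of "final_state _"] by blast
qed

section \<open>Solving the LP relaxation\<close>

type_synonym lp_data = "int list \<times> int list list \<times> int list"

text \<open>Variable \<open>i * C + j\<close> is \<open>x i j\<close>, variable
  \<open>F * C + i\<close> is \<open>y i\<close>, and the last one is a homogenising variable
  \<open>t\<close>. With scaled costs, the three groups of rows demand that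
  \<open>y i - x i j\<close>, the supply of client \<open>j\<close> minus \<open>t\<close> times its
  demand, and \<open>\<theta> * t\<close> minus the cost be positive.\<close>

definition lp_rows :: "lp_data \<Rightarrow> int \<Rightarrow> int list list" where
  "lp_rows D \<theta> =
     (let F = length (fst D); C = length (snd (snd D)) in
      map (\<lambda>e. map (\<lambda>v. if v = F * C + e div C then 1 else if v = e then -1 else 0) [0..<F * C + F + 1]) [0..<F * C] @
      map (\<lambda>j. map (\<lambda>v. if v < F * C then if v mod C = j then 1 else 0
                        else if v < F * C + F then 0 else - vnth (snd (snd D)) j) [0..<F * C + F + 1]) [0..<C] @
      [map (\<lambda>v. if v < F * C then - vnth (rnth (fst (snd D)) (v div C)) (v mod C)
                 else if v < F * C + F then - vnth (fst D) (v - F * C) else \<theta>) [0..<F * C + F + 1]])"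

definition cost_sum :: "lp_data \<Rightarrow> int" where
  "cost_sum D = (\<Sum>i\<leftarrow>[0..<length (fst D)]. vnth (fst D) i) +
     (\<Sum>i\<leftarrow>[0..<length (fst D)]. \<Sum>j\<leftarrow>[0..<length (snd (snd D))]. vnth (rnth (fst (snd D)) i) j)"

text \<open>The product bounds the cost of a crude feasible solution; the summand 2 leaves room for
  the unit of slack that \<open>lp_rows_complete\<close> needs at the initial upper end.\<close>

definition search_bits :: "lp_data \<Rightarrow> nat" where
  "search_bits D = floorlog 2 (nat (cost_sum D * sum_list (snd (snd D)) + 2))"

definition bisect_step :: "lp_data \<Rightarrow> int \<times> int \<Rightarrow> int \<times> int" where
  "bisect_step D s = (let h = snd s div 2 in
     if solve_rows (lp_rows D (fst s + h)) = [] then (fst s + h, h) else (fst s, h))"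

definition bisect :: "lp_data \<Rightarrow> int \<times> int" where
  "bisect D = foldl (\<lambda>s a. bisect_step D s) (0, 2 ^ search_bits D) [0..<search_bits D]"

text \<open>At the end of the bisection the interval has width 1, so this is the system at its upper
  end, which is known to be solved.\<close>

definition lp_solution :: "lp_data \<Rightarrow> int list" where
  "lp_solution D = solve_rows (lp_rows D (fst (bisect D) + 1))"

lemma lp_rows_len:
  "u \<in> set (lp_rows D \<theta>) \<Longrightarrow> length u = length (fst D) * length (snd (snd D)) + length (fst D) + 1"
  "lp_rows D \<theta> \<noteq> []"
  by (auto simp: lp_rows_def Let_def)

lemma ptime_lp_rows [pt]: "ptime A f \<Longrightarrow> ptime A g \<Longrightarrow> ptime A (\<lambda>x. lp_rows (f x) (g x))"
  by (erule (1) ptime_compose2[rotated]) (unfold lp_rows_def Let_def, intro pt)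

lemma ptime_solve_lp_rows [pt]:
  "ptime A f \<Longrightarrow> ptime A g \<Longrightarrow> ptime A (\<lambda>x. solve_rows (lp_rows (f x) (g x)))"
  by (rule ptime_compose[OF ptime_solve_rows])
    (auto intro!: pt simp: wf_rows_def lp_rows_len simp del: add_Suc_right)

lemma ptime_cost_sum [pt]: "ptime A f \<Longrightarrow> ptime A (\<lambda>x. cost_sum (f x))"
  by (erule ptime_compose_UNIV[rotated]) (unfold cost_sum_def, intro pt)

lemma ptime_search_bits [pt]: "ptime A f \<Longrightarrow> ptime A (\<lambda>x. search_bits (f x))"
  unfolding search_bits_def by (intro pt)

lemma poly_bounded_search_bits [pt]: "ptime A f \<Longrightarrow> poly_bounded A (\<lambda>x. search_bits (f x))"
  unfolding search_bits_def by (intro pt)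

lemma ptime_bisect_step [pt]: "ptime A f \<Longrightarrow> ptime A g \<Longrightarrow> ptime A (\<lambda>x. bisect_step (f x) (g x))"
  by (erule (1) ptime_compose2[rotated]) (unfold bisect_step_def Let_def, intro pt)

lemma bisect_fold_bounds:
  "length l \<le> b \<Longrightarrow> let s = foldl (\<lambda>s a. bisect_step D s) (0, 2 ^ b) l in
     0 \<le> fst s \<and> snd s = 2 ^ (b - length l) \<and> fst s + snd s \<le> 2 ^ b"
proof (induction l rule: rev_induct)
  case (snoc a l)
  define s where "s = foldl (\<lambda>s a. bisect_step D s) (0, 2 ^ b) l"
  have s: "0 \<le> fst s" "snd s = 2 ^ (b - length l)" "fst s + snd s \<le> 2 ^ b"
    using snoc by (auto simp: s_def Let_def)
  have b: "b - length l = Suc (b - length (l @ [a]))" using snoc.prems by simp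
  define p :: int where "p = 2 ^ (b - length (l @ [a]))"
  have p: "snd s div 2 = p" "snd s = 2 * p" "0 \<le> p"
    using s(2) unfolding b p_def by simp_all
  have "0 \<le> fst (bisect_step D s) \<and> snd (bisect_step D s) = p \<and>
      fst (bisect_step D s) + snd (bisect_step D s) \<le> 2 ^ b"
    using s(1,3) p(3) unfolding bisect_step_def p(1) Let_def p(2) by auto
  then have "0 \<le> fst (bisect_step D s) \<and> snd (bisect_step D s) = 2 ^ (b - length (l @ [a])) \<and>
      fst (bisect_step D s) + snd (bisect_step D s) \<le> 2 ^ b"
    unfolding p_def .
  then show ?case by (simp add: s_def Let_def)
qed (simp add: Let_def)

lemma ptime_bisect [pt]: "ptime A f \<Longrightarrow> ptime A (\<lambda>x. bisect (f x))"
proof (erule ptime_compose_UNIV[rotated])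
  show "ptime UNIV bisect"
    unfolding bisect_def
  proof (rule ptime_foldl_UNIV)
    show "poly_bounded UNIV (\<lambda>D. 1 + csize (2 ^ search_bits D :: int) + csize (2 ^ search_bits D :: int))"
      by (intro pt poly_bounded_csize_ptime)
    fix D k assume k: "k \<le> length [0..<search_bits D]"
    define s where "s = foldl (\<lambda>s a. bisect_step D s) (0, 2 ^ search_bits D) (take k [0..<search_bits D])"
    have s: "0 \<le> fst s" "0 \<le> snd s" "fst s + snd s \<le> 2 ^ search_bits D"
      using bisect_fold_bounds[of "take k [0..<search_bits D]" "search_bits D" D] k
      by (auto simp: s_def Let_def)
    then have "csize (fst s) \<le> csize (2 ^ search_bits D :: int)" "csize (snd s) \<le> csize (2 ^ search_bits D :: int)"
      by (auto intro!: csize_int_mono)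
    then show "csize s \<le> 1 + csize (2 ^ search_bits D :: int) + csize (2 ^ search_bits D :: int)"
      using csize_pair[of "fst s" "snd s"] by simp
  qed (intro pt)+
qed

lemma ptime_lp_solution [pt]: "ptime A f \<Longrightarrow> ptime A (\<lambda>x. lp_solution (f x))"
  unfolding lp_solution_def by (intro pt)

section \<open>Correctness of the LP solver\<close>

lemma sum_block: "(\<Sum>v<F * C. g v) = (\<Sum>i<F. \<Sum>j<C. g (i * C + j))" for g :: "nat \<Rightarrow> 'a::comm_monoid_add"
proof (induction F)
  case (Suc F)
  have "(\<Sum>v<Suc F * C. g v) = (\<Sum>v<F * C. g v) + (\<Sum>v=F * C..<F * C + C. g v)"
    by (metis add.commute mult_Suc atLeast0LessThan le_add1 sum.atLeastLessThan_concat zero_le)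
  also have "(\<Sum>v=F * C..<F * C + C. g v) = (\<Sum>j<C. g (F * C + j))"
    using sum.shift_bounds_nat_ivl[of g 0 "F * C" C] by (simp add: atLeast0LessThan add.commute)
  finally show ?case using Suc by simp
qed simp

lemma sum_vars:
  "(\<Sum>v<F * C + F + 1. g v) = (\<Sum>i<F. \<Sum>j<C. g (i * C + j)) + (\<Sum>i<F. g (F * C + i)) + g (F * C + F)"
  for g :: "nat \<Rightarrow> 'a::comm_monoid_add"
proof -
  have "(\<Sum>v<F * C + F. g v) = (\<Sum>v<F * C. g v) + (\<Sum>v=F * C..<F * C + F. g v)"
    by (metis atLeast0LessThan le_add1 sum.atLeastLessThan_concat zero_le)
  also have "(\<Sum>v=F * C..<F * C + F. g v) = (\<Sum>i<F. g (F * C + i))"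
    using sum.shift_bounds_nat_ivl[of g 0 "F * C" F] by (simp add: atLeast0LessThan add.commute)
  finally show ?thesis by (simp add: sum_block)
qed

lemma block_less: "i < F \<Longrightarrow> j < C \<Longrightarrow> i * C + j < F * C" for i j :: nat
proof -
  assume "i < F" "j < C"
  then have "i * C + j < Suc i * C" by simp
  also have "\<dots> \<le> F * C" using \<open>i < F\<close> by (intro mult_right_mono) auto
  finally show ?thesis .
qed

definition scaled_data :: "real \<Rightarrow> ftfp \<Rightarrow> lp_data \<Rightarrow> bool" where
  "scaled_data S I D \<longleftrightarrow> 0 < S \<and> length (fst D) = num_sites I \<and> length (snd (snd D)) = num_clients I \<and>
     (\<forall>i<num_sites I. real_of_int (vnth (fst D) i) = S * of_rat (open_cost I i)) \<and>
     (\<forall>i<num_sites I. \<forall>j<num_clients I.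
        real_of_int (vnth (rnth (fst (snd D)) i) j) = S * of_rat (conn_cost I i j)) \<and>
     (\<forall>j<num_clients I. vnth (snd (snd D)) j = int (demand I j))"

lemma lp_cost_nonneg:
  "ftfp_instance I \<Longrightarrow> lp_feasible I y x \<Longrightarrow> 0 \<le> lp_cost I y x"
  unfolding ftfp_instance_def lp_feasible_def lp_cost_def
  by (intro add_nonneg_nonneg sum_nonneg mult_nonneg_nonneg) auto

lemma lp_opt_le:
  "ftfp_instance I \<Longrightarrow> lp_feasible I y x \<Longrightarrow> lp_opt I \<le> lp_cost I y x"
  unfolding lp_opt_def by (rule cInf_lower) (auto intro!: bdd_belowI[of _ 0] lp_cost_nonneg)

lemma lp_opt_less:
  assumes "lp_feasible I y0 x0" "lp_opt I < c"
  obtains y x where "lp_feasible I y x" "lp_cost I y x < c"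
  using cInf_lessD[of "{lp_cost I y x | y x. lp_feasible I y x}" c] assms unfolding lp_opt_def by blast

text \<open>Division by the last variable undoes the homogenisation. As a quotient of integers it
  has a floor that the program obtains by integer division.\<close>

definition frac_y :: "ftfp \<Rightarrow> int list \<Rightarrow> nat \<Rightarrow> real" where
  "frac_y I q i = real_of_int (vnth q (num_sites I * num_clients I + i)) /
     real_of_int (vnth q (num_sites I * num_clients I + num_sites I))"

definition frac_x :: "ftfp \<Rightarrow> int list \<Rightarrow> nat \<Rightarrow> nat \<Rightarrow> real" where
  "frac_x I q i j = real_of_int (vnth q (i * num_clients I + j)) /
     real_of_int (vnth q (num_sites I * num_clients I + num_sites I))"

context
  fixes S :: real and I :: ftfp and D :: lp_data
  assumes data: "scaled_data S I D" and inst: "ftfp_instance I" and sites: "0 < num_sites I"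
begin

private abbreviation "F \<equiv> num_sites I"
private abbreviation "C \<equiv> num_clients I"
private abbreviation "N \<equiv> F * C + F + 1"
private abbreviation "fc i \<equiv> real_of_int (vnth (fst D) i)"
private abbreviation "cc i j \<equiv> real_of_int (vnth (rnth (fst (snd D)) i) j)"
private abbreviation "rr j \<equiv> real_of_int (vnth (snd (snd D)) j)"

private lemma dat: "0 < S" "length (fst D) = F" "length (snd (snd D)) = C"
  "i < F \<Longrightarrow> fc i = S * of_rat (open_cost I i)"
  "i < F \<Longrightarrow> j < C \<Longrightarrow> cc i j = S * of_rat (conn_cost I i j)"
  "j < C \<Longrightarrow> vnth (snd (snd D)) j = int (demand I j)"
  using data unfolding scaled_data_def by auto

private lemma nonneg: "i < F \<Longrightarrow> 0 \<le> fc i" "i < F \<Longrightarrow> j < C \<Longrightarrow> 0 \<le> cc i j"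
  using inst dat(1) by (simp_all add: dat(4,5) ftfp_instance_def)

lemma scaled_cost:
  "S * lp_cost I y x = (\<Sum>i<F. fc i * y i) + (\<Sum>i<F. \<Sum>j<C. cc i j * x i j)"
  unfolding lp_cost_def by (simp add: dat sum_distrib_left distrib_left mult.assoc)

private definition "link_row e = map (\<lambda>v. if v = F * C + e div C then 1 else if v = e then -1 else 0) [0..<N]"
private definition "demand_row j = map (\<lambda>v. if v < F * C then if v mod C = j then 1 else 0
  else if v < F * C + F then 0 else - vnth (snd (snd D)) j) [0..<N]"
private definition "cost_row \<theta> = map (\<lambda>v. if v < F * C then - vnth (rnth (fst (snd D)) (v div C)) (v mod C)
  else if v < F * C + F then - vnth (fst D) (v - F * C) else \<theta>) [0..<N]"

private lemma set_lp_rows: "set (lp_rows D \<theta>) = link_row ` {..<F * C} \<union> demand_row ` {..<C} \<union> {cost_row \<theta>}"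
  unfolding lp_rows_def Let_def dat link_row_def demand_row_def cost_row_def by (auto simp: atLeast0LessThan)

private lemma dot_link_row:
  assumes "i < F" "j < C"
  shows "dot N (vfun (link_row (i * C + j))) w = w (F * C + i) - w (i * C + j)"
proof -
  have lt: "i * C + j < F * C" by (rule block_less[OF assms])
  have "dot N (vfun (link_row (i * C + j))) w
      = (\<Sum>v<N. (if v = F * C + i then w (F * C + i) else 0) - (if v = i * C + j then w (i * C + j) else 0))"
    unfolding dot_def
  proof (intro sum.cong refl)
    fix v assume "v \<in> {..<N}"
    moreover have "(i * C + j) div C = i" using assms by simp
    ultimately show "vfun (link_row (i * C + j)) v * w v
        = (if v = F * C + i then w (F * C + i) else 0) - (if v = i * C + j then w (i * C + j) else 0)"
      using lt by (auto simp: link_row_def vfun_def)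
  qed
  also have "\<dots> = w (F * C + i) - w (i * C + j)"
    unfolding sum_subtractf using lt assms(1) by (simp add: sum.delta)
  finally show ?thesis .
qed

private lemma dot_demand_row:
  assumes "j < C"
  shows "dot N (vfun (demand_row j)) w = (\<Sum>i<F. w (i * C + j)) - rr j * w (F * C + F)"
proof -
  have "vfun (demand_row j) (i * C + k) = (if k = j then 1 else 0)" if "i < F" "k < C" for i k
    using block_less[OF that] that by (simp add: vfun_def demand_row_def del: upt_Suc)
  then have "(\<Sum>i<F. \<Sum>k<C. vfun (demand_row j) (i * C + k) * w (i * C + k))
      = (\<Sum>i<F. \<Sum>k<C. if k = j then w (i * C + j) else 0)"
    by (intro sum.cong refl) auto
  also have "\<dots> = (\<Sum>i<F. w (i * C + j))" using assms by simp
  finally show ?thesis unfolding dot_def sum_vars by (simp add: vfun_def demand_row_def del: upt_Suc)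
qed

private lemma dot_cost_row:
  "dot N (vfun (cost_row \<theta>)) w = \<theta> * w (F * C + F) -
     ((\<Sum>i<F. fc i * w (F * C + i)) + (\<Sum>i<F. \<Sum>j<C. cc i j * w (i * C + j)))"
proof -
  have "vfun (cost_row \<theta>) (i * C + j) = - cc i j" if "i < F" "j < C" for i j
    using block_less[OF that] that by (simp add: vfun_def cost_row_def del: upt_Suc)
  then have "(\<Sum>i<F. \<Sum>j<C. vfun (cost_row \<theta>) (i * C + j) * w (i * C + j))
      = - (\<Sum>i<F. \<Sum>j<C. cc i j * w (i * C + j))"
    unfolding sum_negf[symmetric] by (intro sum.cong refl) auto
  moreover have "(\<Sum>i<F. vfun (cost_row \<theta>) (F * C + i) * w (F * C + i)) = - (\<Sum>i<F. fc i * w (F * C + i))"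
    unfolding sum_negf[symmetric] by (intro sum.cong refl) (auto simp: vfun_def cost_row_def simp del: upt_Suc)
  ultimately show ?thesis unfolding dot_def sum_vars by (simp add: vfun_def cost_row_def del: upt_Suc)
qed

private lemma N_pos: "0 < N" by simp

private lemma rows_len: "\<And>u. u \<in> set (lp_rows D \<theta>) \<Longrightarrow> length u = N"
  using lp_rows_len(1)[of _ D] by (simp add: dat)

lemma lp_rows_sound:
  assumes "solve_rows (lp_rows D \<theta>) \<noteq> []"
  defines "q \<equiv> solve_rows (lp_rows D \<theta>)"
  shows "lp_feasible I (frac_y I q) (frac_x I q)" "S * lp_cost I (frac_y I q) (frac_x I q) \<le> \<theta>"
    "0 < vnth q (F * C + F)"
proof -
  have pos: "0 < dot N (vfun u) (vfun q)" if "u \<in> set (lp_rows D \<theta>)" for u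
    unfolding q_def by (rule solve_rows_sound(2)[OF lp_rows_len(2) rows_len _ assms(1) that]) auto
  have qpos: "0 < vfun q i" if "i < N" for i
  proof -
    have "0 < vnth q i"
      unfolding q_def by (rule solve_rows_sound(3)[OF lp_rows_len(2) rows_len _ assms(1)]) (use that in auto)
    then show ?thesis by (simp add: vfun_def)
  qed
  define t where "t = vfun q (F * C + F)"
  have t: "0 < t" unfolding t_def by (rule qpos) simp
  show "0 < vnth q (F * C + F)" using t by (simp add: t_def vfun_def)
  have fy: "frac_y I q i = vfun q (F * C + i) / t" for i by (simp add: frac_y_def t_def vfun_def)
  have fx: "frac_x I q i j = vfun q (i * C + j) / t" for i j by (simp add: frac_x_def t_def vfun_def)
  show "lp_feasible I (frac_y I q) (frac_x I q)"
    unfolding lp_feasible_def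
  proof (intro conjI ballI)
    fix i assume i: "i \<in> {..<F}"
    show "0 \<le> frac_y I q i" using qpos[of "F * C + i"] i t by (simp add: fy)
    fix j assume j: "j \<in> {..<C}"
    have lt: "i * C + j < F * C" using i j by (intro block_less) auto
    show "0 \<le> frac_x I q i j" using qpos[of "i * C + j"] lt t by (simp add: fx)
    have "0 < vfun q (F * C + i) - vfun q (i * C + j)"
      using pos[of "link_row (i * C + j)"] dot_link_row[of i j] i j lt by (simp add: set_lp_rows)
    then show "frac_x I q i j \<le> frac_y I q i" using t by (simp add: fx fy divide_right_mono)
  next
    fix j assume j: "j \<in> {..<C}"
    have "0 < (\<Sum>i<F. vfun q (i * C + j)) - rr j * t"
      using pos[of "demand_row j"] dot_demand_row[of j] j by (simp add: set_lp_rows t_def)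
    then have "rr j \<le> (\<Sum>i<F. vfun q (i * C + j)) / t" using t by (simp add: pos_le_divide_eq)
    then show "real (demand I j) \<le> (\<Sum>i\<in>{..<F}. frac_x I q i j)"
      using j by (simp add: fx sum_divide_distrib dat)
  qed
  have "0 < \<theta> * t - ((\<Sum>i<F. fc i * vfun q (F * C + i)) + (\<Sum>i<F. \<Sum>j<C. cc i j * vfun q (i * C + j)))"
    using pos[of "cost_row \<theta>"] dot_cost_row[of \<theta>] by (simp add: set_lp_rows t_def)
  then have "((\<Sum>i<F. fc i * vfun q (F * C + i)) + (\<Sum>i<F. \<Sum>j<C. cc i j * vfun q (i * C + j))) / t \<le> \<theta>"
    using t by (simp add: pos_divide_le_eq)
  then show "S * lp_cost I (frac_y I q) (frac_x I q) \<le> \<theta>"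
    unfolding scaled_cost fy fx by (simp add: add_divide_distrib sum_divide_distrib)
qed

private lemma entry_le_row_bound:
  assumes "u \<in> set (lp_rows D \<theta>)"
  shows "(\<Sum>v<N. \<bar>vfun u v\<bar>) + 1 \<le> row_bound (lp_rows D \<theta>)"
proof -
  have nn: "0 \<le> (\<Sum>a\<leftarrow>u. \<bar>a :: int\<bar>)" for u by (rule sum_list_nonneg) auto
  have "(\<Sum>a\<leftarrow>u. \<bar>a\<bar>) \<in> set (map (\<lambda>u. \<Sum>a\<leftarrow>u. \<bar>a\<bar>) (lp_rows D \<theta>))" using assms by auto
  then have "(\<Sum>a\<leftarrow>u. \<bar>a\<bar>) \<le> (\<Sum>u\<leftarrow>lp_rows D \<theta>. \<Sum>a\<leftarrow>u. \<bar>a\<bar>)"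
    by (rule member_le_sum_list) (auto intro: nn)
  moreover have "(\<Sum>a\<leftarrow>u. \<bar>a\<bar>) = (\<Sum>i<N. \<bar>vnth u i\<bar>)"
    using rows_len[OF assms] by (simp add: sum_list_sum_nth atLeast0LessThan nth_default_def)
  ultimately have "(\<Sum>i<N. \<bar>vnth u i\<bar>) + 1 \<le> row_bound (lp_rows D \<theta>)" by (simp add: row_bound_def)
  then have "real_of_int ((\<Sum>i<N. \<bar>vnth u i\<bar>) + 1) \<le> real_of_int (row_bound (lp_rows D \<theta>))"
    by (simp only: of_int_le_iff)
  then show ?thesis by (simp add: vfun_def)
qed

text \<open>The given solution is cut off at \<open>\<sigma>\<close> and pushed into the interior,
  \<open>x\<close> by \<open>\<delta>\<close> and \<open>y\<close> by twice as much. Then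
  \<open>y - x\<close> and the supply of each client have slack at least \<open>\<delta>\<close>,
  and the unit of slack in the cost pays for the shift.\<close>

lemma lp_rows_complete:
  assumes feas: "lp_feasible I y x" and cost: "S * lp_cost I y x < real_of_int \<theta> - 1"
  shows "solve_rows (lp_rows D \<theta>) \<noteq> []"
proof -
  define \<sigma> where "\<sigma> = real_of_int (row_bound (lp_rows D \<theta>))"
  have bound: "(\<Sum>v<N. \<bar>vfun u v\<bar>) + 1 \<le> \<sigma>" if "u \<in> set (lp_rows D \<theta>)" for u
    using entry_le_row_bound[OF that] by (simp add: \<sigma>_def)
  have \<sigma>: "1 \<le> \<sigma>"
  proof -
    have "(\<Sum>v<N. \<bar>vfun (cost_row \<theta>) v\<bar>) + 1 \<le> \<sigma>" by (rule bound) (simp add: set_lp_rows)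
    then show ?thesis using sum_nonneg[of "{..<N}" "\<lambda>v. \<bar>vfun (cost_row \<theta>) v\<bar>"] by linarith
  qed
  have rle: "rr j \<le> \<sigma>" if "j < C" for j
  proof -
    have "\<bar>vfun (demand_row j) (F * C + F)\<bar> \<le> (\<Sum>v<N. \<bar>vfun (demand_row j) v\<bar>)"
      by (rule member_le_sum) auto
    moreover have "rr j \<le> \<bar>vfun (demand_row j) (F * C + F)\<bar>" by (simp add: vfun_def demand_row_def del: upt_Suc)
    moreover have "(\<Sum>v<N. \<bar>vfun (demand_row j) v\<bar>) + 1 \<le> \<sigma>"
      by (rule bound) (use that in \<open>simp add: set_lp_rows\<close>)
    ultimately show ?thesis by linarith
  qed
  have csum: "(\<Sum>i<F. fc i) + (\<Sum>i<F. \<Sum>j<C. cc i j) \<le> \<sigma>"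
  proof -
    have "(\<Sum>i<F. \<Sum>j<C. cc i j) \<le> (\<Sum>i<F. \<Sum>j<C. \<bar>vfun (cost_row \<theta>) (i * C + j)\<bar>)"
    proof (intro sum_mono)
      fix i j assume "i \<in> {..<F}" "j \<in> {..<C}"
      then show "cc i j \<le> \<bar>vfun (cost_row \<theta>) (i * C + j)\<bar>"
        using block_less[of i F j C] by (simp add: vfun_def cost_row_def del: upt_Suc)
    qed
    moreover have "(\<Sum>i<F. fc i) \<le> (\<Sum>i<F. \<bar>vfun (cost_row \<theta>) (F * C + i)\<bar>)"
      by (intro sum_mono) (auto simp: vfun_def cost_row_def simp del: upt_Suc)
    ultimately show ?thesis
      using bound[of "cost_row \<theta>"] unfolding sum_vars by (simp add: set_lp_rows)
  qed
  \<comment> \<open>All cost coefficients together are at most \<open>\<sigma>\<close>, so shifting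
    by at most \<open>2 * \<delta>\<close> costs at most \<open>1 / 2\<close>; what is left of the
    unit is still at least \<open>\<delta>\<close>.\<close>
  define \<delta> where "\<delta> = 1 / (4 * \<sigma>)"
  have \<delta>: "0 < \<delta>" "\<delta> \<le> 1 / 4" "\<delta> * \<sigma> = 1 / 4" using \<sigma> by (simp_all add: \<delta>_def field_simps)
  have feas': "\<And>i. i < F \<Longrightarrow> 0 \<le> y i" "\<And>i j. i < F \<Longrightarrow> j < C \<Longrightarrow> 0 \<le> x i j \<and> x i j \<le> y i"
    "\<And>j. j < C \<Longrightarrow> rr j \<le> (\<Sum>i<F. x i j)"
    using feas by (auto simp: lp_feasible_def dat)
  define y' where "y' i = min (y i) \<sigma> + 2 * \<delta>" for i
  define x' where "x' i j = min (x i j) \<sigma> + \<delta>" for i j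
  define w where "w v = (if v < F * C then x' (v div C) (v mod C)
    else if v < F * C + F then y' (v - F * C) else 1)" for v
  have wx: "w (i * C + j) = x' i j" if "i < F" "j < C" for i j
    using block_less[OF that] that by (simp add: w_def)
  have wy: "w (F * C + i) = y' i" if "i < F" for i using that by (simp add: w_def)
  have wt: "w (F * C + F) = 1" by (simp add: w_def)
  have y'_bounds: "\<delta> \<le> y' i \<and> y' i \<le> \<sigma> + 2" if "i < F" for i
    using feas'(1)[OF that] \<sigma> \<delta> by (auto simp: y'_def min_def)
  have x'_bounds: "\<delta> \<le> x' i j \<and> x' i j \<le> \<sigma> + 2" if "i < F" "j < C" for i j
    using feas'(2)[OF that] \<sigma> \<delta> by (auto simp: x'_def min_def)
  show ?thesis
  proof (rule solve_rows_complete[OF lp_rows_len(2) rows_len N_pos, where w = w])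
    show "1 / (4 * real_of_int (row_bound (lp_rows D \<theta>))) \<le> w v \<and> w v \<le> real_of_int (row_bound (lp_rows D \<theta>)) + 2"
      if "v < N" for v
    proof -
      consider "v < F * C" | "F * C \<le> v" "v < F * C + F" | "v = F * C + F"
        using \<open>v < N\<close> by linarith
      then have "\<delta> \<le> w v \<and> w v \<le> \<sigma> + 2"
      proof cases
        case 1
        then have "v div C < F" "v mod C < C"
          by (metis less_mult_imp_div_less, metis mod_less_divisor mult_0_right not_gr_zero not_less_zero)
        then show ?thesis using 1 x'_bounds by (simp add: w_def)
      next
        case 2
        then show ?thesis using y'_bounds[of "v - F * C"] by (simp add: w_def)
      next
        case 3
        then show ?thesis using \<delta> \<sigma> by (simp add: wt)
      qed
      then show ?thesis by (simp add: \<delta>_def \<sigma>_def)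
    qed
    fix u assume "u \<in> set (lp_rows D \<theta>)"
    then consider e where "e < F * C" "u = link_row e" | j where "j < C" "u = demand_row j" | "u = cost_row \<theta>"
      unfolding set_lp_rows by auto
    then have "\<delta> \<le> dot N (vfun u) w"
    proof cases
      case 1
      define i j where "i = e div C" and "j = e mod C"
      have ij: "i < F" "j < C" "e = i * C + j"
        using 1(1) unfolding i_def j_def
        by (metis less_mult_imp_div_less, metis mod_less_divisor mult_0_right not_gr_zero not_less_zero, simp)
      have "min (x i j) \<sigma> \<le> min (y i) \<sigma>" using feas'(2)[OF ij(1,2)] by auto
      then show ?thesis
        unfolding 1(2) ij(3) dot_link_row[OF ij(1,2)] wx[OF ij(1,2)] wy[OF ij(1)] by (simp add: x'_def y'_def)
    next
      case 2
      \<comment> \<open>Demands are at most \<open>\<sigma>\<close>, so a single connection that has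
        been cut off at \<open>\<sigma>\<close> still serves its client completely.\<close>
      have "rr j \<le> (\<Sum>i<F. min (x i j) \<sigma>)"
      proof (cases "\<exists>i<F. \<sigma> < x i j")
        case True
        then obtain i where i: "i < F" "\<sigma> < x i j" by blast
        have "min (x i j) \<sigma> \<le> (\<Sum>i<F. min (x i j) \<sigma>)"
          by (rule member_le_sum) (use i feas'(2) 2 \<sigma> in auto)
        then show ?thesis using i rle[OF 2(1)] by simp
      next
        case False
        then have "(\<Sum>i<F. min (x i j) \<sigma>) = (\<Sum>i<F. x i j)" by (intro sum.cong refl) auto
        then show ?thesis using feas'(3)[OF 2(1)] by simp
      qed
      moreover have "(\<Sum>i<F. w (i * C + j)) = (\<Sum>i<F. min (x i j) \<sigma>) + F * \<delta>"
        using 2(1) by (simp add: wx x'_def sum.distrib)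
      moreover have "1 * \<delta> \<le> F * \<delta>" using sites \<delta> by (intro mult_right_mono) auto
      ultimately show ?thesis unfolding 2(2) dot_demand_row[OF 2(1)] wt by simp
    next
      case 3
      have "(\<Sum>i<F. fc i * w (F * C + i)) \<le> (\<Sum>i<F. fc i * y i + 2 * \<delta> * fc i)"
      proof (rule sum_mono)
        fix i assume "i \<in> {..<F}"
        then have "fc i * w (F * C + i) \<le> fc i * (y i + 2 * \<delta>)"
          using nonneg by (intro mult_left_mono) (auto simp: wy y'_def)
        then show "fc i * w (F * C + i) \<le> fc i * y i + 2 * \<delta> * fc i" by (simp add: algebra_simps)
      qed
      moreover have "(\<Sum>i<F. \<Sum>j<C. cc i j * w (i * C + j)) \<le> (\<Sum>i<F. \<Sum>j<C. cc i j * x i j + 2 * \<delta> * cc i j)"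
      proof (intro sum_mono)
        fix i j assume ij: "i \<in> {..<F}" "j \<in> {..<C}"
        then have "cc i j * w (i * C + j) \<le> cc i j * (x i j + 2 * \<delta>)"
          using nonneg \<delta> by (intro mult_left_mono) (auto simp: wx x'_def min_def)
        then show "cc i j * w (i * C + j) \<le> cc i j * x i j + 2 * \<delta> * cc i j" by (simp add: algebra_simps)
      qed
      ultimately have "(\<Sum>i<F. fc i * w (F * C + i)) + (\<Sum>i<F. \<Sum>j<C. cc i j * w (i * C + j))
          \<le> S * lp_cost I y x + 2 * \<delta> * ((\<Sum>i<F. fc i) + (\<Sum>i<F. \<Sum>j<C. cc i j))"
        unfolding scaled_cost by (simp add: sum.distrib sum_distrib_left distrib_left)
      also have "\<dots> \<le> S * lp_cost I y x + 2 * \<delta> * \<sigma>"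
        using csum \<delta> by (intro add_left_mono mult_left_mono) auto
      finally show ?thesis using cost \<delta> unfolding 3 dot_cost_row wt by simp
    qed
    then show "1 / (4 * real_of_int (row_bound (lp_rows D \<theta>))) \<le> dot N (vfun u) w"
      by (simp add: \<delta>_def \<sigma>_def)
  qed
qed

text \<open>Every site serves the full demand of every client. This is wasteful, but the cost has
  polynomial bit length, and only that matters for the number of bisection steps.\<close>

private lemma trivial_feasible:
  obtains y x where "lp_feasible I y x" "S * lp_cost I y x \<le> real_of_int (cost_sum D * sum_list (snd (snd D)))"
proof -
  define r where "r = real (\<Sum>j<C. demand I j)"
  have r: "real (demand I j) \<le> r" if "j < C" for j
    unfolding r_def of_nat_le_iff using that by (intro member_le_sum) auto
  have r0: "0 \<le> r" by (simp add: r_def sum_nonneg)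
  have "lp_feasible I (\<lambda>i. r) (\<lambda>i j. real (demand I j))"
    unfolding lp_feasible_def
  proof (intro conjI ballI)
    fix j assume "j \<in> {..<C}"
    have "1 * real (demand I j) \<le> F * real (demand I j)" using sites by (intro mult_right_mono) auto
    then show "real (demand I j) \<le> (\<Sum>i\<in>{..<F}. real (demand I j))" by simp
  qed (use r r0 in auto)
  moreover have "S * lp_cost I (\<lambda>i. r) (\<lambda>i j. real (demand I j)) \<le> real_of_int (cost_sum D * sum_list (snd (snd D)))"
  proof -
    have "S * lp_cost I (\<lambda>i. r) (\<lambda>i j. real (demand I j)) \<le> (\<Sum>i<F. fc i * r) + (\<Sum>i<F. \<Sum>j<C. cc i j * r)"
      unfolding scaled_cost using r nonneg by (intro add_left_mono sum_mono mult_left_mono) auto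
    also have "\<dots> = real_of_int (cost_sum D) * r"
      by (simp add: cost_sum_def dat sum_distrib_right distrib_right)
    also have "\<dots> = real_of_int (cost_sum D * sum_list (snd (snd D)))"
    proof -
      have "sum_list (snd (snd D)) = (\<Sum>j<C. vnth (snd (snd D)) j)"
        by (simp add: sum_list_sum_nth dat atLeast0LessThan nth_default_def)
      then show ?thesis by (simp add: r_def dat)
    qed
    finally show ?thesis .
  qed
  ultimately show ?thesis using that by blast
qed

private lemma complete_opt: "S * lp_opt I < real_of_int \<theta> - 1 \<Longrightarrow> solve_rows (lp_rows D \<theta>) \<noteq> []"
proof -
  assume "S * lp_opt I < real_of_int \<theta> - 1"
  then have "lp_opt I < (real_of_int \<theta> - 1) / S" using dat(1) by (simp add: pos_less_divide_eq mult.commute)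
  then obtain y x where "lp_feasible I y x" "lp_cost I y x < (real_of_int \<theta> - 1) / S"
    using lp_opt_less trivial_feasible by metis
  then show ?thesis using dat(1) by (intro lp_rows_complete) (auto simp: pos_less_divide_eq mult.commute)
qed

text \<open>Bisection keeps the system solvable at the upper end, while the lower end minus 1 does
  not exceed the scaled optimum: failure at a value only excludes solutions that are cheaper by more
  than 1. Together with the final width 1 this gives the error 2.\<close>

lemma lp_solution_correct:
  shows "lp_feasible I (frac_y I (lp_solution D)) (frac_x I (lp_solution D))"
    "S * lp_cost I (frac_y I (lp_solution D)) (frac_x I (lp_solution D)) \<le> S * lp_opt I + 2"
    "0 < vnth (lp_solution D) (num_sites I * num_clients I + num_sites I)"
proof -
  let ?b = "search_bits D"
  have "solve_rows (lp_rows D (fst s + snd s)) \<noteq> [] \<and> real_of_int (fst s) - 1 \<le> S * lp_opt I"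
    if "length l \<le> ?b" "s = foldl (\<lambda>s a. bisect_step D s) (0, 2 ^ ?b) l" for l s
    using that
  proof (induction l arbitrary: s rule: rev_induct)
    case Nil
    obtain y x where yx: "lp_feasible I y x" "S * lp_cost I y x \<le> real_of_int (cost_sum D * sum_list (snd (snd D)))"
      by (rule trivial_feasible)
    have "cost_sum D * sum_list (snd (snd D)) + 2 \<le> int (nat (cost_sum D * sum_list (snd (snd D)) + 2))" by simp
    also have "\<dots> < int (2 ^ ?b)"
      unfolding search_bits_def using less_two_power_floorlog of_nat_less_iff by blast
    finally have "cost_sum D * sum_list (snd (snd D)) + 2 < 2 ^ ?b" by simp
    then have "real_of_int (cost_sum D * sum_list (snd (snd D)) + 2) < real_of_int (2 ^ ?b)"
      by (simp only: of_int_less_iff)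
    then have "S * lp_cost I y x < real_of_int (2 ^ ?b) - 1" using yx(2) by simp
    then have "solve_rows (lp_rows D (2 ^ ?b)) \<noteq> []"
      by (rule lp_rows_complete[OF yx(1)])
    moreover have "0 \<le> lp_opt I"
      unfolding lp_opt_def by (rule cInf_greatest) (use yx(1) lp_cost_nonneg[OF inst] in auto)
    then have "- 1 \<le> S * lp_opt I" using dat(1) by (smt (verit) mult_nonneg_nonneg)
    ultimately show ?case using Nil by simp
  next
    case (snoc a l)
    define s' where "s' = foldl (\<lambda>s a. bisect_step D s) (0, 2 ^ ?b) l"
    have IH: "solve_rows (lp_rows D (fst s' + snd s')) \<noteq> []" "real_of_int (fst s') - 1 \<le> S * lp_opt I"
      using snoc.IH[of s'] snoc.prems by (auto simp: s'_def)
    have "snd s' = 2 ^ (?b - length l)"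
      using bisect_fold_bounds[of l ?b D] snoc.prems(1) by (simp add: s'_def Let_def)
    moreover have "?b - length l = Suc (?b - length (l @ [a]))" using snoc.prems(1) by simp
    ultimately have even: "snd s' = 2 * (snd s' div 2)" by simp
    have s: "s = bisect_step D s'" using snoc.prems(2) by (simp add: s'_def)
    show ?case
    proof (cases "solve_rows (lp_rows D (fst s' + snd s' div 2)) = []")
      case True
      then have "real_of_int (fst s' + snd s' div 2) - 1 \<le> S * lp_opt I"
        using complete_opt[of "fst s' + snd s' div 2"] by linarith
      moreover have s_eq: "fst s = fst s' + snd s' div 2" "snd s = snd s' div 2"
        using True by (simp_all add: s bisect_step_def Let_def)
      moreover have "fst s + snd s = fst s' + snd s'" using even unfolding s_eq by linarith
      ultimately show ?thesis using IH(1) by metis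
    next
      case False
      then show ?thesis using IH(2) by (simp add: s bisect_step_def Let_def)
    qed
  qed
  from this[of "[0..<?b]" "bisect D"]
  have *: "solve_rows (lp_rows D (fst (bisect D) + snd (bisect D))) \<noteq> []" "real_of_int (fst (bisect D)) - 1 \<le> S * lp_opt I"
    by (simp_all add: bisect_def)
  have "snd (bisect D) = 1"
    using bisect_fold_bounds[of "[0..<?b]" ?b D] by (simp add: bisect_def Let_def)
  with *(1) have ne: "solve_rows (lp_rows D (fst (bisect D) + 1)) \<noteq> []" by simp
  note sound = lp_rows_sound[OF ne, folded lp_solution_def]
  show "lp_feasible I (frac_y I (lp_solution D)) (frac_x I (lp_solution D))" by (rule sound)
  show "S * lp_cost I (frac_y I (lp_solution D)) (frac_x I (lp_solution D)) \<le> S * lp_opt I + 2"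
    using sound(2) *(2) by simp
  show "0 < vnth (lp_solution D) (F * C + F)" by (rule sound)
qed

end

section \<open>Rounding and the residual instance\<close>

text \<open>The entries are taken in order until the budget \<open>b\<close> is used up; the sum
  over the earlier indices tells how much of it has been requested before.\<close>

lemma truncated_sum:
  fixes a :: "nat \<Rightarrow> int"
  assumes "\<And>i. i < n \<Longrightarrow> 0 \<le> a i" "0 \<le> b"
  shows "(\<Sum>i<n. max 0 (min (a i) (b - (\<Sum>k<i. a k)))) = min (\<Sum>i<n. a i) b"
  using assms(1)
proof (induction n)
  case (Suc n)
  define s where "s = (\<Sum>i<n. a i)"
  have "0 \<le> a n" using Suc.prems by simp
  then have "min s b + max 0 (min (a n) (b - s)) = min (s + a n) b"
    by (auto simp: min_def max_def)
  moreover have "(\<Sum>i<n. max 0 (min (a i) (b - (\<Sum>k<i. a k)))) = min s b"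
    unfolding s_def using Suc by simp
  ultimately show ?case by (simp add: s_def)
qed (use assms(2) in simp)

text \<open>The minus 1 in \<open>u\<close> ensures that a site with \<open>u i \<ge> 1\<close>
  keeps at least one unit of \<open>y i\<close>, enough for any fractional part of
  \<open>x i\<close>. The budget \<open>r - 1\<close> in \<open>z\<close> leaves a positive demand.
  If it does not bind, \<open>x - z\<close> serves the rest and each difference is at most 2; if it
  binds, exactly one unit of demand is left.\<close>

lemma residual_column:
  fixes x y :: "nat \<Rightarrow> real" and r :: int
  assumes xy: "\<And>i. i < n \<Longrightarrow> 0 \<le> x i \<and> x i \<le> y i" and n: "0 < n" and r: "0 < r"
    and sum: "real_of_int r \<le> (\<Sum>i<n. x i)"
  defines "u \<equiv> \<lambda>i. max 0 (\<lfloor>y i\<rfloor> - 1)"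
  defines "a \<equiv> \<lambda>i. min \<lfloor>x i\<rfloor> (u i)"
  defines "z \<equiv> \<lambda>i. max 0 (min (a i) (r - 1 - (\<Sum>k<i. a k)))"
  shows "\<And>i. i < n \<Longrightarrow> 0 \<le> z i \<and> z i \<le> u i \<and> z i \<le> x i" "\<And>i. i < n \<Longrightarrow> u i \<le> y i"
    "1 \<le> r - (\<Sum>i<n. z i)" "r - (\<Sum>i<n. z i) \<le> 2 * int n"
    "real_of_int (r - (\<Sum>i<n. z i)) \<le> (\<Sum>i<n. min (x i - z i) (y i - u i))"
proof -
  have a: "0 \<le> a i" if "i < n" for i using xy[OF that] by (simp add: a_def u_def)
  have za: "0 \<le> z i \<and> z i \<le> a i" if "i < n" for i using a[OF that] by (simp add: z_def)
  show z: "0 \<le> z i \<and> z i \<le> u i \<and> z i \<le> x i" if "i < n" for i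
  proof -
    have "z i \<le> \<lfloor>x i\<rfloor>" "z i \<le> u i" using za[OF that] by (simp_all add: a_def)
    then show ?thesis using za[OF that] by linarith
  qed
  show uy: "u i \<le> y i" if "i < n" for i using xy[OF that] by (simp add: u_def max_def) linarith
  have u1: "1 \<le> y i - u i" if "i < n" "1 \<le> u i" for i
    using that(2) by (auto simp: u_def max_def split: if_splits)
  have sumz: "(\<Sum>i<n. z i) = min (\<Sum>i<n. a i) (r - 1)"
    unfolding z_def by (rule truncated_sum) (use a r in auto)
  show "1 \<le> r - (\<Sum>i<n. z i)" unfolding sumz by simp
  have nn: "0 \<le> min (x i - z i) (y i - u i)" if "i < n" for i using z[OF that] uy[OF that] by simp
  show "r - (\<Sum>i<n. z i) \<le> 2 * int n"
    "real_of_int (r - (\<Sum>i<n. z i)) \<le> (\<Sum>i<n. min (x i - z i) (y i - u i))"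
  proof (atomize(full), cases "(\<Sum>i<n. a i) \<le> r - 1")
    case True
    then have eq: "(\<Sum>i<n. z i) = (\<Sum>i<n. a i)" by (simp add: sumz)
    have z_eq: "z i = a i" if "i < n" for i
    proof (rule ccontr)
      assume "z i \<noteq> a i"
      then have "(\<Sum>i<n. z i) < (\<Sum>i<n. a i)"
        using za that by (intro sum_strict_mono_ex1) (auto intro!: bexI[of _ i] simp: order.strict_iff_order)
      then show False using eq by simp
    qed
    \<comment> \<open>If \<open>z i = u i\<close>, this is \<open>x i \<le> y i\<close>. Otherwise
      \<open>z i\<close> is the floor of \<open>x i\<close>, so less than 1 is left of
      \<open>x i\<close>, but at least 1 of \<open>y i\<close>.\<close>
    have le: "x i - z i \<le> y i - u i" if "i < n" for i
    proof (cases "a i = u i")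
      case True
      then show ?thesis using xy[OF that] z_eq[OF that] by simp
    next
      case False
      then have ai: "a i = \<lfloor>x i\<rfloor>" "a i < u i" by (auto simp: a_def min_def split: if_splits)
      then have "1 \<le> u i" using a[OF that] by linarith
      then show ?thesis using u1[OF that] z_eq[OF that] ai(1) by linarith
    qed
    have "(\<Sum>i<n. min (x i - z i) (y i - u i)) = (\<Sum>i<n. x i - z i)"
      by (intro sum.cong refl) (use le in \<open>auto simp: min_def\<close>)
    then have "real_of_int (r - (\<Sum>i<n. z i)) \<le> (\<Sum>i<n. min (x i - z i) (y i - u i))"
      using sum by (simp add: sum_subtractf)
    moreover have "(\<Sum>i<n. x i - z i) \<le> (\<Sum>i<n. 2)"
    proof (rule sum_mono)
      fix i assume "i \<in> {..<n}"
      then have i: "i < n" by simp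
      have "\<lfloor>y i\<rfloor> - 1 \<le> u i" by (simp add: u_def)
      then show "x i - z i \<le> 2" unfolding z_eq[OF i] a_def using xy[OF i] by (simp add: min_def) linarith
    qed
    then have "real_of_int (r - (\<Sum>i<n. z i)) \<le> real_of_int (2 * int n)"
      using sum by (simp add: sum_subtractf)
    then have "r - (\<Sum>i<n. z i) \<le> 2 * int n" by (simp only: of_int_le_iff)
    ultimately show "r - (\<Sum>i<n. z i) \<le> 2 * int n \<and>
        real_of_int (r - (\<Sum>i<n. z i)) \<le> (\<Sum>i<n. min (x i - z i) (y i - u i))" by blast
  next
    case False
    then have eq: "r - (\<Sum>i<n. z i) = 1" by (simp add: sumz)
    have "(\<Sum>i<n. z i) < (\<Sum>i<n. a i)" using False eq by linarith
    \<comment> \<open>A site at which the budget cut something off can serve the last unit alone: it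
      has at least one unit left of both \<open>x i\<close> and \<open>y i\<close>.\<close>
    then obtain i where i: "i < n" "z i < a i"
      using sum_mono[of "{..<n}" a z] by (meson lessThan_iff not_less)
    then have "1 \<le> u i" "real_of_int (z i) + 1 \<le> x i"
      using za[OF i(1)] unfolding a_def by linarith+
    then have "1 \<le> min (x i - z i) (y i - u i)" using u1[OF i(1)] by simp
    also have "\<dots> \<le> (\<Sum>i<n. min (x i - z i) (y i - u i))"
      by (rule member_le_sum) (use i nn in auto)
    finally show "r - (\<Sum>i<n. z i) \<le> 2 * int n \<and>
        real_of_int (r - (\<Sum>i<n. z i)) \<le> (\<Sum>i<n. min (x i - z i) (y i - u i))"
      unfolding eq using n by simp
  qed
qed

section \<open>The integral part and the residual instance\<close>

definition round_y :: "(nat \<Rightarrow> real) \<Rightarrow> nat \<Rightarrow> int" where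
  "round_y y i = max 0 (\<lfloor>y i\<rfloor> - 1)"

definition floor_x :: "(nat \<Rightarrow> real) \<Rightarrow> (nat \<Rightarrow> nat \<Rightarrow> real) \<Rightarrow> nat \<Rightarrow> nat \<Rightarrow> int" where
  "floor_x y x i j = min \<lfloor>x i j\<rfloor> (round_y y i)"

definition round_x :: "ftfp \<Rightarrow> (nat \<Rightarrow> real) \<Rightarrow> (nat \<Rightarrow> nat \<Rightarrow> real) \<Rightarrow> nat \<Rightarrow> nat \<Rightarrow> int" where
  "round_x I y x i j = max 0 (min (floor_x y x i j) (int (demand I j) - 1 - (\<Sum>k<i. floor_x y x k j)))"

text \<open>
  Every site occurs twice, because the rounding leaves residual demands of up to twice the number
  of sites.
\<close>

definition residual :: "ftfp \<Rightarrow> (nat \<Rightarrow> real) \<Rightarrow> (nat \<Rightarrow> nat \<Rightarrow> real) \<Rightarrow> ftfp" where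
  "residual I y x = I\<lparr>num_sites := 2 * num_sites I, open_cost := \<lambda>i. open_cost I (i div 2),
     conn_cost := \<lambda>i. conn_cost I (i div 2),
     demand := \<lambda>j. nat (int (demand I j) - (\<Sum>i<num_sites I. round_x I y x i j))\<rparr>"

lemma sum_twice: "(\<Sum>i<2 * n. g i) = (\<Sum>i<n. g (2 * i) + g (Suc (2 * i)))" for g :: "nat \<Rightarrow> 'a::comm_monoid_add"
  by (induction n) (simp_all add: add.assoc)

lemma lp_cost_residual:
  "lp_cost (residual I y x) v w = lp_cost I (\<lambda>i. v (2 * i) + v (Suc (2 * i))) (\<lambda>i j. w (2 * i) j + w (Suc (2 * i)) j)"
  unfolding lp_cost_def residual_def by (simp add: sum_twice distrib_left sum.distrib)

lemma lp_cost_add: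
  "lp_cost I (\<lambda>i. v i + v' i) (\<lambda>i j. w i j + w' i j) = lp_cost I v w + lp_cost I v' w'"
  by (simp add: lp_cost_def distrib_left sum.distrib)

lemma lp_cost_mono:
  assumes "ftfp_instance I" "\<And>i. i < num_sites I \<Longrightarrow> v i \<le> v' i"
    "\<And>i j. i < num_sites I \<Longrightarrow> j < num_clients I \<Longrightarrow> w i j \<le> w' i j"
  shows "lp_cost I v w \<le> lp_cost I v' w'"
  using assms unfolding lp_cost_def ftfp_instance_def
  by (intro add_mono sum_mono mult_left_mono) auto

text \<open>The metric is pulled back along the map that merges the two copies of a site. The copies
  get distance 0, which \<open>metric_costs\<close> permits.\<close>

lemma metric_costs_twice:
  assumes "metric_costs I"
  shows "metric_costs (residual I y x)"
proof -
  let ?P = "sites I <+> clients I" and ?P' = "sites (residual I y x) <+> clients (residual I y x)"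
  obtain D :: "nat + nat \<Rightarrow> nat + nat \<Rightarrow> real" where D:
    "\<forall>a\<in>?P. D a a = 0" "\<forall>a\<in>?P. \<forall>b\<in>?P. 0 \<le> D a b \<and> D a b = D b a"
    "\<forall>a\<in>?P. \<forall>b\<in>?P. \<forall>c\<in>?P. D a c \<le> D a b + D b c"
    "\<forall>i\<in>sites I. \<forall>j\<in>clients I. D (Inl i) (Inr j) = of_rat (conn_cost I i j)"
    using assms unfolding metric_costs_def by blast
  define h :: "nat + nat \<Rightarrow> nat + nat" where "h = map_sum (\<lambda>i. i div 2) (\<lambda>j. j)"
  have h: "h a \<in> ?P" if "a \<in> ?P'" for a
    using that by (auto simp: residual_def h_def)
  show ?thesis
    unfolding metric_costs_def
  proof (intro exI[of _ "\<lambda>a b. D (h a) (h b)"] conjI ballI)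
    fix i j assume "i \<in> sites (residual I y x)" "j \<in> clients (residual I y x)"
    then have "i div 2 \<in> sites I" "j \<in> clients I" by (auto simp: residual_def)
    then show "D (h (Inl i)) (h (Inr j)) = of_rat (conn_cost (residual I y x) i j)"
      using D(4) by (simp add: h_def residual_def)
  qed (use D(1-3) h in blast)+
qed

context
  fixes I :: ftfp and y :: "nat \<Rightarrow> real" and x :: "nat \<Rightarrow> nat \<Rightarrow> real"
  assumes inst: "ftfp_instance I" and sites: "0 < num_sites I" and feas: "lp_feasible I y x"
begin

private abbreviation "J \<equiv> residual I y x"
private abbreviation "taken j \<equiv> (\<Sum>i<num_sites I. round_x I y x i j)"
private abbreviation "base_cost \<equiv> lp_cost I (\<lambda>i. round_y y i) (\<lambda>i j. round_x I y x i j)"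

private lemma col:
  assumes "j < num_clients I"
  shows "\<And>i. i < num_sites I \<Longrightarrow> 0 \<le> round_x I y x i j \<and> round_x I y x i j \<le> round_y y i \<and> round_x I y x i j \<le> x i j"
    "1 \<le> int (demand I j) - taken j"
    "int (demand I j) - taken j \<le> 2 * int (num_sites I)"
    "real_of_int (int (demand I j) - taken j)
       \<le> (\<Sum>i<num_sites I. min (x i j - round_x I y x i j) (y i - round_y y i))"
proof -
  have "0 < int (demand I j)" using inst assms by (simp add: ftfp_instance_def)
  note * = residual_column[of "num_sites I" "\<lambda>i. x i j" y "int (demand I j)",
      folded round_y_def floor_x_def, folded round_x_def, OF _ sites this]
  show "0 \<le> round_x I y x i j \<and> round_x I y x i j \<le> round_y y i \<and> round_x I y x i j \<le> x i j"
    if "i < num_sites I" for i by (rule *(1)) (use feas assms that in \<open>auto simp: lp_feasible_def\<close>)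
  show "1 \<le> int (demand I j) - taken j"
    by (rule *(3)) (use feas assms in \<open>auto simp: lp_feasible_def\<close>)
  show "int (demand I j) - taken j \<le> 2 * int (num_sites I)"
    by (rule *(4)) (use feas assms in \<open>auto simp: lp_feasible_def\<close>)
  show "real_of_int (int (demand I j) - taken j)
       \<le> (\<Sum>i<num_sites I. min (x i j - round_x I y x i j) (y i - round_y y i))"
    by (rule *(5)) (use feas assms in \<open>auto simp: lp_feasible_def\<close>)
qed

private lemma round_y: "i < num_sites I \<Longrightarrow> 0 \<le> round_y y i \<and> round_y y i \<le> y i"
proof -
  assume "i < num_sites I"
  then have "0 \<le> y i" using feas by (simp add: lp_feasible_def)
  then show ?thesis unfolding round_y_def by (simp add: max_def) linarith
qed

lemma small_demand_residual: "small_demand_instance J"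
proof -
  have "ftfp_instance J"
  proof -
    have "0 < demand J j" if "j < num_clients I" for j
      using col(2)[OF that] by (simp add: residual_def)
    then show ?thesis
      using inst metric_costs_twice[of I y x] unfolding ftfp_instance_def by (auto simp: residual_def)
  qed
  moreover have "demand J j \<le> 2 * num_sites I" if "j < num_clients I" for j
    using col(3)[OF that] by (simp add: residual_def)
  ultimately show ?thesis by (simp add: small_demand_instance_def residual_def)
qed

text \<open>Everything is assigned to the even copy of each site, so duplicating the sites does not
  raise the LP value.\<close>

lemma lp_opt_residual_le:
  assumes v: "\<And>i j. i < num_sites I \<Longrightarrow> j < num_clients I \<Longrightarrow> 0 \<le> w i j \<and> w i j \<le> v i"
    "\<And>i. i < num_sites I \<Longrightarrow> 0 \<le> v i"
    "\<And>j. j < num_clients I \<Longrightarrow> real_of_int (int (demand I j) - taken j) \<le> (\<Sum>i<num_sites I. w i j)"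
  shows "lp_opt J \<le> lp_cost I v w"
proof -
  define v' where "v' i = (if even i then v (i div 2) else 0)" for i
  define w' where "w' i j = (if even i then w (i div 2) j else 0)" for i j
  have "lp_feasible J v' w'"
    unfolding lp_feasible_def
  proof (intro conjI ballI)
    fix i assume i: "i \<in> sites J"
    then have i2: "i div 2 < num_sites I" by (auto simp: residual_def)
    then show "0 \<le> v' i" using v(2) by (simp add: v'_def)
    fix j assume "j \<in> clients J"
    then have "j < num_clients I" by (simp add: residual_def)
    then show "0 \<le> w' i j" "w' i j \<le> v' i" using v(1)[OF i2] by (simp_all add: v'_def w'_def)
  next
    fix j assume "j \<in> clients J"
    then have j: "j < num_clients I" by (simp add: residual_def)
    have "real (demand J j) = real_of_int (int (demand I j) - taken j)"
      using col(2)[OF j] by (simp add: residual_def)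
    then show "real (demand J j) \<le> (\<Sum>i\<in>sites J. w' i j)"
      using v(3)[OF j] by (simp add: residual_def sum_twice w'_def)
  qed
  moreover have "ftfp_instance J"
    using small_demand_residual by (simp add: small_demand_instance_def)
  ultimately have "lp_opt J \<le> lp_cost J v' w'" by (rule lp_opt_le[rotated])
  then show ?thesis by (simp add: lp_cost_residual v'_def w'_def)
qed

text \<open>Demands only shrink, so every LP solution of \<open>I\<close> remains feasible. This
  covers the case of an integral part without cost, where no saving can absorb the error of the LP
  solution.\<close>

lemma residual_monotone: "lp_opt J \<le> lp_opt I"
  unfolding lp_opt_def[of I]
proof (rule cInf_greatest)
  show "{lp_cost I y x |y x. lp_feasible I y x} \<noteq> {}" using feas by blast
  fix c assume "c \<in> {lp_cost I y x |y x. lp_feasible I y x}"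
  then obtain v w where c: "c = lp_cost I v w" and vw: "lp_feasible I v w" by blast
  show "lp_opt J \<le> c"
    unfolding c
  proof (rule lp_opt_residual_le)
    fix j assume j: "j < num_clients I"
    have "0 \<le> taken j" using col(1)[OF j] by (intro sum_nonneg) auto
    then have "int (demand I j) - taken j \<le> int (demand I j)" by simp
    then have "real_of_int (int (demand I j) - taken j) \<le> real (demand I j)"
      by (metis of_int_le_iff of_int_of_nat_eq)
    also have "\<dots> \<le> (\<Sum>i<num_sites I. w i j)" using vw j by (simp add: lp_feasible_def)
    finally show "real_of_int (int (demand I j) - taken j) \<le> (\<Sum>i<num_sites I. w i j)" .
  qed (use vw in \<open>auto simp: lp_feasible_def\<close>)
qed

text \<open>What remains of \<open>(y, x)\<close>, with \<open>x\<close> capped by the remaining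
  \<open>y\<close>, is feasible for the residual demands by \<open>residual_column\<close>; its cost
  and that of the integral part add up to at most the cost of \<open>(y, x)\<close>.\<close>

lemma residual_decrease:
  "base_cost + lp_opt J \<le> lp_cost I y x"
proof -
  let ?v = "\<lambda>i. y i - round_y y i" and ?w = "\<lambda>i j. min (x i j - round_x I y x i j) (y i - round_y y i)"
  have "lp_opt J \<le> lp_cost I ?v ?w"
    by (rule lp_opt_residual_le) (use col(1,4) round_y in auto)
  then have "base_cost + lp_opt J
      \<le> lp_cost I (\<lambda>i. real_of_int (round_y y i) + ?v i) (\<lambda>i j. real_of_int (round_x I y x i j) + ?w i j)"
    unfolding lp_cost_add by simp
  also have "\<dots> \<le> lp_cost I y x"
    by (rule lp_cost_mono[OF inst]) (auto simp: min_def)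
  finally show ?thesis .
qed

lemma merge_solutions:
  assumes sol: "int_feasible J Y X"
  defines "y' \<equiv> \<lambda>i. nat (round_y y i) + Y (2 * i) + Y (Suc (2 * i))"
    and "x' \<equiv> \<lambda>i j. nat (round_x I y x i j) + X (2 * i) j + X (Suc (2 * i)) j"
  shows "int_feasible I y' x'"
    and "int_cost I y' x' = base_cost + int_cost J Y X"
proof -
  show "int_feasible I y' x'"
    unfolding int_feasible_def
  proof (intro conjI ballI)
    fix i j assume "i \<in> sites I" "j \<in> clients I"
    then have ij: "i < num_sites I" "j < num_clients I" by simp_all
    have "X k j \<le> Y k" if "k < 2 * num_sites I" for k
      using sol ij(2) that by (simp add: int_feasible_def residual_def)
    then have "X (2 * i) j \<le> Y (2 * i)" "X (Suc (2 * i)) j \<le> Y (Suc (2 * i))" using ij(1) by auto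
    moreover have "nat (round_x I y x i j) \<le> nat (round_y y i)" using col(1)[OF ij(2,1)] by auto
    ultimately show "x' i j \<le> y' i" unfolding x'_def y'_def by linarith
  next
    fix j assume "j \<in> clients I"
    then have j: "j < num_clients I" by simp
    have "nat (int (demand I j) - taken j) \<le> (\<Sum>i<2 * num_sites I. X i j)"
      using sol j by (simp add: int_feasible_def residual_def)
    then have "int (demand I j) - taken j \<le> int (\<Sum>i<2 * num_sites I. X i j)"
      by linarith
    moreover have "taken j = int (\<Sum>i<num_sites I. nat (round_x I y x i j))"
      unfolding of_nat_sum by (intro sum.cong refl) (use col(1)[OF j] in auto)
    ultimately have "demand I j \<le> (\<Sum>i<num_sites I. nat (round_x I y x i j)) + (\<Sum>i<2 * num_sites I. X i j)"
      by linarith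
    also have "\<dots> = (\<Sum>i<num_sites I. x' i j)"
      unfolding sum_twice x'_def sum.distrib by simp
    finally show "demand I j \<le> (\<Sum>i\<in>sites I. x' i j)" .
  qed
  have "int_cost I y' x' = lp_cost I (\<lambda>i. real_of_int (round_y y i) + real (Y (2 * i) + Y (Suc (2 * i))))
      (\<lambda>i j. real_of_int (round_x I y x i j) + real (X (2 * i) j + X (Suc (2 * i)) j))"
    unfolding int_cost_def lp_cost_def
    using round_y col(1) by (intro arg_cong2[of _ _ _ _ "(+)"] sum.cong refl) (auto simp: y'_def x'_def)
  then show "int_cost I y' x' = base_cost + int_cost J Y X"
    unfolding int_cost_def lp_cost_residual by (simp add: lp_cost_add)
qed

text \<open>
  If the integral part has positive cost, that cost is at least 32 units, and since it is paid
  once instead of \<open>\<rho>\<close> times, it compensates the error of 2 units in the LP solution.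
\<close>

lemma rounding_bound:
  assumes rho: "10 / 9 \<le> \<rho>" and data: "scaled_data S I D"
    and div: "\<And>i. 32 dvd vnth (fst D) i" "\<And>i j. 32 dvd vnth (rnth (fst (snd D)) i) j"
    and near: "S * lp_cost I y x \<le> S * lp_opt I + 2"
    and sol: "int_feasible J Y X" "int_cost J Y X \<le> \<rho> * lp_opt J"
  shows "base_cost + int_cost J Y X \<le> \<rho> * lp_opt I"
proof -
  let ?C = "base_cost"
  have S: "0 < S" using data by (simp add: scaled_data_def)
  define k where "k = (\<Sum>i<num_sites I. vnth (fst D) i * round_y y i) +
     (\<Sum>i<num_sites I. \<Sum>j<num_clients I. vnth (rnth (fst (snd D)) i) j * round_x I y x i j)"
  have k: "S * ?C = real_of_int k"
    unfolding scaled_cost[OF data inst sites] k_def by simp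
  have "32 dvd k" unfolding k_def using div by (intro dvd_add dvd_sum dvd_mult2) auto
  have k0: "0 \<le> k"
  proof -
    have "0 \<le> ?C"
      using inst round_y col(1) unfolding lp_cost_def ftfp_instance_def
      by (intro add_nonneg_nonneg sum_nonneg mult_nonneg_nonneg) auto
    then show ?thesis using S k by (metis mult_nonneg_nonneg of_int_0_le_iff less_imp_le)
  qed
  show ?thesis
  proof (cases "k = 0")
    case True
    then have "?C = 0" using k S by simp
    moreover have "\<rho> * lp_opt J \<le> \<rho> * lp_opt I"
      using residual_monotone rho by (intro mult_left_mono) auto
    ultimately show ?thesis using sol(2) by simp
  next
    case False
    then have "32 \<le> k" using \<open>32 dvd k\<close> k0 by (auto elim!: dvdE)
    then have C: "32 \<le> S * ?C" using k by simp
    have dec: "S * ?C + S * lp_opt J \<le> S * lp_opt I + 2"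
      using mult_left_mono[OF residual_decrease, of S] S near by (simp add: distrib_left)
    have "S * (?C + \<rho> * lp_opt J) = \<rho> * (S * ?C + S * lp_opt J) - (\<rho> - 1) * (S * ?C)"
      by (simp add: algebra_simps)
    also have "\<dots> \<le> \<rho> * (S * lp_opt I + 2) - (\<rho> - 1) * 32"
      using rho dec C by (intro diff_mono mult_left_mono) auto
    \<comment> \<open>This is \<open>2 * \<rho> \<le> 32 * (\<rho> - 1)\<close>, true for
      \<open>\<rho> \<ge> 16 / 15\<close> and hence for \<open>\<rho> \<ge> 10 / 9\<close>.\<close>
    also have "\<dots> \<le> S * (\<rho> * lp_opt I)" using rho by (simp add: algebra_simps)
    finally have "?C + \<rho> * lp_opt J \<le> \<rho> * lp_opt I" using S by simp
    then show ?thesis using sol(2) by linarith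
  qed
qed

end

section \<open>Integrality gap and reduction\<close>

definition gap_instance :: ftfp where
  "gap_instance = \<lparr>num_sites = 3, num_clients = 3, open_cost = \<lambda>i. 1,
     conn_cost = \<lambda>i j. if i = j then 3 else 1, demand = \<lambda>j. 1\<rparr>"

lemma sum_lessThan_3: "(\<Sum>i<3. f i) = f 0 + f 1 + f (2 :: nat)" for f :: "nat \<Rightarrow> 'a::comm_monoid_add"
  by (simp add: eval_nat_numeral)

lemma less_3_cases: "i < 3 \<longleftrightarrow> i = 0 \<or> i = 1 \<or> i = (2 :: nat)"
  by auto

lemma small_demand_gap_instance: "small_demand_instance gap_instance"
proof -
  \<comment> \<open>Distance 2 between distinct points of the same side satisfies both
    \<open>2 \<le> 1 + 1\<close> and \<open>3 \<le> 2 + 1\<close>.\<close>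
  define D :: "nat + nat \<Rightarrow> nat + nat \<Rightarrow> real" where
    "D a b = (case (a, b) of (Inl i, Inr j) \<Rightarrow> if i = j then 3 else 1
       | (Inr j, Inl i) \<Rightarrow> if i = j then 3 else 1 | _ \<Rightarrow> if a = b then 0 else 2)" for a b
  have "D a a = 0" "0 \<le> D a b" "D a b = D b a" for a b
    by (auto simp: D_def split: sum.splits)
  moreover have "D a c \<le> D a b + D b c" for a b c
    by (cases a; cases b; cases c) (auto simp: D_def)
  moreover have "D (Inl i) (Inr j) = of_rat (conn_cost gap_instance i j)" for i j
    by (simp add: D_def gap_instance_def)
  ultimately have "metric_costs gap_instance"
    unfolding metric_costs_def by (intro exI[of _ D]) blast
  then show ?thesis
    by (simp add: small_demand_instance_def ftfp_instance_def) (simp add: gap_instance_def)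
qed

text \<open>Opening half of each site and serving every client from its two near sites costs
  \<open>9 / 2\<close>. An integral solution opens at least two facilities and pays at least 3 for
  connections, or uses one site only, which is far from one of the clients; either way it costs at
  least 5.\<close>

lemma gap_lower_bound:
  assumes "1 \<le> \<rho>" "small_demand_lp_algorithm \<rho> A"
  shows "10 / 9 \<le> \<rho>"
proof -
  let ?G = gap_instance
  obtain y x where sol: "int_feasible ?G y x" "int_cost ?G y x \<le> \<rho> * lp_opt ?G"
    using assms(2) small_demand_gap_instance unfolding small_demand_lp_algorithm_def by blast
  have "lp_feasible ?G (\<lambda>i. 1 / 2) (\<lambda>i j. if i = j then 0 else 1 / 2)"
    unfolding lp_feasible_def by (auto simp: gap_instance_def sum_lessThan_3 less_3_cases)
  then have "lp_opt ?G \<le> lp_cost ?G (\<lambda>i. 1 / 2) (\<lambda>i j. if i = j then 0 else 1 / 2)"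
    using small_demand_gap_instance by (intro lp_opt_le) (simp_all add: small_demand_instance_def)
  also have "\<dots> = 9 / 2" by (simp add: lp_cost_def gap_instance_def sum_lessThan_3)
  finally have "\<rho> * lp_opt ?G \<le> \<rho> * (9 / 2)" using assms(1) by (intro mult_left_mono) auto
  moreover have "5 \<le> int_cost ?G y x"
  proof -
    have le: "\<And>i j. i < 3 \<Longrightarrow> j < 3 \<Longrightarrow> x i j \<le> y i" and cover: "\<And>j. j < 3 \<Longrightarrow> 1 \<le> x 0 j + x 1 j + x 2 j"
      using sol(1) by (auto simp: int_feasible_def gap_instance_def sum_lessThan_3)
    have "5 \<le> y 0 + y 1 + y 2 + (3 * x 0 0 + x 0 1 + x 0 2 + (x 1 0 + 3 * x 1 1 + x 1 2) + (x 2 0 + x 2 1 + 3 * x 2 2))"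
    proof -
      have cov: "1 \<le> x 0 0 + x 1 0 + x 2 0" "1 \<le> x 0 1 + x 1 1 + x 2 1" "1 \<le> x 0 2 + x 1 2 + x 2 2"
        by (rule cover, simp)+
      \<comment> \<open>In the last three cases a single site serves everybody, and the connections
        alone cost \<open>1 + 1 + 3\<close>.\<close>
      consider "2 \<le> y 0 + y 1 + y 2" | "y 0 = 0" "y 1 = 0" | "y 0 = 0" "y 2 = 0" | "y 1 = 0" "y 2 = 0"
        by linarith
      then show ?thesis
      proof cases
        case 1
        then show ?thesis using cov by linarith
      next
        case 2
        then have "x 0 j = 0" "x 1 j = 0" if "j < 3" for j using le[of 0 j] le[of 1 j] that by auto
        from this[of 0] this[of 1] this[of 2]
        show ?thesis using cov by linarith
      next
        case 3
        then have "x 0 j = 0" "x 2 j = 0" if "j < 3" for j using le[of 0 j] le[of 2 j] that by auto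
        from this[of 0] this[of 1] this[of 2]
        show ?thesis using cov by linarith
      next
        case 4
        then have "x 1 j = 0" "x 2 j = 0" if "j < 3" for j using le[of 1 j] le[of 2 j] that by auto
        from this[of 0] this[of 1] this[of 2]
        show ?thesis using cov by linarith
      qed
    qed
    then have "real 5 \<le> real (y 0 + y 1 + y 2 + (3 * x 0 0 + x 0 1 + x 0 2 + (x 1 0 + 3 * x 1 1 + x 1 2) + (x 2 0 + x 2 1 + 3 * x 2 2)))"
      by (simp only: of_nat_le_iff)
    then show ?thesis
      by (simp add: int_cost_def lp_cost_def gap_instance_def sum_lessThan_3)
  qed
  ultimately show ?thesis using sol(2) by linarith
qed

section \<open>Instances and solutions as program data\<close>

type_synonym raw_data = "(int \<times> int) list \<times> (int \<times> int) list list \<times> int list"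

definition raw_of :: "ftfp \<Rightarrow> raw_data" where
  "raw_of I = (map (\<lambda>i. quotient_of (open_cost I i)) [0..<num_sites I],
     map (\<lambda>i. map (\<lambda>j. quotient_of (conn_cost I i j)) [0..<num_clients I]) [0..<num_sites I],
     map (\<lambda>j. int (demand I j)) [0..<num_clients I])"

definition sol_of :: "ftfp \<Rightarrow> (nat \<Rightarrow> nat) \<Rightarrow> (nat \<Rightarrow> nat \<Rightarrow> nat) \<Rightarrow> int list \<times> int list list" where
  "sol_of I y x = (map (\<lambda>i. int (y i)) [0..<num_sites I],
     map (\<lambda>i. map (\<lambda>j. int (x i j)) [0..<num_clients I]) [0..<num_sites I])"

lemma encode_raw_of: "encode (raw_of I) = enc_instance I"
  by (simp add: raw_of_def enc_instance_def encode_prod_def encode_list_def enc_vec_def enc_mat_def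
      enc_rat_def enc_nat_def encode_int_def o_def)

lemma encode_sol_of: "encode (sol_of I y x) = enc_solution I y x"
  by (simp add: sol_of_def enc_solution_def encode_prod_def encode_list_def enc_vec_def enc_mat_def
      enc_nat_def encode_int_def o_def)

lemma inj_encode_int: "inj (encode :: int \<Rightarrow> tree)"
  by (simp add: inj_def encode_int_def)

lemma inj_encode_list: "inj (encode :: 'a::tree_code \<Rightarrow> tree) \<Longrightarrow> inj (encode :: 'a list \<Rightarrow> tree)"
proof (rule injI)
  fix xs ys :: "'a list"
  assume "inj (encode :: 'a \<Rightarrow> tree)" "encode xs = encode ys"
  then show "xs = ys"
  proof (induction xs arbitrary: ys)
    case Nil
    then show ?case by (cases ys) (auto simp: encode_list_def)
  next
    case (Cons a xs)
    then show ?case by (cases ys) (auto simp: encode_list_def dest: injD)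
  qed
qed

lemma encode_sol_inject: "encode s = encode s' \<Longrightarrow> s = s'" for s s' :: "int list \<times> int list list"
  using inj_encode_list[OF inj_encode_int] inj_encode_list[OF inj_encode_list[OF inj_encode_int]]
  by (simp add: encode_prod_def prod_eq_iff inj_eq)

text \<open>The plain product of all denominators is good enough as a common multiple: its bit
  length is at most about the sum of theirs.\<close>

definition denom :: "raw_data \<Rightarrow> int" where
  "denom z = prod_list (map snd (fst z)) * prod_list (map (\<lambda>u. prod_list (map snd u)) (fst (snd z)))"

text \<open>After clearing denominators, the factor 32 makes every nonzero cost of an integral
  solution at least 32, well above the error 2 of the LP solution.\<close>

definition scaled :: "raw_data \<Rightarrow> lp_data" where
  "scaled z = (let d = denom z in
     (map (\<lambda>q. 32 * (fst q * (d div snd q))) (fst z),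
      map (\<lambda>u. map (\<lambda>q. 32 * (fst q * (d div snd q))) u) (fst (snd z)), snd (snd z)))"

lemma dvd_prod_list: "a \<in> set l \<Longrightarrow> a dvd prod_list l" for a :: int
  by (induction l) auto

lemma prod_list_pos: "(\<And>a. a \<in> set l \<Longrightarrow> 0 < a) \<Longrightarrow> 0 < prod_list l" for l :: "int list"
  by (induction l) auto

lemma denom_pos: "0 < denom (raw_of I)"
  unfolding denom_def raw_of_def
  by (intro mult_pos_pos prod_list_pos) (auto intro!: prod_list_pos quotient_of_denom_pos')

lemma scaled_entry:
  assumes "snd (quotient_of r) dvd d"
  shows "real_of_int (32 * (fst (quotient_of r) * (d div snd (quotient_of r)))) = 32 * real_of_int d * of_rat r"
proof -
  obtain a b where q: "quotient_of r = (a, b)" by (cases "quotient_of r")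
  have b: "0 < b" using quotient_of_denom_pos[OF q] .
  have "r = of_int a / of_int b" using quotient_of_div[OF q] .
  then have "(of_rat r :: real) = real_of_int a / real_of_int b"
    by (simp add: of_rat_divide)
  moreover have "real_of_int (d div b) = real_of_int d / real_of_int b"
    using assms by (simp add: q real_of_int_div)
  ultimately show ?thesis by (simp add: q)
qed

lemma scaled_data_raw_of: "scaled_data (32 * real_of_int (denom (raw_of I))) I (scaled (raw_of I))"
  unfolding scaled_data_def
proof (intro conjI allI impI)
  show "0 < 32 * real_of_int (denom (raw_of I))" using denom_pos by simp
  show "length (fst (scaled (raw_of I))) = num_sites I" "length (snd (snd (scaled (raw_of I)))) = num_clients I"
    by (simp_all add: scaled_def raw_of_def Let_def)
  fix i assume i: "i < num_sites I"
  have "snd (quotient_of (open_cost I i)) dvd prod_list (map snd (fst (raw_of I)))"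
    using i by (intro dvd_prod_list) (auto simp: raw_of_def)
  then have "snd (quotient_of (open_cost I i)) dvd denom (raw_of I)" by (simp add: denom_def)
  from scaled_entry[OF this]
  show "real_of_int (vnth (fst (scaled (raw_of I))) i) = 32 * real_of_int (denom (raw_of I)) * of_rat (open_cost I i)"
    using i by (simp add: scaled_def Let_def raw_of_def[of I] nth_default_def del: of_int_mult)
  fix j assume j: "j < num_clients I"
  have "snd (quotient_of (conn_cost I i j)) dvd prod_list (map snd (fst (snd (raw_of I)) ! i))"
    using i j by (intro dvd_prod_list) (auto simp: raw_of_def)
  also have "\<dots> dvd prod_list (map (\<lambda>u. prod_list (map snd u)) (fst (snd (raw_of I))))"
    using i by (intro dvd_prod_list) (auto simp: raw_of_def)
  finally have "snd (quotient_of (conn_cost I i j)) dvd denom (raw_of I)" by (simp add: denom_def)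
  from scaled_entry[OF this]
  show "real_of_int (vnth (rnth (fst (snd (scaled (raw_of I)))) i) j)
      = 32 * real_of_int (denom (raw_of I)) * of_rat (conn_cost I i j)"
    using i j by (simp add: scaled_def Let_def raw_of_def[of I] nth_default_def del: of_int_mult)
next
  fix j assume "j < num_clients I"
  then show "vnth (snd (snd (scaled (raw_of I)))) j = int (demand I j)"
    by (simp add: scaled_def Let_def raw_of_def)
qed

lemma scaled_dvd: "32 dvd vnth (fst (scaled z)) i" "32 dvd vnth (rnth (fst (snd (scaled z))) i) j"
  by (auto simp: scaled_def Let_def nth_default_def)

lemma ptime_scaled [pt]: "ptime A f \<Longrightarrow> ptime A (\<lambda>x. scaled (f x))"
  by (erule ptime_compose_UNIV[rotated]) (unfold scaled_def denom_def, intro pt)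

definition open_list :: "lp_data \<Rightarrow> int list \<Rightarrow> int list" where
  "open_list D q = (let F = length (fst D); C = length (snd (snd D)) in
     map (\<lambda>i. max 0 (vnth q (F * C + i) div vnth q (F * C + F) - 1)) [0..<F])"

definition floor_mat :: "lp_data \<Rightarrow> int list \<Rightarrow> int list list" where
  "floor_mat D q = (let F = length (fst D); C = length (snd (snd D)); u = open_list D q in
     map (\<lambda>i. map (\<lambda>j. min (vnth q (i * C + j) div vnth q (F * C + F)) (vnth u i)) [0..<C]) [0..<F])"

definition conn_mat :: "lp_data \<Rightarrow> int list \<Rightarrow> int list list" where
  "conn_mat D q = (let F = length (fst D); C = length (snd (snd D)); M = floor_mat D q in
     map (\<lambda>i. map (\<lambda>j. max 0 (min (vnth (rnth M i) j)
       (vnth (snd (snd D)) j - 1 - (\<Sum>k\<leftarrow>[0..<F]. if k < i then vnth (rnth M k) j else 0)))) [0..<C]) [0..<F])"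

definition residual_demands :: "lp_data \<Rightarrow> int list list \<Rightarrow> int list" where
  "residual_demands D X = map (\<lambda>j. vnth (snd (snd D)) j - (\<Sum>i\<leftarrow>[0..<length (fst D)]. vnth (rnth X i) j))
     [0..<length (snd (snd D))]"

definition reduce :: "raw_data \<Rightarrow> raw_data" where
  "reduce z = (let D = scaled z; X = conn_mat D (lp_solution D) in
     (map (\<lambda>i. nth_default (0, 1) (fst z) (i div 2)) [0..<2 * length (fst z)],
      map (\<lambda>i. rnth (fst (snd z)) (i div 2)) [0..<2 * length (fst z)], residual_demands D X))"

definition combine :: "raw_data \<Rightarrow> int list \<times> int list list \<Rightarrow> int list \<times> int list list" where
  "combine z s = (let D = scaled z; q = lp_solution D; Y = open_list D q; X = conn_mat D q;
       F = length (fst D); C = length (snd (snd D)) in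
     (map (\<lambda>i. vnth Y i + vnth (fst s) (2 * i) + vnth (fst s) (Suc (2 * i))) [0..<F],
      map (\<lambda>i. map (\<lambda>j. vnth (rnth X i) j + vnth (rnth (snd s) (2 * i)) j + vnth (rnth (snd s) (Suc (2 * i))) j)
        [0..<C]) [0..<F]))"

lemma ptime_open_list [pt]: "ptime A f \<Longrightarrow> ptime A g \<Longrightarrow> ptime A (\<lambda>x. open_list (f x) (g x))"
  by (erule (1) ptime_compose2[rotated]) (unfold open_list_def Let_def, intro pt)

lemma ptime_floor_mat [pt]: "ptime A f \<Longrightarrow> ptime A g \<Longrightarrow> ptime A (\<lambda>x. floor_mat (f x) (g x))"
  by (erule (1) ptime_compose2[rotated]) (unfold floor_mat_def Let_def, intro pt)

lemma ptime_conn_mat [pt]: "ptime A f \<Longrightarrow> ptime A g \<Longrightarrow> ptime A (\<lambda>x. conn_mat (f x) (g x))"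
  by (erule (1) ptime_compose2[rotated]) (unfold conn_mat_def Let_def, intro pt)

lemma ptime_residual_demands [pt]: "ptime A f \<Longrightarrow> ptime A g \<Longrightarrow> ptime A (\<lambda>x. residual_demands (f x) (g x))"
  by (erule (1) ptime_compose2[rotated]) (unfold residual_demands_def, intro pt)

lemma ptime_reduce: "ptime A reduce"
  unfolding reduce_def Let_def by (rule ptime_mono[of UNIV]) (intro pt, simp)

lemma ptime_combine: "ptime UNIV (\<lambda>p. combine (fst p) (snd p))"
  unfolding combine_def Let_def by (intro pt)

context
  fixes I :: ftfp and q :: "int list" and D :: lp_data
  defines "D \<equiv> scaled (raw_of I)"
  defines "q \<equiv> lp_solution D"
begin

private lemma lens: "length (fst D) = num_sites I" "length (snd (snd D)) = num_clients I"
  "j < num_clients I \<Longrightarrow> vnth (snd (snd D)) j = int (demand I j)"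
  using scaled_data_raw_of[of I] by (simp_all add: scaled_data_def D_def)

private lemma open_list_eq: "i < num_sites I \<Longrightarrow> vnth (open_list D q) i = round_y (frac_y I q) i"
  by (simp add: open_list_def Let_def lens round_y_def frac_y_def floor_divide_of_int_eq)

private lemma floor_mat_eq:
  "i < num_sites I \<Longrightarrow> j < num_clients I \<Longrightarrow> vnth (rnth (floor_mat D q) i) j = floor_x (frac_y I q) (frac_x I q) i j"
  by (simp add: floor_mat_def Let_def lens open_list_eq floor_x_def frac_x_def floor_divide_of_int_eq)

private lemma conn_mat_eq:
  assumes "i < num_sites I" "j < num_clients I"
  shows "vnth (rnth (conn_mat D q) i) j = round_x I (frac_y I q) (frac_x I q) i j"
proof -
  have "(\<Sum>k<num_sites I. if k < i then vnth (rnth (floor_mat D q) k) j else 0)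
      = (\<Sum>k<i. floor_x (frac_y I q) (frac_x I q) k j)"
    by (rule sum.mono_neutral_cong_right) (use assms in \<open>auto simp: floor_mat_eq\<close>)
  then show ?thesis
    using assms by (simp add: conn_mat_def Let_def lens floor_mat_eq round_x_def)
qed

lemma reduce_raw_of:
  assumes "ftfp_instance I" "0 < num_sites I"
  shows "reduce (raw_of I) = raw_of (residual I (frac_y I q) (frac_x I q))"
    and "small_demand_instance (residual I (frac_y I q) (frac_x I q))"
proof -
  note sol = lp_solution_correct[OF scaled_data_raw_of assms, folded D_def, folded q_def]
  show small: "small_demand_instance (residual I (frac_y I q) (frac_x I q))"
    by (rule small_demand_residual[OF assms sol(1)])
  have pos: "0 < demand (residual I (frac_y I q) (frac_x I q)) j" if "j < num_clients I" for j
    using small that by (simp add: small_demand_instance_def ftfp_instance_def residual_def)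
  have "vnth (snd (snd D)) j - (\<Sum>i<num_sites I. vnth (rnth (conn_mat D q) i) j)
      = int (demand (residual I (frac_y I q) (frac_x I q)) j)" if "j < num_clients I" for j
    using pos[OF that] that by (simp add: lens conn_mat_eq residual_def)
  then show "reduce (raw_of I) = raw_of (residual I (frac_y I q) (frac_x I q))"
    unfolding reduce_def Let_def D_def[symmetric] q_def[symmetric]
    by (auto simp: raw_of_def residual_def residual_demands_def lens nth_default_def)
qed

lemma combine_raw_of:
  assumes inst: "ftfp_instance I" "0 < num_sites I" and rho: "10 / 9 \<le> \<rho>"
  defines "I' \<equiv> residual I (frac_y I q) (frac_x I q)"
  assumes sol: "int_feasible I' Y X" "int_cost I' Y X \<le> \<rho> * lp_opt I'"
  shows "\<exists>y x. combine (raw_of I) (sol_of I' Y X) = sol_of I y x \<and> int_feasible I y x \<and>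
    int_cost I y x \<le> \<rho> * lp_opt I"
proof -
  note lp = lp_solution_correct[OF scaled_data_raw_of inst, folded D_def, folded q_def]
  let ?y = "\<lambda>i. nat (round_y (frac_y I q) i) + Y (2 * i) + Y (Suc (2 * i))"
  let ?x = "\<lambda>i j. nat (round_x I (frac_y I q) (frac_x I q) i j) + X (2 * i) j + X (Suc (2 * i)) j"
  note merge = merge_solutions[OF inst lp(1) sol(1)[unfolded I'_def]]
  have "int_cost I ?y ?x \<le> \<rho> * lp_opt I"
    unfolding merge(2)
    using rounding_bound[OF inst lp(1) rho scaled_data_raw_of scaled_dvd _ sol[unfolded I'_def]] lp(2)
    by (simp add: D_def)
  moreover have "combine (raw_of I) (sol_of I' Y X) = sol_of I ?y ?x"
  proof -
    have "0 \<le> round_y (frac_y I q) i" "0 \<le> round_x I (frac_y I q) (frac_x I q) i j" for i j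
      by (simp_all add: round_y_def round_x_def)
    then show ?thesis
      unfolding combine_def Let_def D_def[symmetric] q_def[symmetric]
      by (simp add: sol_of_def lens open_list_eq conn_mat_eq I'_def residual_def)
  qed
  ultimately show ?thesis using merge(1) by blast
qed

end

section \<open>The reduction as a program\<close>

lemma lp_opt_le_int_opt:
  assumes "ftfp_instance I" "int_feasible I y x"
  shows "lp_opt I \<le> int_opt I"
  unfolding int_opt_def
proof (rule cInf_greatest)
  show "{int_cost I y x |y x. int_feasible I y x} \<noteq> {}" using assms(2) by blast
  fix c assume "c \<in> {int_cost I y x |y x. int_feasible I y x}"
  then obtain v w where c: "c = int_cost I v w" and vw: "int_feasible I v w" by blast
  have "lp_feasible I (\<lambda>i. real (v i)) (\<lambda>i j. real (w i j))"
    using vw unfolding lp_feasible_def int_feasible_def of_nat_sum[symmetric] of_nat_le_iff by simp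
  then show "lp_opt I \<le> c" unfolding c int_cost_def by (rule lp_opt_le[OF assms(1)])
qed

text \<open>The algorithm is given only through its runs; the choice operator turns it into a
  function on data. Runs are deterministic, so on instances with small demands this is the promised
  solution.\<close>

definition small_output :: "prog \<Rightarrow> raw_data \<Rightarrow> int list \<times> int list list" where
  "small_output A z = (SOME s. returns A (encode z) (encode s))"

text \<open>Instances without sites are treated separately because the LP solver presupposes a site.
  Such an instance is feasible only without clients, and then the pair of empty lists encodes a
  solution of cost 0.\<close>

definition reduction :: "prog \<Rightarrow> raw_data \<Rightarrow> int list \<times> int list list" where
  "reduction A z = (if fst z = [] then ([], []) else combine z (small_output A (reduce z)))"

context
  fixes \<rho> :: real and A :: prog
  assumes alg: "small_demand_lp_algorithm \<rho> A"
begin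

private lemma small_output:
  assumes "small_demand_instance I"
  obtains y x where "small_output A (raw_of I) = sol_of I y x" "int_feasible I y x"
    "int_cost I y x \<le> \<rho> * lp_opt I" "returns A (encode (raw_of I)) (encode (small_output A (raw_of I)))"
proof -
  obtain y x where *: "returns A (encode (raw_of I)) (encode (sol_of I y x))" "int_feasible I y x"
      "int_cost I y x \<le> \<rho> * lp_opt I"
    using alg assms unfolding small_demand_lp_algorithm_def encode_raw_of encode_sol_of by blast
  then have ret: "returns A (encode (raw_of I)) (encode (small_output A (raw_of I)))"
    unfolding small_output_def by (rule_tac someI)
  then have "small_output A (raw_of I) = sol_of I y x"
    using *(1) run_deterministic encode_sol_inject unfolding returns_def by blast
  then show ?thesis using that * ret by blast
qed

private lemma ptime_small_output: "ptime (raw_of ` {I. small_demand_instance I}) (small_output A)"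
proof -
  obtain p :: "nat poly" where p: "\<forall>u\<in>enc_instance ` {I. small_demand_instance I}.
      \<exists>v t. run A u v t \<and> t \<le> poly p (tsize u)"
    using alg unfolding small_demand_lp_algorithm_def polytime_on_def by blast
  have "\<exists>t. run A (encode z) (encode (small_output A z)) t \<and> t \<le> poly p (csize z)"
    if z: "z \<in> raw_of ` {I. small_demand_instance I}" for z
  proof -
    obtain I where I: "z = raw_of I" "small_demand_instance I" using z by blast
    have "encode z \<in> enc_instance ` {I. small_demand_instance I}" using I by (simp add: encode_raw_of)
    then obtain v t where vt: "run A (encode z) v t" "t \<le> poly p (csize z)" using p by blast
    moreover obtain t' where "run A (encode z) (encode (small_output A z)) t'"
      using small_output[OF I(2)] unfolding I(1) returns_def by blast
    ultimately show ?thesis using run_deterministic[of A "encode z" v t] by auto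
  qed
  then show ?thesis unfolding ptime_def by (intro exI[of _ A] exI[of _ p]) blast
qed

private lemma ptime_reduction: "ptime (raw_of ` {I. ftfp_instance I}) (reduction A)"
  unfolding reduction_def
proof (rule ptime_if_set)
  let ?U = "{z \<in> raw_of ` {I. ftfp_instance I}. fst z \<noteq> []}"
  have "ptime ?U (\<lambda>z. small_output A (reduce z))"
  proof (rule ptime_compose[OF ptime_small_output ptime_reduce])
    fix z assume "z \<in> ?U"
    then obtain I where "z = raw_of I" "ftfp_instance I" "0 < num_sites I"
      by (auto simp: raw_of_def)
    then show "reduce z \<in> raw_of ` {I. small_demand_instance I}"
      using reduce_raw_of[of I] by blast
  qed
  then have "ptime ?U (\<lambda>z. (z, small_output A (reduce z)))" by (intro ptime_pair ptime_ident)
  from ptime_compose_UNIV[OF ptime_combine this]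
  show "ptime ?U (\<lambda>z. combine z (small_output A (reduce z)))" by simp
qed (intro pt)+

lemma approx_algorithm_exists:
  assumes rho: "1 \<le> \<rho>"
  shows "\<exists>A'. approx_algorithm \<rho> A'"
proof -
  obtain P q where P: "\<forall>z\<in>raw_of ` {I. ftfp_instance I}.
      \<exists>t. run P (encode z) (encode (reduction A z)) t \<and> t \<le> poly q (csize z)"
    using ptime_reduction unfolding ptime_def by blast
  have gap: "10 / 9 \<le> \<rho>" by (rule gap_lower_bound[OF rho alg])
  have "polytime_on (enc_instance ` {I. ftfp_instance I}) P"
    unfolding polytime_on_def
  proof (intro exI[of _ q] ballI)
    fix u assume "u \<in> enc_instance ` {I. ftfp_instance I}"
    then obtain I where "u = encode (raw_of I)" "ftfp_instance I" by (auto simp: encode_raw_of)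
    then show "\<exists>v t. run P u v t \<and> t \<le> poly q (tsize u)" using P by blast
  qed
  moreover have "\<exists>y x. returns P (enc_instance I) (enc_solution I y x) \<and> int_feasible I y x \<and>
      int_cost I y x \<le> \<rho> * int_opt I"
    if inst: "ftfp_instance I" and feas: "int_feasible I v w" for I v w
  proof -
    have ret: "returns P (enc_instance I) (encode (reduction A (raw_of I)))"
      using P inst unfolding returns_def encode_raw_of[symmetric] by blast
    show ?thesis
    proof (cases "num_sites I = 0")
      case True
      have "num_clients I = 0"
        using feas inst True by (auto simp: int_feasible_def ftfp_instance_def)
      then have "int_feasible I (\<lambda>i. 0) (\<lambda>i j. 0)" "reduction A (raw_of I) = sol_of I (\<lambda>i. 0) (\<lambda>i j. 0)"
        "int_cost I y x = 0" for y x
        using True by (simp_all add: int_feasible_def reduction_def raw_of_def sol_of_def int_cost_def lp_cost_def)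
      moreover from this have "int_opt I = 0"
        unfolding int_opt_def using feas by (auto simp: image_def intro!: cInf_eq_non_empty)
      ultimately show ?thesis using ret unfolding encode_sol_of[symmetric] by (metis mult_zero_right order_refl)
    next
      case False
      then have sites: "0 < num_sites I" by simp
      note red = reduce_raw_of[OF inst sites]
      let ?q = "lp_solution (scaled (raw_of I))"
      let ?J = "residual I (frac_y I ?q) (frac_x I ?q)"
      obtain Y X where YX: "small_output A (reduce (raw_of I)) = sol_of ?J Y X"
        "int_feasible ?J Y X" "int_cost ?J Y X \<le> \<rho> * lp_opt ?J"
        using small_output[OF red(2)] unfolding red(1) by metis
      obtain y x where yx: "combine (raw_of I) (small_output A (reduce (raw_of I))) = sol_of I y x"
        "int_feasible I y x" "int_cost I y x \<le> \<rho> * lp_opt I"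
        using combine_raw_of[OF inst sites gap YX(2,3)] unfolding YX(1) by blast
      have "reduction A (raw_of I) = sol_of I y x"
        using yx(1) sites by (simp add: reduction_def raw_of_def)
      moreover have "\<rho> * lp_opt I \<le> \<rho> * int_opt I"
        using lp_opt_le_int_opt[OF inst feas] rho by (intro mult_left_mono) auto
      ultimately show ?thesis using ret yx(2,3) unfolding encode_sol_of[symmetric] by (metis order_trans)
    qed
  qed
  ultimately show ?thesis unfolding approx_algorithm_def by blast
qed

end

theorem theorem2:
  fixes \<rho> :: real
  assumes "\<rho> \<ge> 1"
    and "\<exists>A. small_demand_lp_algorithm \<rho> A"
  shows "\<exists>A'. approx_algorithm \<rho> A'"
  using assms approx_algorithm_exists by blast

end
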